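(* Let $\ell\equiv 5\pmod 8$ be a prime such that $2\in\mathbf{R}_{\mathbb{Q}(\zeta_\ell^+)/\mathbb{Q}}$. Then the class number of $\mathbb{Q}(\sqrt{\ell})$ is trivial outside $(\ell-1)/4$, i.e. every prime dividing this class number divides $(\ell-1)/4$. In particular, the class number of $\mathbb{Q}(\sqrt{\ell})$ is odd.
   Context: Here $\mathbb{Q}(\zeta_\ell^+)$ denotes the maximal real subfield of the cyclotomic field $\mathbb{Q}(\zeta_\ell)$ ($\zeta_\ell$ a primitive $\ell$-th root of unity). For a Galois extension of number fields $L/K$, the residue degree of a prime ideal $\wp$ of $L$ above a prime $\mathfrak{p}$ of $K$ is $[\mathcal{O}_L/\wp:\mathcal{O}_K/\mathfrak{p}]$, and $$\mathbf{R}_{L/K}=\{f\in\mathbb{N}: \text{the class group of } L \text{ is generated by the classes of prime ideals of } L \text{ that are unramified over } K \text{ and have residue degree } f \text{ for } L/K\}.$$ *)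

theory Defs
  imports
    Complex_Main
    "HOL-Number_Theory.Cong"
    "HOL-Computational_Algebra.Polynomial"
    "HOL-Computational_Algebra.Primes"
    "HOL-Algebra.Algebra"
    "HOL-Algebra.Algebraic_Closure_Type"
begin

text \<open>Number fields are represented by subsets of the complex numbers, closed under the
  field operations of \<open>complex_field\<close>.\<close>

abbreviation complex_field :: "complex ring" where
  "complex_field \<equiv> ring_of_type_algebra"

text \<open>The smallest subfield of the complex numbers containing \<open>S\<close>; since it contains
  the rationals, this is \<open>\<rat>(S)\<close>.\<close>

definition rat_adjoin :: "complex set \<Rightarrow> complex set" where
  "rat_adjoin S = generate_field complex_field S"

definition primitive_root_of_unity :: "nat \<Rightarrow> complex \<Rightarrow> bool" where
  "primitive_root_of_unity n z \<longleftrightarrow> n > 0 \<and> z ^ n = 1 \<and> (\<forall>k. 0 < k \<and> k < n \<longrightarrow> z ^ k \<noteq> 1)"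

definition maximal_real_subfield :: "complex set \<Rightarrow> complex set" where
  "maximal_real_subfield K = K \<inter> \<real>"

definition integers_of :: "complex set \<Rightarrow> complex set" where
  "integers_of K = {x \<in> K. algebraic_int x}"

definition integer_ring :: "complex set \<Rightarrow> complex ring" where
  "integer_ring K = complex_field\<lparr>carrier := integers_of K\<rparr>"

subsection \<open>The class group\<close>

definition fractional_ideal :: "complex set \<Rightarrow> complex set \<Rightarrow> bool" where
  "fractional_ideal K I \<longleftrightarrow>
     I \<subseteq> K \<and> I \<noteq> {0} \<and> subgroup I (add_monoid complex_field) \<and>
     (\<forall>a\<in>integers_of K. \<forall>x\<in>I. a * x \<in> I) \<and>
     (\<exists>d\<in>integers_of K. d \<noteq> 0 \<and> (\<forall>x\<in>I. d * x \<in> integers_of K))"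

text \<open>\<open>ideal_prod complex_field I J\<close> is the set of nonempty finite sums of products of an
  element of \<open>I\<close> and an element of \<open>J\<close>; the ambient ring enters only through its operations.\<close>

definition fractional_ideals :: "complex set \<Rightarrow> complex set monoid" where
  "fractional_ideals K =
     \<lparr>carrier = {I. fractional_ideal K I}, mult = ideal_prod complex_field, one = integers_of K\<rparr>"

definition principal_fractional_ideals :: "complex set \<Rightarrow> complex set set" where
  "principal_fractional_ideals K = {(\<lambda>x. a * x) ` integers_of K |a. a \<in> K \<and> a \<noteq> 0}"

definition class_group :: "complex set \<Rightarrow> complex set set monoid" where
  "class_group K = fractional_ideals K Mod principal_fractional_ideals K"

definition ideal_class :: "complex set \<Rightarrow> complex set \<Rightarrow> complex set set" where
  "ideal_class K I = principal_fractional_ideals K #>\<^bsub>fractional_ideals K\<^esub> I"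

definition class_number :: "complex set \<Rightarrow> nat" where
  "class_number K = Coset.order (class_group K)"

subsection \<open>Primes in an extension \<open>K \<subseteq> L\<close>\<close>

definition primes_of :: "complex set \<Rightarrow> complex set set" where
  "primes_of L = {P. primeideal P (integer_ring L) \<and> P \<noteq> {0}}"

definition prime_below :: "complex set \<Rightarrow> complex set \<Rightarrow> complex set" where
  "prime_below K P = P \<inter> integers_of K"

text \<open>The exponent of \<open>P\<close> in the factorisation of the extension to \<open>L\<close> of the prime below
  \<open>P\<close>. Powers are taken in the group of fractional ideals.\<close>

definition ramification_index :: "complex set \<Rightarrow> complex set \<Rightarrow> complex set \<Rightarrow> nat" where
  "ramification_index L K P =
     (GREATEST e. \<exists>J. ideal J (integer_ring L) \<and>
        Idl\<^bsub>integer_ring L\<^esub> (prime_below K P) =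
          ideal_prod (integer_ring L) (P [^]\<^bsub>fractional_ideals L\<^esub> e) J)"

definition unramified :: "complex set \<Rightarrow> complex set \<Rightarrow> complex set \<Rightarrow> bool" where
  "unramified L K P \<longleftrightarrow> ramification_index L K P = 1"

text \<open>The residue field of the prime of \<open>K\<close> below \<open>P\<close> is identified with its image
  under the canonical embedding of residue fields, that is, with the image of the integers of
  \<open>K\<close> in the residue field of \<open>P\<close>.\<close>

definition residue_degree :: "complex set \<Rightarrow> complex set \<Rightarrow> complex set \<Rightarrow> nat" where
  "residue_degree L K P =
     (let F = integer_ring L Quot P;
          k = (\<lambda>x. P +>\<^bsub>integer_ring L\<^esub> x) ` integers_of K
      in ring.dim F k (carrier F))"

text \<open>The set written \<open>\<^bold>R\<close> with index \<open>L/K\<close>.\<close>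

definition generating_residue_degrees :: "complex set \<Rightarrow> complex set \<Rightarrow> nat set" where
  "generating_residue_degrees L K =
     {f. generate (class_group L)
           {ideal_class L P |P. P \<in> primes_of L \<and> unramified L K P \<and> residue_degree L K P = f}
         = carrier (class_group L)}"

end

theory Submission
  imports
    Defs
    "Jordan_Normal_Form.Char_Poly"
    "HOL-Number_Theory.Residue_Primitive_Roots"
begin

text \<open>Write \<open>L\<close> for the maximal real subfield, \<open>K = \<rat>(\<surd>l) \<subseteq> L\<close>, and \<open>n = (l - 1) / 4 = [L : K]\<close>, which is odd.
  A prime \<open>P\<close> of \<open>L\<close> over \<open>p\<close> of residue degree two forces \<open>p\<^sup>2 \<equiv> -1\<close> modulo \<open>l\<close>, so \<open>p\<close> is a
  non-residue modulo \<open>l\<close>, the Frobenius at \<open>P\<close> generates the decomposition group, and the norm of \<open>P\<close> to \<open>K\<close>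
  is \<open>(p)\<close>. As such primes generate the class group of \<open>L\<close>, the norm of every ideal of \<open>L\<close> is principal, generated by
  an element of \<open>K\<close>; on an ideal extended from \<open>K\<close> the norm is the \<open>n\<close>-th power. Hence \<open>n\<close> kills the
  class group of \<open>K\<close>, which is finite, and Cauchy's theorem applies.

  Invertibility of fractional ideals and finiteness of the class group are obtained together from
  Hurwitz's approximation argument: finitely many ideals represent all classes, so two powers of an
  ideal are equivalent, and Nakayama's lemma turns this into an inverse.\<close>
subsection \<open>Algebraic integers\<close>

text \<open>Why the steps of the overview hold. The Galois group of \<open>L\<close> over the
  rationals is the group of units modulo \<open>l\<close> up to sign, and the Frobenius at
  \<open>P\<close> is the class of \<open>p\<close>. Residue degree two makes its order two:
  \<open>p\<close> is not 1 or -1 modulo \<open>l\<close>, but its square is. The square cannot be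
  1, so it is -1. As \<open>n\<close> is odd, p^h = (-1)^n = -1 for h = (l - 1) / 2, and Euler's
  criterion makes \<open>p\<close> a non-residue. Frobenius thus moves \<open>K\<close>, the
  stabiliser of \<open>P\<close> meets the Galois group of \<open>L\<close> over \<open>K\<close>
  trivially, and the \<open>n\<close> conjugates of \<open>P\<close> over \<open>K\<close> are
  distinct. They are all the primes above \<open>p\<close>, each of multiplicity one, with product
  \<open>(p)\<close>. The congruence of \<open>l\<close> modulo 8 enters twice: it makes -1 a
  square, which puts \<open>K\<close> inside the real field \<open>L\<close>, and it makes
  \<open>n\<close> odd. The obstacle is to control integers, automorphisms and norms of both fields.
  All come from the cyclotomic field \<open>E\<close>: its integers are shown to be \<int>[\<zeta>]
  through divisibility by 1 - \<zeta>, its automorphisms send \<zeta> to a power \<zeta>^a, and the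
  subfields only use restrictions of these.\<close>

definition zspan :: "complex set \<Rightarrow> complex set" where
  "zspan S = range (\<lambda>a. \<Sum>s\<in>S. of_int (a s) * s)"

lemma zspanI: "x = (\<Sum>s\<in>S. of_int (a s) * s) \<Longrightarrow> x \<in> zspan S"
  by (simp add: zspan_def)

lemma zspan_add:
  assumes "x \<in> zspan S" "y \<in> zspan S" shows "x + y \<in> zspan S"
proof -
  obtain a b where "x = (\<Sum>s\<in>S. of_int (a s) * s)" "y = (\<Sum>s\<in>S. of_int (b s) * s)"
    using assms by (auto simp: zspan_def)
  hence "x + y = (\<Sum>s\<in>S. of_int (a s + b s) * s)"
    by (simp add: sum.distrib algebra_simps)
  thus ?thesis by (rule zspanI)
qed

lemma zspan_int_mult:
  assumes "x \<in> zspan S" shows "of_int c * x \<in> zspan S"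
proof -
  obtain a where "x = (\<Sum>s\<in>S. of_int (a s) * s)"
    using assms by (auto simp: zspan_def)
  hence "of_int c * x = (\<Sum>s\<in>S. of_int (c * a s) * s)"
    by (simp add: sum_distrib_left algebra_simps)
  thus ?thesis by (rule zspanI)
qed

lemma zspan_0: "0 \<in> zspan S"
  by (rule zspanI[of _ "\<lambda>_. 0"]) simp

lemma zspan_sum:
  assumes "\<And>i. i \<in> I \<Longrightarrow> f i \<in> zspan S" shows "sum f I \<in> zspan S"
  using assms by (induction I rule: infinite_finite_induct) (auto intro: zspan_0 zspan_add)

lemma zspan_base:
  assumes "finite S" "s \<in> S" shows "s \<in> zspan S"
proof -
  have "s = (\<Sum>t\<in>S. of_int (if t = s then 1 else 0) * t)"
    using assms by (simp add: if_distrib[of "\<lambda>x. of_int x * _"] sum.delta cong: if_cong)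
  thus ?thesis by (rule zspanI)
qed

lemma zspan_mult_closed:
  assumes "\<And>s. s \<in> S \<Longrightarrow> z * s \<in> zspan S" "x \<in> zspan S"
  shows "z * x \<in> zspan S"
proof -
  obtain a where "x = (\<Sum>s\<in>S. of_int (a s) * s)"
    using assms by (auto simp: zspan_def)
  hence "z * x = (\<Sum>s\<in>S. of_int (a s) * (z * s))"
    by (simp add: sum_distrib_left algebra_simps)
  also have "\<dots> \<in> zspan S" by (intro zspan_sum zspan_int_mult assms)
  finally show ?thesis .
qed

text \<open>The equations make \<open>v\<close> an eigenvector of the integer matrix
  \<open>A\<close> with eigenvalue \<open>x\<close>, so \<open>x\<close> is a root of the
  characteristic polynomial, which is monic with integer coefficients.\<close>

lemma algebraic_int_eigenvalue:
  fixes A :: "nat \<Rightarrow> nat \<Rightarrow> int" and v :: "nat \<Rightarrow> complex"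
  assumes "i < n" "v i \<noteq> 0"
    and eq: "\<And>i. i < n \<Longrightarrow> x * v i = (\<Sum>j<n. of_int (A i j) * v j)"
  shows "algebraic_int x"
proof -
  define M :: "int mat" where "M = mat n n (\<lambda>(i,j). A i j)"
  define M' :: "complex mat" where "M' = map_mat of_int M"
  have M: "M \<in> carrier_mat n n" and M': "M' \<in> carrier_mat n n"
    by (auto simp: M_def M'_def)
  have "eigenvector M' (vec n v) x"
    unfolding eigenvector_def
  proof (intro conjI)
    show "vec n v \<in> carrier_vec (dim_row M')" using M' by auto
    show "vec n v \<noteq> 0\<^sub>v (dim_row M')" using M' assms(1,2)
      by (auto simp: vec_eq_iff)
    show "M' *\<^sub>v vec n v = x \<cdot>\<^sub>v vec n v"
    proof (rule eq_vecI)
      fix k assume "k < dim_vec (x \<cdot>\<^sub>v vec n v)"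
      hence k: "k < n" by simp
      hence "(M' *\<^sub>v vec n v) $ k = (\<Sum>j = 0..<n. of_int (A k j) * v j)"
        by (simp add: M'_def M_def scalar_prod_def)
      also have "\<dots> = x * v k" using eq[OF k] by (simp add: atLeast0LessThan)
      finally show "(M' *\<^sub>v vec n v) $ k = (x \<cdot>\<^sub>v vec n v) $ k" using k by simp
    qed (simp add: M'_def M_def)
  qed
  hence "eigenvalue M' x" by (auto simp: eigenvalue_def)
  hence "poly (char_poly M') x = 0" using eigenvalue_root_char_poly[OF M'] by simp
  moreover have "char_poly M' = map_poly of_int (char_poly M)"
    unfolding M'_def using of_int_hom.char_poly_hom[OF M] .
  moreover have "lead_coeff (char_poly M) = 1" using degree_monic_char_poly[OF M] by simp
  ultimately show ?thesis by (auto simp: algebraic_int_altdef_ipoly)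
qed

text \<open>Once \<open>S\<close> is enumerated, multiplication by \<open>z\<close> on its span has
  an integer matrix; the vector of generators is an eigenvector, nonzero because of
  \<open>s\<close>.\<close>

lemma algebraic_int_zspan:
  assumes "finite S" "s \<in> S" "s \<noteq> 0" and "\<And>s. s \<in> S \<Longrightarrow> z * s \<in> zspan S"
  shows "algebraic_int z"
proof -
  obtain f where f: "bij_betw f {..<card S} S"
    using ex_bij_betw_nat_finite[OF assms(1)] by (auto simp: atLeast0LessThan)
  have "\<forall>s. \<exists>a. s \<in> S \<longrightarrow> z * s = (\<Sum>t\<in>S. of_int (a t :: int) * t)"
    using assms(4) unfolding zspan_def by blast
  then obtain a where a: "\<And>s. s \<in> S \<Longrightarrow> z * s = (\<Sum>t\<in>S. of_int (a s t :: int) * t)"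
    by metis
  obtain k where k: "k < card S" "f k = s" using assms(2) bij_betw_imp_surj_on[OF f] by (metis imageE lessThan_iff)
  show ?thesis
  proof (rule algebraic_int_eigenvalue[of k "card S" f z "\<lambda>i j. a (f i) (f j)"])
    fix i assume "i < card S"
    hence "f i \<in> S" using f by (auto simp: bij_betw_def)
    thus "z * f i = (\<Sum>j<card S. of_int (a (f i) (f j)) * f j)"
      using a sum.reindex_bij_betw[OF f, of "\<lambda>t. of_int (a (f i) t) * t"] by simp
  qed (use k assms(3) in auto)
qed

lemma algebraic_int_monic_relation:
  assumes "algebraic_int (x::complex)"
  obtains m and c :: "nat \<Rightarrow> int" where "m > 0" "x ^ m = (\<Sum>i<m. of_int (c i) * x ^ i)"
proof -
  obtain p where p: "poly (map_poly of_int p) x = 0" "lead_coeff p = 1"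
    using assms by (auto simp: algebraic_int_altdef_ipoly)
  define m where "m = degree p"
  have dm: "degree (map_poly of_int p :: complex poly) = m" by (simp add: m_def)
  have "0 = (\<Sum>i\<le>m. of_int (coeff p i) * x ^ i)"
    using p(1) by (simp add: poly_altdef m_def)
  also have "\<dots> = (\<Sum>i<m. of_int (coeff p i) * x ^ i) + x ^ m"
  proof -
    have "{..m} = insert m {..<m}" by auto
    thus ?thesis using p(2) by (simp add: m_def add.commute)
  qed
  finally have "x ^ m = - (\<Sum>i<m. of_int (coeff p i) * x ^ i)"
    by (metis add_eq_0_iff)
  hence e: "x ^ m = (\<Sum>i<m. of_int (- coeff p i) * x ^ i)"
    by (simp add: sum_negf)
  have "m > 0" using e by (cases m) auto
  thus ?thesis by (rule that[OF _ e])
qed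

text \<open>The products x^i y^j with exponents below the degrees of monic relations for
  \<open>x\<close> and \<open>y\<close> span a group stable under multiplication by \<open>x\<close>
  and by \<open>y\<close>, hence by their sum and their product.\<close>

lemma
  assumes "algebraic_int (x::complex)" "algebraic_int y"
  shows algebraic_int_add: "algebraic_int (x + y)"
    and algebraic_int_mult: "algebraic_int (x * y)"
proof -
  obtain m c where m: "m > 0" "x ^ m = (\<Sum>i<m. of_int (c i :: int) * x ^ i)"
    using algebraic_int_monic_relation[OF assms(1)] by blast
  obtain n d where n: "n > 0" "y ^ n = (\<Sum>i<n. of_int (d i :: int) * y ^ i)"
    using algebraic_int_monic_relation[OF assms(2)] by blast
  define S where "S = {x ^ i * y ^ j |i j. i < m \<and> j < n}"
  have "S = (\<lambda>(i,j). x ^ i * y ^ j) ` ({..<m} \<times> {..<n})"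
    by (auto simp: S_def)
  hence fin: "finite S" by simp
  have base: "x ^ i * y ^ j \<in> zspan S" if "i < m" "j < n" for i j
    by (rule zspan_base[OF fin]) (use that in \<open>auto simp: S_def\<close>)
  have xS: "x * s \<in> zspan S" if sS: "s \<in> S" for s
  proof -
    obtain i j where ij: "s = x ^ i * y ^ j" "i < m" "j < n" using sS unfolding S_def by blast
    show ?thesis
    proof (cases "Suc i < m")
      case True
      thus ?thesis using base[of "Suc i" j] ij by (simp add: mult_ac)
    next
      case False
      hence "x * s = x ^ m * y ^ j" using ij by (metis Suc_lessI mult.assoc power_Suc)
      also have "\<dots> = (\<Sum>k<m. of_int (c k) * (x ^ k * y ^ j))"
        unfolding m(2) sum_distrib_right by (simp only: mult.assoc)
      also have "\<dots> \<in> zspan S" using ij by (intro zspan_sum zspan_int_mult base) auto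
      finally show ?thesis .
    qed
  qed
  have yS: "y * s \<in> zspan S" if sS: "s \<in> S" for s
  proof -
    obtain i j where ij: "s = x ^ i * y ^ j" "i < m" "j < n" using sS unfolding S_def by blast
    show ?thesis
    proof (cases "Suc j < n")
      case True
      thus ?thesis using base[of i "Suc j"] ij by (simp add: mult_ac)
    next
      case False
      hence "y * s = x ^ i * y ^ n" using ij by (metis Suc_lessI mult.left_commute power_Suc)
      also have "\<dots> = (\<Sum>k<n. of_int (d k) * (x ^ i * y ^ k))"
        unfolding n(2) sum_distrib_left by (simp only: mult.left_commute)
      also have "\<dots> \<in> zspan S" using ij by (intro zspan_sum zspan_int_mult base) auto
      finally show ?thesis .
    qed
  qed
  have 1: "1 \<in> S" using m(1) n(1) unfolding S_def by (auto intro!: exI[of _ 0])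
  show "algebraic_int (x + y)"
    by (rule algebraic_int_zspan[OF fin 1]) (auto simp: distrib_right intro: zspan_add xS yS)
  show "algebraic_int (x * y)"
    by (rule algebraic_int_zspan[OF fin 1])
       (auto simp: mult.assoc intro: zspan_mult_closed[OF xS] yS)
qed

lemma algebraic_int_diff:
  "algebraic_int (x::complex) \<Longrightarrow> algebraic_int y \<Longrightarrow> algebraic_int (x - y)"
  using algebraic_int_add[of x "- y"] algebraic_int_minus[of y] by simp

lemma algebraic_int_sum:
  "(\<And>i. i \<in> I \<Longrightarrow> algebraic_int (f i :: complex)) \<Longrightarrow> algebraic_int (sum f I)"
  by (induction I rule: infinite_finite_induct) (auto intro: algebraic_int_add)

lemma algebraic_int_prod:
  "(\<And>i. i \<in> I \<Longrightarrow> algebraic_int (f i :: complex)) \<Longrightarrow> algebraic_int (prod f I)"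
  by (induction I rule: infinite_finite_induct) (auto intro: algebraic_int_mult)

lemma algebraic_int_power:
  "algebraic_int (x::complex) \<Longrightarrow> algebraic_int (x ^ n)"
  by (induction n) (auto intro: algebraic_int_mult)

subsection \<open>Products of additive sets of complex numbers\<close>

abbreviation set_prod :: "complex set \<Rightarrow> complex set \<Rightarrow> complex set" (infixl "\<star>" 70) where
  "A \<star> B \<equiv> ideal_prod complex_field A B"

lemma complex_field_simps [simp]:
  "carrier complex_field = UNIV"
  "x \<otimes>\<^bsub>complex_field\<^esub> y = x * y"
  "x \<oplus>\<^bsub>complex_field\<^esub> y = x + y"
  "\<one>\<^bsub>complex_field\<^esub> = 1"
  "\<zero>\<^bsub>complex_field\<^esub> = 0"
  by (simp_all add: ring_of_type_algebra_def)

lemma complex_field_a_inv [simp]: "\<ominus>\<^bsub>complex_field\<^esub> x = - x"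
proof -
  interpret ring complex_field by (rule ring_from_type_algebra)
  show ?thesis using minus_equality[of "- x" x] by simp
qed

lemma complex_field_m_inv: "x \<noteq> 0 \<Longrightarrow> inv\<^bsub>complex_field\<^esub> x = inverse x"
proof -
  interpret field complex_field by (rule field_from_type_algebra)
  assume "x \<noteq> 0"
  thus ?thesis using inv_char[of x "inverse x"] by simp
qed

lemma subgroup_complex_field_iff:
  "subgroup I (add_monoid complex_field) \<longleftrightarrow>
     0 \<in> I \<and> (\<forall>x\<in>I. \<forall>y\<in>I. x + y \<in> I) \<and> (\<forall>x\<in>I. - x \<in> I)"
  using complex_field_a_inv by (auto simp: subgroup_def a_inv_def)

lemma set_prod_induct [consumes 1, case_names prod sum]:
  assumes "x \<in> A \<star> B" "\<And>a b. a \<in> A \<Longrightarrow> b \<in> B \<Longrightarrow> P (a * b)"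
    "\<And>x y. x \<in> A \<star> B \<Longrightarrow> y \<in> A \<star> B \<Longrightarrow> P x \<Longrightarrow> P y \<Longrightarrow> P (x + y)"
  shows "P x"
  using assms by (induction rule: ideal_prod.induct) auto

lemma set_prodI: "a \<in> A \<Longrightarrow> b \<in> B \<Longrightarrow> a * b \<in> A \<star> B"
  using ideal_prod.prod[of a A b B complex_field] by simp

lemma set_prod_add: "x \<in> A \<star> B \<Longrightarrow> y \<in> A \<star> B \<Longrightarrow> x + y \<in> A \<star> B"
  using ideal_prod.sum[of x complex_field A B y] by simp

lemma set_prod_subset:
  assumes "\<And>a b. a \<in> A \<Longrightarrow> b \<in> B \<Longrightarrow> a * b \<in> C"
    "\<And>x y. x \<in> C \<Longrightarrow> y \<in> C \<Longrightarrow> x + y \<in> C"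
  shows "A \<star> B \<subseteq> C"
proof
  fix x assume "x \<in> A \<star> B" thus "x \<in> C"
    by (induction rule: set_prod_induct) (auto intro: assms)
qed

lemma set_prod_mono: "A \<subseteq> A' \<Longrightarrow> B \<subseteq> B' \<Longrightarrow> A \<star> B \<subseteq> A' \<star> B'"
  by (rule set_prod_subset) (auto intro: set_prodI set_prod_add)

lemma set_prod_commute: "A \<star> B = B \<star> A"
proof -
  have "A \<star> B \<subseteq> B \<star> A" for A B
  proof (rule set_prod_subset)
    fix a b assume "a \<in> A" "b \<in> B"
    thus "a * b \<in> B \<star> A" using set_prodI[of b B a A] by (simp add: mult.commute)
  qed (rule set_prod_add)
  thus ?thesis by blast
qed

lemma set_prod_assoc_le: "(A \<star> B) \<star> C \<subseteq> A \<star> (B \<star> C)"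
proof (rule set_prod_subset)
  fix x c assume "x \<in> A \<star> B" and c: "c \<in> C"
  thus "x * c \<in> A \<star> (B \<star> C)"
    by (induction rule: set_prod_induct)
       (auto simp: mult.assoc distrib_right intro: set_prodI set_prod_add)
qed (rule set_prod_add)

lemma set_prod_assoc: "(A \<star> B) \<star> C = A \<star> (B \<star> C)"
proof
  have "A \<star> (B \<star> C) = (C \<star> B) \<star> A" by (metis set_prod_commute)
  also have "\<dots> \<subseteq> C \<star> (B \<star> A)" by (rule set_prod_assoc_le)
  also have "\<dots> = (A \<star> B) \<star> C" by (metis set_prod_commute)
  finally show "A \<star> (B \<star> C) \<subseteq> (A \<star> B) \<star> C" .
qed (rule set_prod_assoc_le)

text \<open>Compatibility of \<open>h\<close> is required on \<open>F\<close> only, since the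
  automorphisms used later are meaningful only on a subfield.\<close>

lemma set_prod_image_hom:
  assumes "A \<subseteq> F" "B \<subseteq> F"
    and F: "\<And>x y. x \<in> F \<Longrightarrow> y \<in> F \<Longrightarrow> x + y \<in> F" "\<And>x y. x \<in> F \<Longrightarrow> y \<in> F \<Longrightarrow> x * y \<in> F"
    and h: "\<And>x y. x \<in> F \<Longrightarrow> y \<in> F \<Longrightarrow> h (x + y) = h x + h y"
      "\<And>x y. x \<in> F \<Longrightarrow> y \<in> F \<Longrightarrow> h (x * y) = h x * h y"
  shows "h ` (A \<star> B) = h ` A \<star> h ` B"
proof
  have AB: "A \<star> B \<subseteq> F" using assms(1,2) by (intro set_prod_subset F) auto
  show "h ` A \<star> h ` B \<subseteq> h ` (A \<star> B)"
  proof (rule set_prod_subset)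
    fix x y assume "x \<in> h ` A" "y \<in> h ` B"
    then obtain a b where "x = h a" "y = h b" "a \<in> A" "b \<in> B" by blast
    thus "x * y \<in> h ` (A \<star> B)"
      using assms(1,2) h(2)[of a b] set_prodI[of a A b B] by (metis imageI subsetD)
  next
    fix x y assume "x \<in> h ` (A \<star> B)" "y \<in> h ` (A \<star> B)"
    then obtain a b where "x = h a" "y = h b" "a \<in> A \<star> B" "b \<in> A \<star> B" by blast
    thus "x + y \<in> h ` (A \<star> B)"
      using AB h(1)[of a b] set_prod_add[of a A B b] by (metis imageI subsetD)
  qed
  have "h x \<in> h ` A \<star> h ` B" if "x \<in> A \<star> B" for x
    using that
  proof (induction rule: set_prod_induct)
    case (prod a b)
    have "h (a * b) = h a * h b" using prod assms(1,2) by (intro h) auto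
    thus ?case using prod by (auto intro: set_prodI)
  next
    case (sum x y)
    have "h (x + y) = h x + h y" using sum AB by (intro h) auto
    thus ?case using sum by (auto intro: set_prod_add)
  qed
  thus "h ` (A \<star> B) \<subseteq> h ` A \<star> h ` B" by blast
qed

lemma set_prod_scale: "((*) c ` A) \<star> B = (*) c ` (A \<star> B)"
proof
  show "((*) c ` A) \<star> B \<subseteq> (*) c ` (A \<star> B)"
  proof (rule set_prod_subset)
    fix x y assume "x \<in> (*) c ` (A \<star> B)" "y \<in> (*) c ` (A \<star> B)"
    then obtain a b where ab: "x = c * a" "y = c * b" "a \<in> A \<star> B" "b \<in> A \<star> B" by blast
    hence "x + y = c * (a + b)" "a + b \<in> A \<star> B" by (auto simp: distrib_left intro: set_prod_add)
    thus "x + y \<in> (*) c ` (A \<star> B)" by blast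
  qed (auto simp: mult.assoc intro: set_prodI)
  have "c * x \<in> ((*) c ` A) \<star> B" if "x \<in> A \<star> B" for x
    using that
  proof (induction rule: set_prod_induct)
    case (prod a b)
    have "c * a * b \<in> ((*) c ` A) \<star> B" using prod by (intro set_prodI) auto
    thus ?case by (simp add: mult.assoc)
  qed (auto simp: distrib_left intro: set_prod_add)
  thus "(*) c ` (A \<star> B) \<subseteq> ((*) c ` A) \<star> B" by blast
qed

lemma scale_scale: "(*) (c::complex) ` (*) d ` A = (*) (c * d) ` A"
  by (auto simp: image_image mult.assoc)

lemma inverse_scale: "c \<noteq> 0 \<Longrightarrow> (*) (inverse c) ` (*) (c::complex) ` A = A"
  by (simp add: scale_scale)

lemma cmod_of_rat: "cmod (of_rat q) = of_rat \<bar>q\<bar>"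
proof -
  obtain a b where "q = Rat.Fract a b" by (cases q) auto
  hence "(of_rat q :: complex) = of_real (of_rat q)"
    by (simp add: Fract_of_int_quotient of_rat_divide)
  hence "cmod (of_rat q) = \<bar>of_rat q\<bar>" by (metis norm_of_real)
  thus ?thesis by (simp add: abs_if of_rat_minus)
qed

section \<open>Subfields of the complex numbers and number fields\<close>

locale complex_subfield =
  fixes F :: "complex set"
  assumes one_F: "1 \<in> F"
    and add_F: "x \<in> F \<Longrightarrow> y \<in> F \<Longrightarrow> x + y \<in> F"
    and mult_F: "x \<in> F \<Longrightarrow> y \<in> F \<Longrightarrow> x * y \<in> F"
    and uminus_F: "x \<in> F \<Longrightarrow> - x \<in> F"
    and inverse_F: "x \<in> F \<Longrightarrow> inverse x \<in> F"
begin

abbreviation "\<O> \<equiv> integers_of F"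

lemma diff_F: "x \<in> F \<Longrightarrow> y \<in> F \<Longrightarrow> x - y \<in> F"
  using add_F[of x "- y"] uminus_F[of y] by simp

lemma divide_F: "x \<in> F \<Longrightarrow> y \<in> F \<Longrightarrow> x / y \<in> F"
  using mult_F[of x "inverse y"] inverse_F[of y] by (simp add: divide_inverse)

lemma zero_F: "0 \<in> F" using diff_F[OF one_F one_F] by simp

lemma of_nat_F: "of_nat n \<in> F"
  by (induction n) (auto intro: zero_F one_F add_F)

lemma of_int_F: "of_int n \<in> F"
  by (cases n rule: int_cases2) (auto intro: of_nat_F uminus_F)

lemma of_rat_F: "of_rat r \<in> F"
proof -
  obtain a b where "r = Rat.Fract a b" by (cases r) auto
  thus ?thesis by (simp add: Fract_of_int_quotient of_rat_divide divide_F of_int_F)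
qed

lemma sum_F: "(\<And>i. i \<in> I \<Longrightarrow> f i \<in> F) \<Longrightarrow> sum f I \<in> F"
  by (induction I rule: infinite_finite_induct) (auto intro: add_F zero_F)

lemma power_F: "x \<in> F \<Longrightarrow> x ^ n \<in> F"
  by (induction n) (auto intro: mult_F one_F)

lemma O_F: "x \<in> \<O> \<Longrightarrow> x \<in> F" and O_int: "x \<in> \<O> \<Longrightarrow> algebraic_int x"
  and OI: "x \<in> F \<Longrightarrow> algebraic_int x \<Longrightarrow> x \<in> \<O>"
  by (auto simp: integers_of_def)

lemma add_O: "x \<in> \<O> \<Longrightarrow> y \<in> \<O> \<Longrightarrow> x + y \<in> \<O>"
  and mult_O: "x \<in> \<O> \<Longrightarrow> y \<in> \<O> \<Longrightarrow> x * y \<in> \<O>"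
  and uminus_O: "x \<in> \<O> \<Longrightarrow> - x \<in> \<O>"
  and diff_O: "x \<in> \<O> \<Longrightarrow> y \<in> \<O> \<Longrightarrow> x - y \<in> \<O>"
  and of_nat_O: "of_nat n \<in> \<O>" and of_int_O: "of_int k \<in> \<O>"
  and one_O: "1 \<in> \<O>" and zero_O: "0 \<in> \<O>"
  by (auto simp: integers_of_def intro: add_F mult_F uminus_F diff_F of_nat_F of_int_F one_F zero_F
      algebraic_int_add algebraic_int_mult algebraic_int_diff)

lemma sum_O: "(\<And>i. i \<in> I \<Longrightarrow> f i \<in> \<O>) \<Longrightarrow> sum f I \<in> \<O>"
  by (induction I rule: infinite_finite_induct) (auto intro: add_O zero_O)

lemma power_O: "x \<in> \<O> \<Longrightarrow> x ^ n \<in> \<O>"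
  by (induction n) (auto intro: mult_O one_O)

end

text \<open>\<open>B\<close> need not be a basis and \<open>G\<close> need not consist of distinct embeddings of \<open>F\<close>: all automorphisms of
  the cyclotomic field serve for each of its subfields, the product over them being a power of the norm.\<close>

locale number_field = complex_subfield F for F +
  fixes B :: "complex set" and G :: "(complex \<Rightarrow> complex) set"
  assumes finite_B: "finite B" and B_int: "B \<subseteq> integers_of F"
    and B_span: "x \<in> F \<Longrightarrow> \<exists>r. x = (\<Sum>b\<in>B. of_rat (r b) * b)"
    and finite_G: "finite G" and G_nonempty: "G \<noteq> {}"
    and G_add: "\<sigma> \<in> G \<Longrightarrow> x \<in> F \<Longrightarrow> y \<in> F \<Longrightarrow> \<sigma> (x + y) = \<sigma> x + \<sigma> y"
    and G_mult: "\<sigma> \<in> G \<Longrightarrow> x \<in> F \<Longrightarrow> y \<in> F \<Longrightarrow> \<sigma> (x * y) = \<sigma> x * \<sigma> y"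
    and G_rat: "\<sigma> \<in> G \<Longrightarrow> \<sigma> (of_rat r) = of_rat r"
    and G_int: "\<sigma> \<in> G \<Longrightarrow> x \<in> integers_of F \<Longrightarrow> algebraic_int (\<sigma> x)"
    and norm_rat: "x \<in> F \<Longrightarrow> (\<Prod>\<sigma>\<in>G. \<sigma> x) \<in> \<rat>"
    and residues_finite: "D > 0 \<Longrightarrow> \<exists>f :: complex \<Rightarrow> nat \<Rightarrow> nat. finite (f ` integers_of F) \<and>
          (\<forall>x\<in>integers_of F. \<forall>y\<in>integers_of F. f x = f y \<longrightarrow> algebraic_int ((x - y) / of_nat D))"
begin

definition Nm :: "complex \<Rightarrow> complex" where "Nm x = (\<Prod>\<sigma>\<in>G. \<sigma> x)"

lemma G_1: "\<sigma> \<in> G \<Longrightarrow> \<sigma> 1 = 1" and G_0: "\<sigma> \<in> G \<Longrightarrow> \<sigma> 0 = 0"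
  using G_rat[of \<sigma> 1] G_rat[of \<sigma> 0] by auto

lemma G_sum: "\<sigma> \<in> G \<Longrightarrow> (\<And>i. i \<in> I \<Longrightarrow> f i \<in> F) \<Longrightarrow> \<sigma> (sum f I) = (\<Sum>i\<in>I. \<sigma> (f i))"
  by (induction I rule: infinite_finite_induct) (auto simp: G_0 G_add sum_F)

lemma G_nonzero: "\<sigma> \<in> G \<Longrightarrow> x \<in> F \<Longrightarrow> x \<noteq> 0 \<Longrightarrow> \<sigma> x \<noteq> 0"
  using G_mult[of \<sigma> x "inverse x"] inverse_F[of x] G_1[of \<sigma>] by auto

lemma Nm_mult: "x \<in> F \<Longrightarrow> y \<in> F \<Longrightarrow> Nm (x * y) = Nm x * Nm y"
  by (simp add: Nm_def G_mult prod.distrib)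

lemma Nm_nonzero: "x \<in> F \<Longrightarrow> x \<noteq> 0 \<Longrightarrow> Nm x \<noteq> 0"
  by (simp add: Nm_def finite_G G_nonzero)

lemma Nm_int: "x \<in> \<O> \<Longrightarrow> Nm x \<in> \<int>"
  unfolding Nm_def
  by (intro rational_algebraic_int_is_int algebraic_int_prod G_int norm_rat O_F)

text \<open>Hurwitz's pigeonhole argument. The fractional parts of the coordinates of
  \<open>t * x\<close> lie in a cube that is cut into boxes; two multiples in the same box differ by
  an integer \<open>w\<close> up to an element with tiny coordinates, all of whose conjugates are
  below 1. The bound \<open>M\<close> does not depend on \<open>x\<close>.\<close>

lemma approximation:
  obtains M :: nat where "M > 0"
    "\<And>x. x \<in> F \<Longrightarrow> \<exists>t\<in>{1..M}. \<exists>w\<in>\<O>. cmod (Nm (of_nat t * x - w)) < 1"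
proof -
  \<comment> \<open>\<open>C\<close> bounds every conjugate of a combination of \<open>B\<close>
    with coefficients of absolute value at most 1; boxes of side \<open>1 / Q\<close> with
    \<open>Q > C\<close> then push all conjugates below 1.\<close>
  define C where "C = (\<Sum>\<sigma>\<in>G. \<Sum>b\<in>B. cmod (\<sigma> b))"
  obtain Q :: nat where Q: "real Q > C" using reals_Archimedean2 by blast
  have C0: "C \<ge> 0" by (auto simp: C_def intro!: sum_nonneg)
  hence Q0: "Q > 0" using Q by (cases Q) auto
  define M where "M = Q ^ card B"
  have M0: "M > 0" using Q0 by (simp add: M_def)
  show ?thesis
  proof (rule that[OF M0])
    fix x assume "x \<in> F"
    then obtain r where r: "x = (\<Sum>b\<in>B. of_rat (r b) * b)" using B_span by blast
    define box where "box = (\<lambda>t::nat. restrict (\<lambda>b. nat \<lfloor>of_nat Q * frac (of_nat t * r b)\<rfloor>) B)"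
    have "box \<in> {0..M} \<rightarrow> (B \<rightarrow>\<^sub>E {..<Q})"
    proof (clarsimp simp: box_def)
      fix t b assume "b \<in> B"
      have "of_nat Q * frac (of_nat t * r b) < of_nat Q"
        using Q0 frac_lt_1 by simp
      thus "nat \<lfloor>of_nat Q * frac (of_nat t * r b)\<rfloor> < Q"
        using frac_ge_0[of "of_nat t * r b"] Q0 by (simp add: nat_less_iff floor_less_iff)
    qed
    \<comment> \<open>There are \<open>M + 1\<close> values of \<open>t\<close> but only
      \<open>M\<close> boxes.\<close>
    moreover have "card (B \<rightarrow>\<^sub>E {..<Q}) < card {0..M}"
      using finite_B by (simp add: card_PiE M_def)
    moreover have "finite (B \<rightarrow>\<^sub>E {..<Q})" using finite_B by (intro finite_PiE) auto
    ultimately have "\<not> inj_on box {0..M}"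
      using card_inj_on_le[of box "{0..M}" "B \<rightarrow>\<^sub>E {..<Q}"] by (auto simp: image_subset_iff_funcset)
    then obtain t1 t2 where t12: "t1 \<le> M" "t2 \<le> M" "t1 < t2" "box t1 = box t2"
      unfolding inj_on_def by (metis atLeastAtMost_iff linorder_neqE_nat)
    define w where "w = (\<Sum>b\<in>B. of_int (\<lfloor>of_nat t2 * r b\<rfloor> - \<lfloor>of_nat t1 * r b\<rfloor>) * b)"
    define e where "e = (\<lambda>b. frac (of_nat t2 * r b) - frac (of_nat t1 * r b))"
    have e: "\<bar>e b\<bar> < 1 / of_nat Q" if "b \<in> B" for b
    proof -
      have "nat \<lfloor>of_nat Q * frac (of_nat t1 * r b)\<rfloor> = nat \<lfloor>of_nat Q * frac (of_nat t2 * r b)\<rfloor>"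
        using fun_cong[OF t12(4), of b] that by (simp add: box_def)
      hence "\<lfloor>of_nat Q * frac (of_nat t1 * r b)\<rfloor> = \<lfloor>of_nat Q * frac (of_nat t2 * r b)\<rfloor>"
        by (simp add: eq_nat_nat_iff)
      hence "\<bar>of_nat Q * frac (of_nat t2 * r b) - of_nat Q * frac (of_nat t1 * r b)\<bar> < 1"
        by linarith
      hence "\<bar>of_nat Q * e b\<bar> < 1" by (simp add: e_def right_diff_distrib)
      thus ?thesis using Q0 by (simp add: abs_mult field_simps)
    qed
    have BO: "b \<in> \<O>" "b \<in> F" if "b \<in> B" for b using that B_int O_F by auto
    have diff: "of_nat (t2 - t1) * x - w = (\<Sum>b\<in>B. of_rat (e b) * b)"
    proof -
      have "of_nat (t2 - t1) * of_rat (r b) - of_int (\<lfloor>of_nat t2 * r b\<rfloor> - \<lfloor>of_nat t1 * r b\<rfloor>)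
              = (of_rat (e b) :: complex)" for b
      proof -
        have "of_nat (t2 - t1) * r b - of_int (\<lfloor>of_nat t2 * r b\<rfloor> - \<lfloor>of_nat t1 * r b\<rfloor>) = e b"
          using t12(3) by (simp add: e_def frac_def of_nat_diff algebra_simps)
        hence "of_rat (of_nat (t2 - t1) * r b - of_int (\<lfloor>of_nat t2 * r b\<rfloor> - \<lfloor>of_nat t1 * r b\<rfloor>))
           = (of_rat (e b) :: complex)" by simp
        thus ?thesis by (simp only: of_rat_diff of_rat_mult of_rat_of_nat_eq of_rat_of_int_eq)
      qed
      note * = this
      have "of_nat (t2 - t1) * x - w = (\<Sum>b\<in>B. (of_nat (t2 - t1) * of_rat (r b)
               - of_int (\<lfloor>of_nat t2 * r b\<rfloor> - \<lfloor>of_nat t1 * r b\<rfloor>)) * b)"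
        unfolding r w_def sum_distrib_left sum_subtractf[symmetric] left_diff_distrib mult.assoc ..
      thus ?thesis unfolding * .
    qed
    have small: "cmod (\<sigma> (of_nat (t2 - t1) * x - w)) < 1" if \<sigma>: "\<sigma> \<in> G" for \<sigma>
    proof -
      have "\<sigma> (of_nat (t2 - t1) * x - w) = (\<Sum>b\<in>B. of_rat (e b) * \<sigma> b)"
        unfolding diff using \<sigma> BO by (subst G_sum) (auto simp: G_mult G_rat of_rat_F intro: mult_F)
      also have "cmod \<dots> \<le> (\<Sum>b\<in>B. cmod (of_rat (e b) * \<sigma> b))" by (rule norm_sum)
      also have "\<dots> \<le> (\<Sum>b\<in>B. 1 / real Q * cmod (\<sigma> b))"
      proof (rule sum_mono)
        fix b assume "b \<in> B"
        have "cmod (of_rat (e b)) = of_rat \<bar>e b\<bar>"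
          by (rule cmod_of_rat)
        also have "\<dots> \<le> of_rat (1 / of_nat Q)" using e[OF \<open>b \<in> B\<close>] by (simp only: of_rat_less_eq)
        finally show "cmod (of_rat (e b) * \<sigma> b) \<le> 1 / real Q * cmod (\<sigma> b)"
          unfolding norm_mult by (intro mult_right_mono) (auto simp: of_rat_divide)
      qed
      also have "\<dots> = (\<Sum>b\<in>B. cmod (\<sigma> b)) / real Q" by (simp add: sum_divide_distrib)
      also have "\<dots> \<le> C / real Q"
        unfolding C_def using \<sigma> finite_G
        by (intro divide_right_mono member_le_sum[of \<sigma> G "\<lambda>\<sigma>. \<Sum>b\<in>B. cmod (\<sigma> b)"])
           (auto intro: sum_nonneg)
      also have "\<dots> < 1" using Q Q0 by simp
      finally show ?thesis .
    qed
    have "cmod (Nm (of_nat (t2 - t1) * x - w)) = (\<Prod>\<sigma>\<in>G. cmod (\<sigma> (of_nat (t2 - t1) * x - w)))"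
      by (simp add: Nm_def prod_norm)
    also have "\<dots> < (\<Prod>\<sigma>\<in>G. 1)"
    proof -
      obtain \<tau> where "\<tau> \<in> G" using G_nonempty by blast
      thus ?thesis using small finite_G less_imp_le by (intro prod_mono_strict[of \<tau>]) auto
    qed
    finally have "cmod (Nm (of_nat (t2 - t1) * x - w)) < 1" by simp
    moreover have "w \<in> \<O>" unfolding w_def by (intro sum_O mult_O of_int_O BO)
    moreover have "t2 - t1 \<in> {1..M}" using t12 by auto
    ultimately show "\<exists>t\<in>{1..M}. \<exists>w\<in>\<O>. cmod (Nm (of_nat t * x - w)) < 1" by blast
  qed
qed

end

subsection \<open>Fractional ideals\<close>

context number_field
begin

lemma frac_subset: "fractional_ideal F I \<Longrightarrow> x \<in> I \<Longrightarrow> x \<in> F"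
  and frac_zero: "fractional_ideal F I \<Longrightarrow> 0 \<in> I"
  and frac_add: "fractional_ideal F I \<Longrightarrow> x \<in> I \<Longrightarrow> y \<in> I \<Longrightarrow> x + y \<in> I"
  and frac_uminus: "fractional_ideal F I \<Longrightarrow> x \<in> I \<Longrightarrow> - x \<in> I"
  and frac_mult: "fractional_ideal F I \<Longrightarrow> a \<in> \<O> \<Longrightarrow> x \<in> I \<Longrightarrow> a * x \<in> I"
  unfolding fractional_ideal_def subgroup_complex_field_iff by auto

lemma frac_diff: "fractional_ideal F I \<Longrightarrow> x \<in> I \<Longrightarrow> y \<in> I \<Longrightarrow> x - y \<in> I"
  using frac_add[of I x "- y"] frac_uminus[of I y] by simp

lemma frac_nonzero: "fractional_ideal F I \<Longrightarrow> \<exists>x\<in>I. x \<noteq> 0"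
  unfolding fractional_ideal_def subgroup_complex_field_iff by auto

lemma fractional_idealI:
  assumes "I \<subseteq> F" "x \<in> I" "x \<noteq> 0" "d \<in> \<O>" "d \<noteq> 0" "\<And>x. x \<in> I \<Longrightarrow> d * x \<in> \<O>"
    and "\<And>x y. x \<in> I \<Longrightarrow> y \<in> I \<Longrightarrow> x + y \<in> I" "\<And>a x. a \<in> \<O> \<Longrightarrow> x \<in> I \<Longrightarrow> a * x \<in> I"
  shows "fractional_ideal F I"
proof -
  have "0 \<in> I" using assms(8)[OF zero_O assms(2)] by simp
  moreover have "- y \<in> I" if "y \<in> I" for y
    using assms(8)[OF uminus_O[OF one_O] that] by simp
  ultimately show ?thesis
    unfolding fractional_ideal_def subgroup_complex_field_iff
    using assms(1-6) by (intro conjI ballI bexI[of _ d] assms(7,8)) auto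
qed

lemma frac_O: "fractional_ideal F \<O>"
  by (rule fractional_idealI[of _ 1 1]) (auto intro: one_O add_O mult_O O_F)

lemma denominator:
  assumes "x \<in> F" shows "\<exists>n>0. of_nat n * x \<in> \<O>"
proof -
  have rat: "\<exists>n>0. of_nat n * of_rat q \<in> (\<int> :: complex set)" for q :: rat
  proof -
    obtain a b where "q = Rat.Fract a b" "b > 0" by (cases q) auto
    hence "of_nat (nat b) * of_rat q = (of_int a :: complex)" "nat b > 0"
      by (auto simp: Fract_of_int_quotient of_rat_divide)
    thus ?thesis by (metis Ints_of_int)
  qed
  obtain r where r: "x = (\<Sum>b\<in>B. of_rat (r b) * b)" using B_span assms by blast
  have "\<exists>n>0. of_nat n * (\<Sum>b\<in>S. of_rat (r b) * b) \<in> \<O>" if "finite S" "S \<subseteq> B" for S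
    using that
  proof (induction rule: finite_induct)
    case empty thus ?case by (auto intro: zero_O)
  next
    case (insert b S)
    obtain n where n: "n > 0" "of_nat n * (\<Sum>b\<in>S. of_rat (r b) * b) \<in> \<O>"
      using insert by auto
    obtain m k where m: "m > 0" "of_nat m * of_rat (r b) = (of_int k :: complex)"
      using rat[of "r b"] by (auto elim: Ints_cases)
    have "of_nat (n * m) * (\<Sum>b\<in>insert b S. of_rat (r b) * b)
        = of_nat n * ((of_nat m * of_rat (r b)) * b) + of_nat m * (of_nat n * (\<Sum>b\<in>S. of_rat (r b) * b))"
      using insert by (simp add: algebra_simps)
    also have "\<dots> \<in> \<O>" unfolding m(2)
      using insert.prems B_int by (intro add_O mult_O of_nat_O of_int_O n) auto
    finally show ?case using n m by (intro exI[of _ "n * m"]) auto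
  qed
  thus ?thesis using finite_B r by blast
qed

lemma frac_scale:
  assumes I: "fractional_ideal F I" and c: "c \<in> F" "c \<noteq> 0"
  shows "fractional_ideal F ((*) c ` I)"
proof -
  obtain x where x: "x \<in> I" "x \<noteq> 0" using frac_nonzero[OF I] by blast
  obtain d where d: "d \<in> \<O>" "d \<noteq> 0" "\<And>x. x \<in> I \<Longrightarrow> d * x \<in> \<O>"
    using I unfolding fractional_ideal_def by blast
  obtain n where n: "n > 0" "of_nat n * c \<in> \<O>" using denominator[OF c(1)] by blast
  show ?thesis
  proof (rule fractional_idealI[of _ "c * x" "of_nat n * d"])
    fix y assume "y \<in> (*) c ` I"
    then obtain z where z: "y = c * z" "z \<in> I" by blast
    have *: "of_nat n * d * y = of_nat n * c * (d * z)" using z by simp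
    show "of_nat n * d * y \<in> \<O>" unfolding * by (intro mult_O[OF n(2)] d z)
  next
    fix y z assume "y \<in> (*) c ` I" "z \<in> (*) c ` I"
    thus "y + z \<in> (*) c ` I" using frac_add[OF I] by (auto simp flip: distrib_left)
  next
    fix a y assume a: "a \<in> \<O>" "y \<in> (*) c ` I"
    then obtain z where z: "y = c * z" "z \<in> I" by blast
    hence "a * y = c * (a * z)" by simp
    thus "a * y \<in> (*) c ` I" using frac_mult[OF I a(1) z(2)] by blast
  qed (use I x c d n in \<open>auto intro!: mult_O mult_F of_nat_O intro: frac_subset\<close>)
qed

lemma frac_prod:
  assumes I: "fractional_ideal F I" and J: "fractional_ideal F J"
  shows "fractional_ideal F (I \<star> J)"
proof -
  obtain x where x: "x \<in> I" "x \<noteq> 0" using frac_nonzero[OF I] by blast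
  obtain d where d: "d \<in> \<O>" "d \<noteq> 0" "\<And>x. x \<in> I \<Longrightarrow> d * x \<in> \<O>"
    using I unfolding fractional_ideal_def by blast
  obtain y where y: "y \<in> J" "y \<noteq> 0" using frac_nonzero[OF J] by blast
  obtain e where e: "e \<in> \<O>" "e \<noteq> 0" "\<And>x. x \<in> J \<Longrightarrow> e * x \<in> \<O>"
    using J unfolding fractional_ideal_def by blast
  show ?thesis
  proof (rule fractional_idealI[of _ "x * y" "d * e"])
    show "I \<star> J \<subseteq> F"
      by (intro set_prod_subset mult_F add_F) (auto intro: frac_subset[OF I] frac_subset[OF J])
    show "x * y \<in> I \<star> J" using x y by (auto intro: set_prodI)
  next
    fix z assume "z \<in> I \<star> J"
    thus "d * e * z \<in> \<O>"
    proof (induction rule: set_prod_induct)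
      case (prod a b)
      have *: "d * e * (a * b) = (d * a) * (e * b)" by simp
      show ?case unfolding * by (rule mult_O[OF d(3)[OF prod(1)] e(3)[OF prod(2)]])
    qed (auto simp: distrib_left intro: add_O)
  next
    fix a z assume a: "a \<in> \<O>" and "z \<in> I \<star> J"
    from this(2) show "a * z \<in> I \<star> J"
    proof (induction rule: set_prod_induct)
      case (prod x y)
      have "(a * x) * y \<in> I \<star> J" using prod a by (intro set_prodI frac_mult[OF I]) auto
      thus ?case by (simp add: mult.assoc)
    qed (auto simp: distrib_left intro: set_prod_add)
  qed (use x y d e in \<open>auto intro: set_prod_add mult_O\<close>)
qed

lemma O_set_prod:
  assumes I: "fractional_ideal F I" shows "\<O> \<star> I = I"
proof
  show "\<O> \<star> I \<subseteq> I" using frac_mult[OF I] frac_add[OF I] by (intro set_prod_subset) auto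
  show "I \<subseteq> \<O> \<star> I" using set_prodI[OF one_O, of _ I] by auto
qed

text \<open>Scale the ideal into \<O> and take a nonzero \<open>\<beta>\<close> in it of least
  absolute norm. For any \<open>x\<close> in it, \<open>approximation\<close> at
  \<open>x / \<beta>\<close> yields an element of smaller norm than \<open>\<beta>\<close>, hence
  zero, so some \<open>t * x\<close> with \<open>t \<le> M\<close> is a multiple of
  \<open>\<beta>\<close>. Multiplying by \<open>fact M / \<beta>\<close> therefore keeps the ideal
  integral and sends \<open>\<beta>\<close> to \<open>fact M\<close>.\<close>

lemma bounded_denominators:
  obtains D :: nat where "D > 0"
    "\<And>I. fractional_ideal F I \<Longrightarrow> \<exists>c\<in>F. c \<noteq> 0 \<and> (*) c ` I \<subseteq> \<O> \<and> of_nat D \<in> (*) c ` I"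
proof -
  obtain M where M: "M > 0"
    "\<And>x. x \<in> F \<Longrightarrow> \<exists>t\<in>{1..M}. \<exists>w\<in>\<O>. cmod (Nm (of_nat t * x - w)) < 1"
    using approximation by blast
  show ?thesis
  proof (rule that[of "fact M"])
    fix I0 assume I0: "fractional_ideal F I0"
    obtain d where d: "d \<in> \<O>" "d \<noteq> 0" "\<And>x. x \<in> I0 \<Longrightarrow> d * x \<in> \<O>"
      using I0 unfolding fractional_ideal_def by blast
    define I where "I = (*) d ` I0"
    have I: "fractional_ideal F I" unfolding I_def using d by (intro frac_scale I0) (auto intro: O_F)
    have IO: "x \<in> \<O>" if "x \<in> I" for x using that d by (auto simp: I_def)
    define \<mu> where "\<mu> = (\<lambda>x. nat \<lfloor>cmod (Nm x)\<rfloor>)"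
    have \<mu>: "cmod (Nm x) = real (\<mu> x)" if x: "x \<in> \<O>" for x
    proof -
      obtain k where "Nm x = of_int k" using Nm_int[OF x] by (auto elim: Ints_cases)
      thus ?thesis by (simp add: \<mu>_def)
    qed
    obtain x0 where "x0 \<in> I" "x0 \<noteq> 0" using frac_nonzero[OF I] by blast
    then obtain \<beta> where \<beta>: "\<beta> \<in> I" "\<beta> \<noteq> 0" "\<And>x. x \<in> I \<Longrightarrow> x \<noteq> 0 \<Longrightarrow> \<mu> \<beta> \<le> \<mu> x"
      using ex_has_least_nat[of "\<lambda>x. x \<in> I \<and> x \<noteq> 0" x0 \<mu>] by blast
    have \<beta>F: "\<beta> \<in> F" using \<beta> I frac_subset by blast
    have main: "of_nat (fact M) * (x / \<beta>) \<in> \<O>" if x: "x \<in> I" for x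
    proof -
      have xF: "x \<in> F" using x I frac_subset by blast
      obtain t w where t: "t \<in> {1..M}" "w \<in> \<O>" "cmod (Nm (of_nat t * (x / \<beta>) - w)) < 1"
        using M(2)[OF divide_F[OF xF \<beta>F]] by blast
      define y where "y = of_nat t * x - w * \<beta>"
      have yI: "y \<in> I" unfolding y_def
        by (intro frac_diff[OF I] frac_mult[OF I] of_nat_O t x \<beta>)
      have "y = (of_nat t * (x / \<beta>) - w) * \<beta>" using \<beta> by (simp add: y_def field_simps)
      hence "Nm y = Nm (of_nat t * (x / \<beta>) - w) * Nm \<beta>"
        using \<beta>F xF t by (simp add: Nm_mult diff_F mult_F divide_F of_nat_F O_F)
      hence "cmod (Nm y) < cmod (Nm \<beta>)"
        using t(3) Nm_nonzero[OF \<beta>F \<beta>(2)] by (simp add: norm_mult)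
      hence "\<mu> y < \<mu> \<beta>" using \<mu>[OF IO[OF yI]] \<mu>[OF IO[OF \<beta>(1)]] by simp
      hence "y = 0" using \<beta>(3)[OF yI] by fastforce
      hence "x / \<beta> * of_nat t = w" using \<beta> by (simp add: y_def field_simps)
      moreover obtain k where k: "fact M = t * k"
        using t(1) dvd_fact[of t M] by (auto simp: dvd_def)
      ultimately have "of_nat (fact M) * (x / \<beta>) = of_nat k * w" by (simp add: k mult_ac)
      thus ?thesis using t by (auto intro: mult_O of_nat_O)
    qed
    \<comment> \<open>The factor \<open>d\<close> carries \<open>I0\<close> to its integral multiple
      \<open>I\<close>, to which \<open>main\<close> applies.\<close>
    define c where "c = of_nat (fact M) * d / \<beta>"
    have "c \<in> F" unfolding c_def by (intro divide_F[OF _ \<beta>F] mult_F of_nat_F O_F[OF d(1)])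
    moreover have "c \<noteq> 0" using d \<beta> by (simp add: c_def)
    moreover have "c * x = of_nat (fact M) * ((d * x) / \<beta>)" for x by (simp add: c_def)
    hence "(*) c ` I0 \<subseteq> \<O>" using main by (auto simp: I_def simp del: of_nat_fact)
    moreover have "of_nat (fact M) \<in> (*) c ` I0"
    proof -
      obtain b where "\<beta> = d * b" "b \<in> I0" using \<beta> by (auto simp: I_def)
      hence "of_nat (fact M) = c * b" using d \<beta> by (simp add: c_def)
      thus ?thesis using \<open>b \<in> I0\<close> by blast
    qed
    ultimately show "\<exists>c\<in>F. c \<noteq> 0 \<and> (*) c ` I0 \<subseteq> \<O> \<and> of_nat (fact M) \<in> (*) c ` I0" by blast
  qed simp
qed

lemma of_nat_mult_subset:
  assumes I: "fractional_ideal F I" and "of_nat D \<in> I" "x \<in> F" "algebraic_int (x / of_nat D)" "D > 0"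
  shows "x \<in> I"
proof -
  have "x / of_nat D \<in> \<O>" using assms by (intro OI divide_F of_nat_F)
  from frac_mult[OF I this assms(2)] show ?thesis using assms(5) by simp
qed

text \<open>An ideal containing \<open>D\<close> is a union of residue classes modulo
  \<open>D\<close>, hence determined by its image under a function with finitely many values that
  separates these classes.\<close>

lemma finite_ideals_containing:
  assumes "D > 0"
  shows "finite {I. fractional_ideal F I \<and> I \<subseteq> \<O> \<and> of_nat D \<in> I}" (is "finite ?T")
proof -
  obtain f :: "complex \<Rightarrow> nat \<Rightarrow> nat" where f: "finite (f ` \<O>)"
    "\<And>x y. x \<in> \<O> \<Longrightarrow> y \<in> \<O> \<Longrightarrow> f x = f y \<Longrightarrow> algebraic_int ((x - y) / of_nat D)"
    using residues_finite[OF assms] by metis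
  have "inj_on ((`) f) ?T"
  proof (rule inj_onI)
    have "I \<subseteq> J" if IJ: "I \<in> ?T" "J \<in> ?T" "f ` I = f ` J" for I J
    proof
      fix x assume x: "x \<in> I"
      hence "f x \<in> f ` J" using IJ(3) by blast
      then obtain y where y: "y \<in> J" "f x = f y" by blast
      have O: "x \<in> \<O>" "y \<in> \<O>" using x y IJ by auto
      have J: "fractional_ideal F J" "of_nat D \<in> J" using IJ(2) by simp_all
      have "x - y \<in> J"
        by (rule of_nat_mult_subset[OF J diff_F[OF O_F[OF O(1)] O_F[OF O(2)]] f(2)[OF O y(2)] assms])
      hence "x - y + y \<in> J" by (rule frac_add[OF J(1) _ y(1)])
      thus "x \<in> J" by simp
    qed
    note sub = this
    fix I J assume IJ: "I \<in> ?T" "J \<in> ?T" "f ` I = f ` J"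
    show "I = J" by (rule subset_antisym[OF sub[OF IJ] sub[OF IJ(2,1) IJ(3)[symmetric]]])
  qed
  moreover have "(`) f ` ?T \<subseteq> Pow (f ` \<O>)" by auto
  ultimately show ?thesis using f(1) by (meson finite_Pow_iff finite_imageD finite_subset)
qed

text \<open>All \<open>b ^ m * D\<close> lie in \<open>A\<close>, hence are integral, and two of
  them agree modulo \<open>D\<close>. So \<open>b ^ n - b ^ m\<close> is an algebraic integer for
  some \<open>m < n\<close>, and \<open>b\<close> is a root of a monic polynomial with integral
  coefficients.\<close>

lemma stabilizer_integral:
  assumes A: "fractional_ideal F A" "A \<subseteq> \<O>" "of_nat D \<in> A" "D > 0"
    and b: "b \<in> F" "\<And>x. x \<in> A \<Longrightarrow> b * x \<in> A"
  shows "b \<in> \<O>"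
proof -
  obtain f :: "complex \<Rightarrow> nat \<Rightarrow> nat" where f: "finite (f ` \<O>)"
    "\<And>x y. x \<in> \<O> \<Longrightarrow> y \<in> \<O> \<Longrightarrow> f x = f y \<Longrightarrow> algebraic_int ((x - y) / of_nat D)"
    using residues_finite[OF A(4)] by metis
  have pw: "b ^ m * of_nat D \<in> A" for m
    by (induction m) (auto simp: A mult.assoc intro: b)
  have "finite (range (\<lambda>m. f (b ^ m * of_nat D)))"
    using pw A(2) by (intro finite_subset[OF _ f(1)]) auto
  hence "\<not> inj (\<lambda>m. f (b ^ m * of_nat D))" using finite_imageD by blast
  then obtain m n where mn: "m < n" "f (b ^ n * of_nat D) = f (b ^ m * of_nat D)"
    unfolding inj_on_def by (metis UNIV_I linorder_neqE_nat)
  have "algebraic_int ((b ^ n * of_nat D - b ^ m * of_nat D) / of_nat D)"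
    using pw A(2) mn by (intro f) auto
  also have "(b ^ n * of_nat D - b ^ m * of_nat D) / of_nat D = b ^ n - b ^ m"
    using A(4) by (simp add: field_simps)
  finally have y: "algebraic_int (b ^ n - b ^ m)" .
  define p :: "complex poly" where "p = monom 1 n - monom 1 m"
  have "degree (monom 1 n + - monom 1 m :: complex poly) = degree (monom 1 n :: complex poly)"
    using mn(1) by (intro degree_add_eq_left) (simp add: degree_monom_eq)
  hence deg: "degree p = n" by (simp add: p_def degree_monom_eq)
  have "algebraic_int b"
  proof (rule algebraic_int_root[OF y])
    show "poly p b = b ^ n - b ^ m" by (simp add: p_def poly_monom)
    show "\<forall>i. coeff p i \<in> \<int>" by (simp add: p_def)
    show "lead_coeff p = 1" "degree p > 0" using mn(1) unfolding deg by (simp_all add: p_def)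
  qed
  thus ?thesis by (rule OI[OF b(1)])
qed

section \<open>Finite generation and Nakayama's lemma\<close>

definition ospan :: "complex set \<Rightarrow> complex set" where
  "ospan S = {\<Sum>s\<in>S. c s * s |c. c ` S \<subseteq> \<O>}"

text \<open>\<open>D\<close> together with one element of \<open>A\<close> for each value of
  \<open>f\<close> on \<open>A\<close> generates: \<open>x\<close> differs from its representative
  \<open>y\<close> by an integral multiple of \<open>D\<close>.\<close>

lemma ospan_finite_generators:
  assumes A: "fractional_ideal F A" "A \<subseteq> \<O>" "of_nat D \<in> A" "D > 0"
  obtains S where "finite S" "S \<subseteq> A" "A \<subseteq> ospan S"
proof -
  obtain f :: "complex \<Rightarrow> nat \<Rightarrow> nat" where f: "finite (f ` \<O>)"
    "\<And>x y. x \<in> \<O> \<Longrightarrow> y \<in> \<O> \<Longrightarrow> f x = f y \<Longrightarrow> algebraic_int ((x - y) / of_nat D)"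
    using residues_finite[OF A(4)] by metis
  define g where "g = inv_into A f"
  define S where "S = insert (of_nat D) (g ` f ` A)"
  have fin: "finite S" unfolding S_def using finite_subset[OF image_mono[OF A(2)] f(1)] by simp
  have SA: "S \<subseteq> A" unfolding S_def g_def using A(3) by (auto intro: inv_into_into)
  have "x \<in> ospan S" if x: "x \<in> A" for x
  proof -
    define y where "y = g (f x)"
    have y: "y \<in> A" "f y = f x" unfolding y_def g_def using x
      by (auto intro: inv_into_into f_inv_into_f)
    have w: "(x - y) / of_nat D \<in> \<O>"
    proof -
      have "x \<in> \<O>" "y \<in> \<O>" using x y A(2) by auto
      thus ?thesis using y(2)
        by (intro OI[OF divide_F[OF diff_F[OF O_F O_F] of_nat_F] f(2)]) simp_all
    qed
    \<comment> \<open>A sum of two indicators, because \<open>y\<close> and \<open>D\<close> may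
      coincide.\<close>
    define c where "c = (\<lambda>s. (if s = y then 1 else 0) + (if s = of_nat D then (x - y) / of_nat D else 0))"
    have ys: "y \<in> S" using x by (auto simp: S_def y_def)
    have "(\<Sum>s\<in>S. c s * s) = (\<Sum>s\<in>S. if s = y then s else 0)
             + (\<Sum>s\<in>S. if s = of_nat D then (x - y) / of_nat D * s else 0)"
      unfolding sum.distrib[symmetric] by (intro sum.cong) (auto simp: c_def distrib_right)
    also have "\<dots> = y + (x - y) / of_nat D * of_nat D"
      using fin ys by (simp add: S_def)
    also have "\<dots> = x" using A(4) by simp
    finally have "x = (\<Sum>s\<in>S. c s * s)" ..
    moreover have "c ` S \<subseteq> \<O>" using w by (auto simp: c_def intro!: add_O one_O zero_O)
    ultimately show ?thesis unfolding ospan_def by blast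
  qed
  thus ?thesis using that[OF fin SA] by blast
qed

text \<open>Nakayama's lemma by eliminating the generators of \<open>A\<close> one at a time.\<close>

lemma nakayama:
  assumes A: "fractional_ideal F A" "A \<subseteq> \<O>" "of_nat D \<in> A" "D > 0"
    and J: "fractional_ideal F J" "J \<subseteq> \<O>" "A \<star> J = A"
  shows "1 \<in> J"
proof -
  obtain S where S: "finite S" "S \<subseteq> A" "A \<subseteq> ospan S" using ospan_finite_generators[OF A] .
  \<comment> \<open>\<open>P R u\<close> says that \<open>u\<close> is 1 modulo \<open>J\<close> and
    multiplies \<open>A\<close> into the span of \<open>R\<close>. It holds for \<open>S\<close> and
    1; once \<open>R\<close> is empty, \<open>u * D = 0\<close> forces \<open>u = 0\<close> and puts
    1 into \<open>J\<close>.\<close>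
  define P where "P = (\<lambda>R u. 1 - u \<in> J \<and> (\<forall>x\<in>A. \<exists>c. c ` R \<subseteq> \<O> \<and> u * x = (\<Sum>s\<in>R. c s * s)))"
  have "\<exists>u. P (S - T) u" if "finite T" "T \<subseteq> S" for T
    using that
  proof (induction rule: finite_induct)
    case empty
    have "P S 1" using S(3) frac_zero[OF J(1)] by (auto simp: P_def ospan_def)
    thus ?case by auto
  next
    case (insert t T)
    define R where "R = S - T"
    define R' where "R' = R - {t}"
    have R: "finite R" "R = insert t R'" "t \<notin> R'" "finite R'" "S - insert t T = R'"
      using insert S(1) by (auto simp: R_def R'_def)
    obtain u where u: "P R u" using insert R_def by auto
    have comb: "\<exists>c. c ` R \<subseteq> J \<and> u * x = (\<Sum>s\<in>R. c s * s)" if "x \<in> A \<star> J" for x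
      using that
    proof (induction rule: set_prod_induct)
      case (prod a b)
      then obtain c where c: "c ` R \<subseteq> \<O>" "u * a = (\<Sum>s\<in>R. c s * s)" using u by (auto simp: P_def)
      have "u * (a * b) = (u * a) * b" by simp
      also have "\<dots> = (\<Sum>s\<in>R. (c s * b) * s)"
        unfolding c(2) sum_distrib_right by (simp only: mult_ac)
      finally have "u * (a * b) = (\<Sum>s\<in>R. (c s * b) * s)" .
      moreover have "(\<lambda>s. c s * b) ` R \<subseteq> J" using c(1) prod frac_mult[OF J(1)] by auto
      ultimately show ?case by blast
    next
      case (sum x y)
      obtain c where "c ` R \<subseteq> J" "u * x = (\<Sum>s\<in>R. c s * s)" using sum(3) by blast
      moreover obtain c' where "c' ` R \<subseteq> J" "u * y = (\<Sum>s\<in>R. c' s * s)" using sum(4) by blast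
      ultimately have "(\<lambda>s. c s + c' s) ` R \<subseteq> J" "u * (x + y) = (\<Sum>s\<in>R. (c s + c' s) * s)"
        using frac_add[OF J(1)] by (auto simp: distrib_left distrib_right sum.distrib)
      thus ?case by blast
    qed
    have "t \<in> A" using insert.prems S(2) by auto
    then obtain c where c: "c ` R \<subseteq> J" "u * t = (\<Sum>s\<in>R. c s * s)"
      using comb[of t] J(3) by auto
    have cO: "c s \<in> \<O>" if "s \<in> R" for s using that c(1) J(2) by auto
    have ct: "(u - c t) * t = (\<Sum>s\<in>R'. c s * s)" using c(2) R by (simp add: algebra_simps)
    have uO: "u \<in> \<O>" "1 - u \<in> J" using u J(2) diff_O[OF one_O, of "1 - u"] by (auto simp: P_def)
    have ctJ: "c t \<in> J" "c t \<in> \<O>" using c(1) R J(2) by auto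
    \<comment> \<open>Expanding \<open>u * t\<close> with coefficients in \<open>J\<close> and
      moving the term of \<open>t\<close> to the left shows that \<open>u - c t\<close> carries
      \<open>t\<close> into the span of \<open>R'\<close>; the extra factor \<open>u\<close> first
      brings \<open>x\<close> into the span of \<open>R\<close>.\<close>
    have "P R' (u * (u - c t))"
      unfolding P_def
    proof (intro conjI ballI)
      have *: "1 - u * (u - c t) = u * (1 - u) + (1 - u) + u * c t" by (simp add: algebra_simps)
      show "1 - u * (u - c t) \<in> J"
        unfolding * by (intro frac_add[OF J(1)] frac_mult[OF J(1)] uO ctJ)
    next
      fix x assume "x \<in> A"
      then obtain e where e: "e ` R \<subseteq> \<O>" "u * x = (\<Sum>s\<in>R. e s * s)" using u by (auto simp: P_def)
      have "u * (u - c t) * x = (u - c t) * (\<Sum>s\<in>R. e s * s)" using e(2) by (simp add: mult_ac)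
      also have "\<dots> = e t * ((u - c t) * t) + (u - c t) * (\<Sum>s\<in>R'. e s * s)"
        using R by (simp add: algebra_simps)
      also have "\<dots> = (\<Sum>s\<in>R'. (e t * c s + (u - c t) * e s) * s)"
        unfolding ct by (simp add: sum_distrib_left sum.distrib distrib_right mult.assoc)
      finally have "u * (u - c t) * x = \<dots>" .
      moreover have "(\<lambda>s. e t * c s + (u - c t) * e s) ` R' \<subseteq> \<O>"
        using e(1) cO R(2) uO ctJ by (auto intro!: add_O mult_O diff_O)
      ultimately show "\<exists>c'. c' ` R' \<subseteq> \<O> \<and> u * (u - c t) * x = (\<Sum>s\<in>R'. c' s * s)" by blast
    qed
    thus ?case using R(5) by auto
  qed
  from this[OF S(1) subset_refl] obtain u where u: "P {} u" by auto
  hence "u * of_nat D = 0" "1 - u \<in> J" using A(3) by (auto simp: P_def)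
  thus ?thesis using A(4) by simp
qed

end

subsection \<open>The class group\<close>

lemma set_prod_scale_right: "A \<star> ((*) c ` B) = (*) c ` (A \<star> B)"
  by (metis set_prod_commute set_prod_scale)

context number_field
begin

text \<open>Defined by recursion because the group of fractional ideals is only established
  afterwards, with the help of these powers.\<close>

fun ideal_power :: "complex set \<Rightarrow> nat \<Rightarrow> complex set" where
  "ideal_power I 0 = \<O>"
| "ideal_power I (Suc n) = I \<star> ideal_power I n"

lemma frac_power: "fractional_ideal F I \<Longrightarrow> fractional_ideal F (ideal_power I n)"
  by (induction n) (auto intro: frac_O frac_prod)

lemma ideal_power_add:
  assumes "fractional_ideal F I"
  shows "ideal_power I (m + n) = ideal_power I m \<star> ideal_power I n"
proof (induction m)
  case 0
  show ?case using O_set_prod[OF frac_power[OF assms, of n]] by simp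
next
  case (Suc m)
  thus ?case by (simp add: set_prod_assoc)
qed

text \<open>Among the powers of \<open>I\<close>, scaled to be integral and to contain
  \<open>D\<close>, two coincide: \<open>A \<star> J = A\<close> with \<open>J\<close> a scaled
  power of positive exponent. The point is to cancel \<open>A\<close> before it is known to be
  invertible: stability of \<open>A\<close> puts \<open>J\<close> into \<O>, Nakayama puts 1 into
  \<open>J\<close>, and \<open>J = \<O>\<close> exhibits an inverse of \<open>I\<close>.\<close>

lemma inverse_ideal_exists:
  assumes I: "fractional_ideal F I"
  shows "\<exists>J. fractional_ideal F J \<and> I \<star> J = \<O>"
proof -
  obtain D where D: "D > 0"
    "\<And>I. fractional_ideal F I \<Longrightarrow> \<exists>c\<in>F. c \<noteq> 0 \<and> (*) c ` I \<subseteq> \<O> \<and> of_nat D \<in> (*) c ` I"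
    using bounded_denominators by blast
  define T where "T = {I. fractional_ideal F I \<and> I \<subseteq> \<O> \<and> of_nat D \<in> I}"
  have T: "finite T" unfolding T_def by (rule finite_ideals_containing[OF D(1)])
  have "\<forall>n. \<exists>c. c \<in> F \<and> c \<noteq> 0 \<and> (*) c ` ideal_power I n \<in> T"
    using D(2)[OF frac_power[OF I]] frac_scale[OF frac_power[OF I]] unfolding T_def by fast
  then obtain c where c: "\<And>n. c n \<in> F" "\<And>n. c n \<noteq> 0" "\<And>n. (*) (c n) ` ideal_power I n \<in> T"
    by metis
  have "finite (range (\<lambda>n. (*) (c n) ` ideal_power I n))"
    using c(3) by (intro finite_subset[OF _ T]) auto
  hence "\<not> inj (\<lambda>n. (*) (c n) ` ideal_power I n)" using finite_imageD by blast
  then obtain i j where ij: "i < j" "(*) (c j) ` ideal_power I j = (*) (c i) ` ideal_power I i"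
    unfolding inj_on_def by (metis UNIV_I linorder_neqE_nat)
  define A where "A = (*) (c i) ` ideal_power I i"
  define J where "J = (*) (c j / c i) ` ideal_power I (j - i)"
  have A: "fractional_ideal F A" "A \<subseteq> \<O>" "of_nat D \<in> A" using c(3)[of i] by (auto simp: A_def T_def)
  have J: "fractional_ideal F J"
    unfolding J_def using c by (intro frac_scale frac_power I divide_F) auto
  have "A \<star> J = (*) (c i * (c j / c i)) ` (ideal_power I i \<star> ideal_power I (j - i))"
    by (simp only: A_def J_def set_prod_scale set_prod_scale_right scale_scale mult.commute)
  also have "\<dots> = (*) (c j) ` ideal_power I j"
    using ij(1) c(2)[of i] ideal_power_add[OF I, of i "j - i"] by simp
  finally have AJ: "A \<star> J = A" using ij(2) by (simp add: A_def)
  have JO: "J \<subseteq> \<O>"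
  proof
    fix b assume b: "b \<in> J"
    show "b \<in> \<O>"
    proof (rule stabilizer_integral[OF A D(1)])
      show "b \<in> F" using b J frac_subset by blast
      fix x assume "x \<in> A"
      hence "x * b \<in> A \<star> J" using b by (rule set_prodI)
      thus "b * x \<in> A" by (simp add: AJ mult.commute)
    qed
  qed
  have "1 \<in> J" by (rule nakayama[OF A D(1) J JO AJ])
  hence "J = \<O>" using JO frac_mult[OF J, of _ 1] by auto
  moreover define k where "k = j - i - 1"
  moreover have "j - i = Suc k" using ij(1) by (simp add: k_def)
  ultimately have "I \<star> ((*) (c j / c i) ` ideal_power I k) = \<O>"
    unfolding J_def by (metis ideal_power.simps(2) set_prod_commute set_prod_scale)
  moreover have "fractional_ideal F ((*) (c j / c i) ` ideal_power I k)"
    using c by (intro frac_scale frac_power I divide_F) auto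
  ultimately show ?thesis by blast
qed

section \<open>The group of fractional ideals and its quotient\<close>

abbreviation "FI \<equiv> fractional_ideals F"
abbreviation "PI \<equiv> principal_fractional_ideals F"

lemma FI_simps [simp]:
  "carrier FI = {I. fractional_ideal F I}" "x \<otimes>\<^bsub>FI\<^esub> y = x \<star> y" "\<one>\<^bsub>FI\<^esub> = \<O>"
  by (simp_all add: fractional_ideals_def)

lemma comm_group_FI: "comm_group FI"
proof (rule comm_groupI)
  fix x assume "x \<in> carrier FI"
  then obtain J where "fractional_ideal F J" "x \<star> J = \<O>" using inverse_ideal_exists by auto
  thus "\<exists>y\<in>carrier FI. y \<otimes>\<^bsub>FI\<^esub> x = \<one>\<^bsub>FI\<^esub>"
    using set_prod_commute by auto
next
  fix x y show "x \<otimes>\<^bsub>FI\<^esub> y = y \<otimes>\<^bsub>FI\<^esub> x"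
    using set_prod_commute by simp
qed (auto simp: set_prod_assoc frac_O O_set_prod frac_prod)

sublocale FI: comm_group FI by (rule comm_group_FI)

lemma PI_def: "PI = {(*) c ` \<O> |c. c \<in> F \<and> c \<noteq> 0}"
  by (simp add: principal_fractional_ideals_def)

lemma PI_frac: "I \<in> PI \<Longrightarrow> fractional_ideal F I"
  by (auto simp: PI_def intro: frac_scale frac_O)

lemma principal_prod:
  "fractional_ideal F I \<Longrightarrow> ((*) c ` \<O>) \<star> I = (*) c ` I"
  by (simp add: set_prod_scale O_set_prod)

lemma subgroup_PI: "subgroup PI FI"
proof (rule FI.subgroupI)
  show "PI \<subseteq> carrier FI" using PI_frac by auto
  show "PI \<noteq> {}" using one_F by (auto simp: PI_def intro!: exI[of _ 1])
next
  fix I assume "I \<in> PI"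
  then obtain c where c: "I = (*) c ` \<O>" "c \<in> F" "c \<noteq> 0" by (auto simp: PI_def)
  have f: "fractional_ideal F ((*) (inverse c) ` \<O>)"
    using c by (intro frac_scale frac_O inverse_F) auto
  have "((*) (inverse c) ` \<O>) \<star> I = \<O>"
    using c f by (simp add: principal_prod frac_scale frac_O scale_scale)
  hence "inv\<^bsub>FI\<^esub> I = (*) (inverse c) ` \<O>"
    using f PI_frac[OF \<open>I \<in> PI\<close>] by (intro FI.inv_equality) auto
  thus "inv\<^bsub>FI\<^esub> I \<in> PI" using c inverse_F by (auto simp: PI_def)
next
  fix I J assume "I \<in> PI" "J \<in> PI"
  then obtain c d where c: "I = (*) c ` \<O>" "c \<in> F" "c \<noteq> 0" "J = (*) d ` \<O>" "d \<in> F" "d \<noteq> 0"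
    by (auto simp: PI_def)
  have "I \<otimes>\<^bsub>FI\<^esub> J = (*) (c * d) ` \<O>"
    using c by (simp add: principal_prod frac_scale frac_O scale_scale)
  thus "I \<otimes>\<^bsub>FI\<^esub> J \<in> PI" using c mult_F[of c d] by (auto simp: PI_def)
qed

sublocale PI: normal PI FI
  by (rule FI.subgroup_imp_normal[OF subgroup_PI])

lemma group_class_group: "group (class_group F)"
  unfolding class_group_def by (rule PI.factorgroup_is_group)

lemma carrier_class_group: "carrier (class_group F) = ideal_class F ` {I. fractional_ideal F I}"
  by (auto simp: class_group_def carrier_FactGroup ideal_class_def)

lemma ideal_class_eq:
  assumes "fractional_ideal F I" "c \<in> F" "c \<noteq> 0"
  shows "ideal_class F ((*) c ` I) = ideal_class F I"
proof -
  have "(*) c ` I \<in> PI #>\<^bsub>FI\<^esub> I"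
    using assms principal_prod[OF assms(1), of c] by (force simp: r_coset_def PI_def)
  thus ?thesis unfolding ideal_class_def
    using FI.repr_independence[OF _ _ subgroup_PI] assms(1) by simp
qed

lemma finite_class_group: "finite (carrier (class_group F))"
proof -
  obtain D where D: "D > 0"
    "\<And>I. fractional_ideal F I \<Longrightarrow> \<exists>c\<in>F. c \<noteq> 0 \<and> (*) c ` I \<subseteq> \<O> \<and> of_nat D \<in> (*) c ` I"
    using bounded_denominators by blast
  have "carrier (class_group F) \<subseteq>
          ideal_class F ` {I. fractional_ideal F I \<and> I \<subseteq> \<O> \<and> of_nat D \<in> I}"
  proof
    fix Z assume "Z \<in> carrier (class_group F)"
    then obtain I where I: "Z = ideal_class F I" "fractional_ideal F I"
      by (auto simp: carrier_class_group)
    obtain c where c: "c \<in> F" "c \<noteq> 0" "(*) c ` I \<subseteq> \<O>" "of_nat D \<in> (*) c ` I" using D(2)[OF I(2)] by blast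
    have "Z = ideal_class F ((*) c ` I)" using I c by (simp add: ideal_class_eq)
    thus "Z \<in> ideal_class F ` {I. fractional_ideal F I \<and> I \<subseteq> \<O> \<and> of_nat D \<in> I}"
      using frac_scale[OF I(2) c(1,2)] c(3,4) by blast
  qed
  thus ?thesis using finite_ideals_containing[OF D(1)] by (meson finite_imageI finite_subset)
qed

text \<open>Cauchy's theorem, extracted from Sylow's: a nontrivial element of a subgroup of order
  p^a has order p^k with k > 0, and this order divides any exponent \<open>n\<close> of the class
  group.\<close>

lemma prime_dvd_class_number:
  assumes p: "Factorial_Ring.prime p" "p dvd class_number F"
    and n: "\<And>I. fractional_ideal F I \<Longrightarrow> ideal_power I n \<in> PI"
  shows "p dvd n"
proof -
  interpret C: group "class_group F" by (rule group_class_group)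
  define a where "a = multiplicity p (class_number F)"
  have cn: "class_number F > 0" unfolding class_number_def
    using finite_class_group by (simp add: C.order_gt_0_iff_finite)
  have "Suc 0 \<le> a" unfolding a_def using p cn
    by (intro multiplicity_geI) (auto simp: prime_elem_multiplicity_eq_zero_iff)
  obtain m where m: "class_number F = p ^ a * m"
    unfolding a_def using multiplicity_dvd[of p "class_number F"] by (auto simp: dvd_def)
  obtain H where H: "subgroup H (class_group F)" "card H = p ^ a"
    using sylow_thm[OF p(1) group_class_group _ finite_class_group] m
    unfolding class_number_def by metis
  have pa: "p ^ a > 1" using \<open>Suc 0 \<le> a\<close> prime_gt_1_nat[OF p(1)] by (intro one_less_power) auto
  have fH: "finite H" using H(2) pa by (intro card_ge_0_finite) linarith
  have "\<not> H \<subseteq> {\<one>\<^bsub>class_group F\<^esub>}"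
    using card_mono[of "{\<one>\<^bsub>class_group F\<^esub>}" H] H(2) pa by auto
  then obtain x where x: "x \<in> H" "x \<noteq> \<one>\<^bsub>class_group F\<^esub>" by blast
  have xC: "x \<in> carrier (class_group F)" using x H(1) subgroup.mem_carrier by metis
  have "x [^]\<^bsub>class_group F\<^esub> (p ^ a) = \<one>\<^bsub>class_group F\<^esub>"
  proof -
    interpret HG: group "class_group F\<lparr>carrier := H\<rparr>"
      by (rule subgroup.subgroup_is_group[OF H(1) group_class_group])
    have "x [^]\<^bsub>class_group F\<lparr>carrier := H\<rparr>\<^esub> (Coset.order (class_group F\<lparr>carrier := H\<rparr>))
            = \<one>\<^bsub>class_group F\<lparr>carrier := H\<rparr>\<^esub>"
      using x(1) by (intro HG.pow_order_eq_1) simp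
    thus ?thesis using H by (simp add: Coset.order_def nat_pow_def)
  qed
  hence "C.ord x dvd p ^ a" using C.pow_eq_id[OF xC] by simp
  then obtain k where k: "C.ord x = p ^ k" using p(1) by (auto simp: divides_primepow_nat)
  have "k \<noteq> 0"
  proof
    assume "k = 0"
    hence "C.ord x = 1" using k by simp
    thus False using C.ord_eq_1[OF xC] x by simp
  qed
  hence "p dvd C.ord x" using k by (simp add: dvd_power)
  moreover have "x [^]\<^bsub>class_group F\<^esub> n = \<one>\<^bsub>class_group F\<^esub>"
  proof -
    obtain I where I: "x = PI #>\<^bsub>FI\<^esub> I" "fractional_ideal F I"
      using xC by (auto simp: carrier_class_group ideal_class_def)
    have "x [^]\<^bsub>class_group F\<^esub> j = PI #>\<^bsub>FI\<^esub> ideal_power I j" for j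
    proof (induction j)
      case 0
      show ?case using FI.coset_join2[OF _ subgroup_PI, of \<O>] subgroup.one_closed[OF subgroup_PI]
        by (simp add: class_group_def frac_O)
    next
      case (Suc j)
      have "x [^]\<^bsub>class_group F\<^esub> Suc j = (PI #>\<^bsub>FI\<^esub> ideal_power I j) <#>\<^bsub>FI\<^esub> (PI #>\<^bsub>FI\<^esub> I)"
        using Suc I by (simp add: class_group_def)
      also have "\<dots> = PI #>\<^bsub>FI\<^esub> (ideal_power I j \<otimes>\<^bsub>FI\<^esub> I)"
        by (rule PI.rcos_sum) (simp_all add: I frac_power)
      finally show ?case using set_prod_commute by simp
    qed
    hence "x [^]\<^bsub>class_group F\<^esub> n = PI #>\<^bsub>FI\<^esub> ideal_power I n" .
    also have "\<dots> = PI" using n[OF I(2)] frac_power[OF I(2)] by (intro FI.coset_join2 subgroup_PI) auto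
    finally show ?thesis by (simp add: class_group_def)
  qed
  hence "C.ord x dvd n" using C.pow_eq_id[OF xC] by simp
  ultimately show ?thesis by (rule dvd_trans)
qed

text \<open>Induction over ideals from generators of the class group. As \<open>Q\<close> is
  multiplicative and holds for principal ideals, it spreads over whole classes; the condition
  phrased with \<open>I \<star> J = \<O>\<close> covers inverses of generators.\<close>

lemma class_group_generated_induct:
  assumes gen: "generate (class_group F) (ideal_class F ` S) = carrier (class_group F)"
    and S: "\<And>P. P \<in> S \<Longrightarrow> fractional_ideal F P"
    and Q: "\<And>P. P \<in> S \<Longrightarrow> Q P"
      "\<And>c. c \<in> F \<Longrightarrow> c \<noteq> 0 \<Longrightarrow> Q ((*) c ` \<O>)"
      "\<And>I J. fractional_ideal F I \<Longrightarrow> fractional_ideal F J \<Longrightarrow> Q I \<Longrightarrow> Q J \<Longrightarrow> Q (I \<star> J)"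
      "\<And>I J. fractional_ideal F I \<Longrightarrow> fractional_ideal F J \<Longrightarrow> I \<star> J = \<O> \<Longrightarrow> Q I \<Longrightarrow> Q J"
    and I: "fractional_ideal F I"
  shows "Q I"
proof -
  have coset: "Q J" if Z: "Z = PI #>\<^bsub>FI\<^esub> I'" "fractional_ideal F I'" "Q I'" "J \<in> Z" for Z I' J
  proof -
    obtain c where "c \<in> F" "c \<noteq> 0" "J = (*) c ` \<O> \<star> I'"
      using Z by (auto simp: r_coset_def PI_def)
    thus ?thesis using Z by (auto intro: Q(2,3) frac_scale frac_O)
  qed
  \<comment> \<open>By \<open>coset\<close>, one representative satisfying \<open>Q\<close> in each
    class of the generated subgroup is enough.\<close>
  have ex: "\<exists>I'. Z = PI #>\<^bsub>FI\<^esub> I' \<and> fractional_ideal F I' \<and> Q I'"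
    if "Z \<in> generate (class_group F) (ideal_class F ` S)" for Z
    using that
  proof (induction rule: generate.induct)
    case one
    have "PI #>\<^bsub>FI\<^esub> \<O> = PI"
      using FI.coset_join2[OF _ subgroup_PI, of \<O>] subgroup.one_closed[OF subgroup_PI] frac_O by simp
    moreover have "Q \<O>" using Q(2)[of 1] one_F by simp
    ultimately show ?case using frac_O by (auto simp: class_group_def intro!: exI[of _ \<O>])
  next
    case (incl Z)
    thus ?case using S Q(1) by (auto simp: ideal_class_def)
  next
    case (inv Z)
    then obtain P where P: "Z = PI #>\<^bsub>FI\<^esub> P" "P \<in> S" by (auto simp: ideal_class_def)
    have PF: "P \<in> carrier FI" using S P by simp
    have XC: "Z \<in> carrier (FI Mod PI)" using P PF by (auto simp: carrier_FactGroup)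
    have "inv\<^bsub>class_group F\<^esub> Z = PI #>\<^bsub>FI\<^esub> inv\<^bsub>FI\<^esub> P"
      unfolding class_group_def using PI.inv_FactGroup[OF XC] PI.rcos_inv[OF PF] P by simp
    moreover have "fractional_ideal F (inv\<^bsub>FI\<^esub> P)" using FI.inv_closed[OF PF] by simp
    moreover have "Q (inv\<^bsub>FI\<^esub> P)"
      by (rule Q(4)[OF S[OF P(2)] calculation(2) _ Q(1)[OF P(2)]]) (use FI.r_inv[OF PF] in simp)
    ultimately show ?case by blast
  next
    case (eng Z W)
    then obtain I1 I2 where 1: "Z = PI #>\<^bsub>FI\<^esub> I1" "fractional_ideal F I1" "Q I1"
      and 2: "W = PI #>\<^bsub>FI\<^esub> I2" "fractional_ideal F I2" "Q I2" by blast
    have "Z \<otimes>\<^bsub>class_group F\<^esub> W = PI #>\<^bsub>FI\<^esub> (I1 \<otimes>\<^bsub>FI\<^esub> I2)"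
      using PI.rcos_sum[of I1 I2] 1 2 by (simp add: class_group_def)
    thus ?case using Q(3)[of I1 I2] 1 2 frac_prod[of I1 I2] by auto
  qed
  have "PI #>\<^bsub>FI\<^esub> I \<in> carrier (class_group F)" using I by (auto simp: carrier_class_group ideal_class_def)
  then obtain I' where I': "PI #>\<^bsub>FI\<^esub> I = PI #>\<^bsub>FI\<^esub> I'" "fractional_ideal F I'" "Q I'"
    using ex gen by blast
  have "I \<in> PI #>\<^bsub>FI\<^esub> I" using I subgroup_PI by (intro FI.rcos_self) auto
  thus ?thesis using coset[OF I'(1,2,3)] by blast
qed

end

subsection \<open>The prime element of a cyclotomic field of prime degree\<close>

abbreviation ipoly_at :: "int poly \<Rightarrow> complex \<Rightarrow> complex" where
  "ipoly_at p z \<equiv> poly (map_poly of_int p) z"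

lemma ipoly_at_diff: "ipoly_at (p - q) z = ipoly_at p z - ipoly_at q z"
  by (simp add: of_int_poly_hom.hom_minus)

lemma ipoly_at_smult: "ipoly_at (smult c p) z = of_int c * ipoly_at p z"
  by (simp add: of_int_hom.map_poly_hom_smult)

definition poly_of_fun :: "nat \<Rightarrow> (nat \<Rightarrow> 'a) \<Rightarrow> 'a :: comm_ring_1 poly" where
  "poly_of_fun m c = (\<Sum>j<m. monom (c j) j)"

lemma coeff_poly_of_fun: "coeff (poly_of_fun m c) i = (if i < m then c i else 0)"
  by (simp add: poly_of_fun_def coeff_sum sum.delta)

lemma poly_poly_of_fun: "poly (poly_of_fun m c) z = (\<Sum>j<m. c j * z ^ j)"
  by (simp add: poly_of_fun_def poly_sum poly_monom)

lemma ipoly_at_poly_of_fun: "ipoly_at (poly_of_fun m c) z = (\<Sum>j<m. of_int (c j) * z ^ j)"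
proof -
  have "map_poly of_int (poly_of_fun m c) = (poly_of_fun m (\<lambda>j. of_int (c j)) :: complex poly)"
    by (rule poly_eqI) (simp add: coeff_map_poly coeff_poly_of_fun)
  thus ?thesis by (simp add: poly_poly_of_fun)
qed

lemma degree_poly_of_fun: "m > 0 \<Longrightarrow> degree (poly_of_fun m c) < m"
  by (rule le_less_trans[OF degree_le[of "m - 1"]]) (auto simp: coeff_poly_of_fun)

lemma algebraic_int_ipoly_at: "algebraic_int z \<Longrightarrow> algebraic_int (ipoly_at p z)"
  by (simp add: poly_altdef algebraic_int_sum algebraic_int_mult algebraic_int_power)

lemma common_denominator:
  assumes "finite I" "\<And>i. i \<in> I \<Longrightarrow> r i \<in> (\<rat> :: complex set)"
  shows "\<exists>D>0. \<forall>i\<in>I. of_nat D * r i \<in> \<int>"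
  using assms
proof (induction rule: finite_induct)
  case (insert i I)
  obtain D where D: "D > 0" "\<forall>i\<in>I. of_nat D * r i \<in> \<int>" using insert by auto
  obtain a b where ab: "r i = of_int a / of_int b" "b > 0" "coprime a b"
    using insert.prems[of i] by (auto elim: Rats_cases')
  have 1: "of_nat (nat b) * r i = of_int a" using ab by simp
  have "of_nat (D * nat b) * r j \<in> \<int>" if "j \<in> insert i I" for j
  proof (cases "j = i")
    case True
    have "of_nat (D * nat b) * r j = of_nat D * (of_nat (nat b) * r i)" using True by simp
    also have "\<dots> = of_nat D * of_int a" unfolding 1 ..
    finally show ?thesis by (metis Ints_mult Ints_of_nat Ints_of_int)
  next
    case False
    have "of_nat (D * nat b) * r j = of_nat (nat b) * (of_nat D * r j)" by simp
    moreover have "of_nat D * r j \<in> \<int>" using False that D by blast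
    ultimately show ?thesis by (metis Ints_mult Ints_of_nat)
  qed
  thus ?case using D ab by (intro exI[of _ "D * nat b"]) auto
qed auto

locale cyclotomic =
  fixes l :: nat and \<zeta> :: complex
  assumes prime_l: "Factorial_Ring.prime l" and l_gt_2: "l > 2"
    and primitive: "primitive_root_of_unity l \<zeta>"
begin

lemma l0: "l > 0" using l_gt_2 by simp

lemma zeta_l: "\<zeta> ^ l = 1" using primitive by (simp add: primitive_root_of_unity_def)

lemma zeta_pow_ne_1: "0 < k \<Longrightarrow> k < l \<Longrightarrow> \<zeta> ^ k \<noteq> 1"
  using primitive by (simp add: primitive_root_of_unity_def)

lemma zeta_ne_0: "\<zeta> \<noteq> 0" using zeta_l l0 by (metis power_0_left not_gr_zero zero_neq_one)

lemma power_mod_l: "z ^ l = 1 \<Longrightarrow> z ^ (n mod l) = (z :: complex) ^ n"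
proof -
  assume z: "z ^ l = 1"
  have "z ^ n = z ^ (l * (n div l) + n mod l)" by simp
  also have "\<dots> = z ^ (n mod l)" unfolding power_add power_mult z by simp
  finally show ?thesis by simp
qed

lemma zeta_pow_l: "(\<zeta> ^ a) ^ l = 1"
  by (metis mult.commute power_mult power_one zeta_l)

lemma zeta_pow_cong: "[a = b] (mod l) \<Longrightarrow> \<zeta> ^ a = \<zeta> ^ b"
  using power_mod_l[OF zeta_l] unfolding cong_def by metis

lemma zeta_pow_eq_1_iff: "\<zeta> ^ a = 1 \<longleftrightarrow> l dvd a"
  using power_mod_l[OF zeta_l, of a] zeta_pow_ne_1[of "a mod l"] l0
  by (metis dvd_eq_mod_eq_0 mod_less_divisor not_gr_zero power_0)

lemma zeta_pow_eq_iff: "\<zeta> ^ a = \<zeta> ^ b \<longleftrightarrow> [a = b] (mod l)"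
proof
  assume eq: "\<zeta> ^ a = \<zeta> ^ b"
  have *: "[a = b] (mod l)" if "a \<le> b" "\<zeta> ^ a = \<zeta> ^ b" for a b
  proof -
    have "\<zeta> ^ a * \<zeta> ^ (b - a) = \<zeta> ^ b" using that(1) by (simp flip: power_add)
    hence "\<zeta> ^ (b - a) = 1" using zeta_ne_0 that(2) by simp
    hence "l dvd b - a" by (simp add: zeta_pow_eq_1_iff)
    thus ?thesis using that(1) by (metis cong_altdef_nat cong_sym)
  qed
  show "[a = b] (mod l)"
  proof (cases "a \<le> b")
    case False
    hence "[b = a] (mod l)" by (intro *) (simp_all add: eq)
    thus ?thesis by (rule cong_sym)
  qed (rule *[OF _ eq])
qed (rule zeta_pow_cong)

lemma alg_zeta_pow: "algebraic_int (\<zeta> ^ a)"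
proof -
  have "algebraic_int \<zeta>"
    by (rule algebraic_int_root[of 1 "monom 1 l"]) (auto simp: poly_monom zeta_l degree_monom_eq l0)
  thus ?thesis by (rule algebraic_int_power)
qed

lemma alg_zeta: "algebraic_int \<zeta>" using alg_zeta_pow[of 1] by simp

lemma sum_powers_root:
  assumes "z ^ l = 1" "z \<noteq> 1" shows "(\<Sum>j<l. z ^ j) = (0::complex)"
  using power_diff_1_eq[of z l] assms by simp

lemma sum_zeta_pow: "(\<Sum>j<l. (\<zeta> ^ a) ^ j) = (if l dvd a then of_nat l else 0)"
  using sum_powers_root[OF zeta_pow_l, of a] zeta_pow_eq_1_iff[of a] by auto

text \<open>With \<open>z = \<zeta> ^ a\<close> the powers of \<open>z\<close> sum to zero, so
  \<open>l\<close> is the sum of the \<open>1 - z ^ j\<close>, each divisible by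
  \<open>1 - z\<close>.\<close>

lemma l_div_one_minus_zeta_pow:
  assumes "\<not> l dvd a" shows "algebraic_int (of_nat l / (1 - \<zeta> ^ a))"
proof -
  have ne: "\<zeta> ^ a \<noteq> 1" using assms zeta_pow_eq_1_iff by simp
  have "of_nat l = (\<Sum>j<l. 1 - (\<zeta> ^ a) ^ j)"
    using sum_zeta_pow[of a] assms by (simp add: sum_subtractf)
  also have "\<dots> = (\<Sum>j<l. (1 - \<zeta> ^ a) * (\<Sum>i<j. (\<zeta> ^ a) ^ i))"
    by (intro sum.cong refl) (simp add: one_diff_power_eq)
  also have "\<dots> = (1 - \<zeta> ^ a) * (\<Sum>j<l. \<Sum>i<j. (\<zeta> ^ a) ^ i)" by (simp add: sum_distrib_left)
  finally have "of_nat l / (1 - \<zeta> ^ a) = (\<Sum>j<l. \<Sum>i<j. (\<zeta> ^ a) ^ i)"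
    using ne by (simp add: field_simps)
  thus ?thesis by (simp add: algebraic_int_sum algebraic_int_power alg_zeta_pow)
qed

text \<open>The value at 1 of the cyclotomic polynomial. \<open>P\<close> and \<open>Q\<close> are
  monic of degree \<open>l - 1\<close> and share \<open>l - 1\<close> distinct roots, so their
  difference, of smaller degree, is zero.\<close>

lemma prod_one_minus_zeta: "(\<Prod>i\<in>{1..<l}. 1 - \<zeta> ^ i) = of_nat l"
proof -
  define P where "P = (\<Prod>i\<in>{1..<l}. [:- (\<zeta> ^ i), 1:])"
  define Q where "Q = poly_of_fun l (\<lambda>_. 1 :: complex)"
  have degP: "degree P = l - 1" unfolding P_def by (subst degree_prod_eq_sum_degree) auto
  have leadP: "coeff P (l - 1) = 1"
    using lead_coeff_prod[of "\<lambda>i. [:- (\<zeta> ^ i), 1:]" "{1..<l}"] degP by (simp add: P_def)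
  have degQ: "degree Q \<le> l - 1" using degree_poly_of_fun[OF l0] unfolding Q_def
    by (metis Suc_pred' l0 less_Suc_eq_le)
  have "P - Q = 0"
  proof (rule ccontr)
    assume ne: "P - Q \<noteq> 0"
    have "degree (P - Q) \<le> l - 1" using degP degQ by (simp add: degree_diff_le)
    moreover have "coeff (P - Q) (l - 1) = 0" using leadP l0 by (simp add: Q_def coeff_poly_of_fun)
    ultimately have deg: "degree (P - Q) < l - 1"
      using ne by (metis le_neq_implies_less leading_coeff_0_iff)
    have inj: "inj_on (\<lambda>i. \<zeta> ^ i) {1..<l}"
      by (rule inj_onI) (auto simp: zeta_pow_eq_iff cong_def)
    have "(\<lambda>i. \<zeta> ^ i) ` {1..<l} \<subseteq> {x. poly (P - Q) x = 0}"
    proof clarify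
      fix i assume i: "i \<in> {1..<l}"
      have "poly P (\<zeta> ^ i) = 0" unfolding P_def poly_prod using i by (intro prod_zero) auto
      moreover have "poly Q (\<zeta> ^ i) = 0"
        using i sum_zeta_pow[of i] by (auto simp: Q_def poly_poly_of_fun dest: dvd_imp_le)
      ultimately show "poly (P - Q) (\<zeta> ^ i) = 0" by simp
    qed
    hence "card ((\<lambda>i. \<zeta> ^ i) ` {1..<l}) \<le> card {x. poly (P - Q) x = 0}"
      using poly_roots_finite[OF ne] by (intro card_mono) auto
    also have "\<dots> \<le> degree (P - Q)" by (rule card_poly_roots_bound[OF ne])
    finally show False using deg card_image[OF inj] by simp
  qed
  hence "poly P 1 = poly Q 1" by simp
  thus ?thesis by (simp add: P_def Q_def poly_prod poly_poly_of_fun)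
qed

definition \<pi> :: complex where "\<pi> = 1 - \<zeta>"

lemma pi_ne_0: "\<pi> \<noteq> 0" using zeta_pow_ne_1[of 1] l_gt_2 by (auto simp: \<pi>_def)

lemma alg_pi: "algebraic_int \<pi>" unfolding \<pi>_def by (intro algebraic_int_diff alg_zeta) simp

text \<open>In the product formula for \<open>l\<close> each of the \<open>l - 1\<close> factors
  \<open>1 - \<zeta> ^ i\<close> is a multiple of \<pi>.\<close>

lemma l_div_pi_pow:
  assumes "m \<le> l - 1" shows "algebraic_int (of_nat l / \<pi> ^ m)"
proof -
  have "of_nat l / \<pi> ^ (l - 1) = (\<Prod>i\<in>{1..<l}. (1 - \<zeta> ^ i) / \<pi>)"
    by (simp only: prod_dividef prod_one_minus_zeta prod_constant card_atLeastLessThan)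
  also have "\<dots> = (\<Prod>i\<in>{1..<l}. \<Sum>j<i. \<zeta> ^ j)"
    using pi_ne_0 by (intro prod.cong) (auto simp: one_diff_power_eq \<pi>_def)
  finally have 1: "algebraic_int (of_nat l / \<pi> ^ (l - 1))"
    by (simp add: algebraic_int_prod algebraic_int_sum alg_zeta_pow)
  have "\<pi> ^ (l - 1) = \<pi> ^ m * \<pi> ^ (l - 1 - m)"
    by (metis assms le_add_diff_inverse power_add)
  hence "of_nat l / \<pi> ^ m = of_nat l / \<pi> ^ (l - 1) * \<pi> ^ (l - 1 - m)" using pi_ne_0 by simp
  thus ?thesis by (metis 1 alg_pi algebraic_int_mult algebraic_int_power)
qed

text \<open>If \<open>i * k\<close> is 1 modulo \<open>l\<close>, then \<zeta> is the
  \<open>k\<close>-th power of \<open>\<zeta> ^ i\<close>; so the factors of the product formula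
  divide \<pi> as well.\<close>

lemma pi_div_one_minus_zeta_pow:
  assumes "\<not> l dvd i" shows "algebraic_int (\<pi> / (1 - \<zeta> ^ i))"
proof -
  have "coprime i l" using assms prime_l prime_imp_coprime_nat coprime_commute by blast
  then obtain k where k: "[i * k = 1] (mod l)" using cong_solve_coprime_nat by auto
  have "\<pi> = 1 - (\<zeta> ^ i) ^ k" using zeta_pow_cong[OF k] by (simp add: \<pi>_def power_mult)
  hence "\<pi> = (1 - \<zeta> ^ i) * (\<Sum>j<k. (\<zeta> ^ i) ^ j)" by (simp only: one_diff_power_eq)
  moreover have "1 - \<zeta> ^ i \<noteq> 0" using assms zeta_pow_eq_1_iff[of i] by simp
  ultimately have "\<pi> / (1 - \<zeta> ^ i) = (\<Sum>j<k. (\<zeta> ^ i) ^ j)" by simp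
  thus ?thesis by (simp add: algebraic_int_sum algebraic_int_power alg_zeta_pow)
qed

lemma pi_pow_div_l: "algebraic_int (\<pi> ^ (l - 1) / of_nat l)"
proof -
  have "\<pi> ^ (l - 1) / of_nat l = (\<Prod>i\<in>{1..<l}. \<pi> / (1 - \<zeta> ^ i))"
    by (simp only: prod_dividef prod_one_minus_zeta prod_constant card_atLeastLessThan)
  thus ?thesis by (auto intro!: algebraic_int_prod pi_div_one_minus_zeta_pow dest: dvd_imp_le)
qed

text \<open>If \<pi> divides \<open>c\<close>, then \<open>\<pi> ^ (l - 1)\<close>, which is
  \<open>l\<close> up to a unit, divides \<open>c ^ (l - 1)\<close>; the quotient by
  \<open>l\<close> is a rational algebraic integer, hence an integer.\<close>

lemma l_dvd_of_pi:
  assumes "algebraic_int (of_int c / \<pi>)" shows "int l dvd c"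
proof -
  have "(of_int (c ^ (l - 1)) / of_int (int l) :: complex)
          = (of_int c / \<pi>) ^ (l - 1) * (\<pi> ^ (l - 1) / of_nat l)"
    using pi_ne_0 by (simp add: power_divide)
  also have "algebraic_int \<dots>"
    by (intro algebraic_int_mult algebraic_int_power assms pi_pow_div_l)
  finally have "(of_int (c ^ (l - 1)) / of_int (int l) :: complex) \<in> \<int>"
    by (intro rational_algebraic_int_is_int) auto
  then obtain z where "(of_int (c ^ (l - 1)) / of_int (int l) :: complex) = of_int z"
    by (auto elim: Ints_cases)
  hence "(of_int (c ^ (l - 1)) :: complex) = of_int (z * int l)" using l0 by (simp add: field_simps)
  hence "int l dvd c ^ (l - 1)" by (simp only: of_int_eq_iff dvd_triv_right)
  thus ?thesis using prime_l by (meson prime_dvd_power prime_nat_int_transfer)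
qed

text \<open>Synthetic division by \<open>X - 1\<close> is division of the value at \<open>\<zeta>\<close> by \<open>\<pi>\<close>, up to sign.\<close>

lemma l_dvd_ipoly:
  assumes "m \<le> l - 1" "p = 0 \<or> degree p < m" "algebraic_int (ipoly_at p \<zeta> / \<pi> ^ m)"
  shows "\<exists>q. p = smult (int l) q"
  using assms
proof (induction m arbitrary: p)
  case 0
  thus ?case by (auto intro: exI[of _ 0])
next
  case (Suc m)
  define s where "s = synthetic_div p 1"
  have p: "p = pCons (poly p 1) s - s"
    using synthetic_div_correct[of p 1] by (simp add: s_def eq_diff_eq)
  have ev: "ipoly_at p \<zeta> = of_int (poly p 1) - \<pi> * ipoly_at s \<zeta>"
    by (subst p) (simp add: ipoly_at_diff of_int_hom.map_poly_pCons_hom \<pi>_def algebra_simps)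
  \<comment> \<open>\<pi> divides the value of \<open>p\<close> at \<zeta> and hence the integer
    \<open>poly p 1\<close>, which is thus a multiple of \<open>l\<close>. As
    \<open>l / \<pi> ^ Suc m\<close> is integral, divisibility by \<open>\<pi> ^ m\<close> is passed
    on to \<open>s\<close>.\<close>
  have "of_int (poly p 1) / \<pi> = \<pi> ^ m * (ipoly_at p \<zeta> / \<pi> ^ Suc m) + ipoly_at s \<zeta>"
    using pi_ne_0 unfolding ev by (simp add: field_simps)
  also have "algebraic_int \<dots>"
    by (intro algebraic_int_add algebraic_int_mult algebraic_int_power alg_pi Suc.prems
        algebraic_int_ipoly_at alg_zeta)
  finally obtain k where k: "poly p 1 = int l * k" using l_dvd_of_pi by (auto simp: dvd_def)
  have "ipoly_at s \<zeta> / \<pi> ^ m = of_int k * (of_nat l / \<pi> ^ Suc m) - ipoly_at p \<zeta> / \<pi> ^ Suc m"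
    using pi_ne_0 unfolding ev k by (simp add: field_simps)
  also have "algebraic_int \<dots>"
    by (intro algebraic_int_diff algebraic_int_mult l_div_pi_pow Suc.prems) simp
  finally have 1: "algebraic_int (ipoly_at s \<zeta> / \<pi> ^ m)" .
  have "s = 0 \<or> degree s < m"
  proof (cases "degree p = 0")
    case True
    thus ?thesis by (auto simp: s_def synthetic_div_eq_0_iff)
  next
    case False
    thus ?thesis using Suc.prems(2) by (auto simp: s_def degree_synthetic_div)
  qed
  then obtain q where "s = smult (int l) q" using Suc.IH[OF _ _ 1] Suc.prems(1) by auto
  hence "p = smult (int l) (pCons k q - q)" using p k by (simp add: smult_diff_right)
  thus ?case by blast
qed

text \<open>Linear independence of the first \<open>l - 1\<close> powers of \<zeta> by descent: zero
  is divisible by every power of \<pi>, so \<open>l_dvd_ipoly\<close> takes a factor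
  \<open>l\<close> out of \<open>p\<close>, and the quotient again vanishes at \<zeta>.\<close>

lemma ipoly_at_zeta_eq_0:
  assumes "ipoly_at p \<zeta> = 0" "degree p < l - 1"
  shows "p = 0"
proof -
  have l1: "l - 1 > 0" using l_gt_2 by simp
  have dec: "\<exists>q. p = smult (int l ^ n) q \<and> ipoly_at q \<zeta> = 0" for n
  proof (induction n)
    case 0
    show ?case using assms by simp
  next
    case (Suc n)
    then obtain q where q: "p = smult (int l ^ n) q" "ipoly_at q \<zeta> = 0" by blast
    have "degree q < l - 1" using assms(2) q(1) l0 by simp
    then obtain q' where q': "q = smult (int l) q'"
      using l_dvd_ipoly[of "l - 1" q] q(2) by auto
    have "ipoly_at q' \<zeta> = 0" using q(2) l0 unfolding q' ipoly_at_smult by simp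
    thus ?case using q q' by (intro exI[of _ q']) (simp add: mult.commute)
  qed
  have "coeff p i = 0" for i
  proof (rule ccontr)
    assume ne: "coeff p i \<noteq> 0"
    \<comment> \<open>A nonzero integer of absolute value \<open>n\<close> is not divisible by
      \<open>l ^ n\<close>, which is larger than \<open>n\<close>.\<close>
    define n where "n = nat \<bar>coeff p i\<bar>"
    obtain q where "p = smult (int l ^ n) q" using dec by blast
    hence "int l ^ n dvd coeff p i" by simp
    hence "int l ^ n \<le> int n" using ne zdvd_imp_le[of "int l ^ n" "\<bar>coeff p i\<bar>"] by (simp add: n_def)
    moreover have "n < l ^ n" using l_gt_2 by (intro power_gt_expt) simp
    ultimately show False by (simp flip: of_nat_power)
  qed
  thus ?thesis by (simp add: poly_eq_iff)
qed

text \<open>Subtracting \<open>r (l - 1)\<close> times the vanishing sum of all powers of \<zeta>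
  leaves a relation of degree below \<open>l - 1\<close>; after clearing denominators, independence
  applies.\<close>

lemma rational_relation:
  assumes r: "\<And>j. j < l \<Longrightarrow> r j \<in> \<rat>" and eq: "(\<Sum>j<l. r j * \<zeta> ^ j) = 0" and "j < l"
  shows "r j = r (l - 1)"
proof -
  obtain D where D: "D > 0" "\<forall>i\<in>{..<l}. of_nat D * (r i - r (l - 1)) \<in> \<int>"
    using common_denominator[of "{..<l}" "\<lambda>i. r i - r (l - 1)"] r l0 by auto
  have "\<forall>i. \<exists>c. i < l \<longrightarrow> of_nat D * (r i - r (l - 1)) = of_int c"
    using D(2) by (auto elim!: Ints_cases)
  then obtain c where c: "\<And>i. i < l \<Longrightarrow> of_nat D * (r i - r (l - 1)) = of_int (c i)" by metis
  have ls: "{..<l} = insert (l - 1) {..<l - 1}" using l0 by auto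
  have c0: "c (l - 1) = 0" using c[of "l - 1"] l0 by simp
  define p where "p = poly_of_fun (l - 1) c"
  have "ipoly_at p \<zeta> = (\<Sum>j<l. of_int (c j) * \<zeta> ^ j)"
    unfolding p_def ipoly_at_poly_of_fun ls using c0 by simp
  also have "\<dots> = (\<Sum>j<l. of_nat D * (r j - r (l - 1)) * \<zeta> ^ j)" by (intro sum.cong refl) (simp only: lessThan_iff c)
  also have "\<dots> = of_nat D * ((\<Sum>j<l. r j * \<zeta> ^ j) - r (l - 1) * (\<Sum>j<l. \<zeta> ^ j))"
    unfolding sum_distrib_left sum_subtractf[symmetric]
    by (intro sum.cong refl) (simp add: algebra_simps)
  also have "\<dots> = 0" using eq sum_powers_root[OF zeta_l] zeta_pow_ne_1[of 1] l_gt_2 by simp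
  finally have "p = 0" using l_gt_2 degree_poly_of_fun[of "l - 1" c]
    by (intro ipoly_at_zeta_eq_0) (auto simp: p_def)
  hence "c j = 0" if "j < l - 1" for j
    using coeff_poly_of_fun[of "l - 1" c j] that by (simp add: p_def)
  hence "c j = 0" using c0 \<open>j < l\<close> by (cases "j = l - 1") auto
  thus ?thesis using c[OF \<open>j < l\<close>] D(1) by simp
qed

end

subsection \<open>The cyclotomic field and its automorphisms\<close>

lemma complex_subfield_rat_adjoin: "complex_subfield (rat_adjoin S)"
proof
  show one: "1 \<in> rat_adjoin S"
    using generate_field.one[of complex_field S] by (simp add: rat_adjoin_def)
  show add: "x + y \<in> rat_adjoin S" if "x \<in> rat_adjoin S" "y \<in> rat_adjoin S" for x y
    using generate_field.eng_add[of x complex_field S y] that by (simp add: rat_adjoin_def)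
  show "x * y \<in> rat_adjoin S" if "x \<in> rat_adjoin S" "y \<in> rat_adjoin S" for x y
    using generate_field.eng_mult[of x complex_field S y] that by (simp add: rat_adjoin_def)
  show minus: "- x \<in> rat_adjoin S" if "x \<in> rat_adjoin S" for x
    using generate_field.a_inv[of x complex_field S] that by (simp add: rat_adjoin_def)
  show "inverse x \<in> rat_adjoin S" if "x \<in> rat_adjoin S" for x
  proof (cases "x = 0")
    case True
    thus ?thesis using add[OF one minus[OF one]] by simp
  next
    case False
    thus ?thesis using generate_field.m_inv[of x complex_field S] that
      by (simp add: rat_adjoin_def complex_field_m_inv)
  qed
qed

lemma rat_adjoin_base: "x \<in> S \<Longrightarrow> x \<in> rat_adjoin S"
  using generate_field.incl[of x S complex_field] by (simp add: rat_adjoin_def)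

lemma rat_adjoin_minimal:
  assumes "complex_subfield T" "S \<subseteq> T" shows "rat_adjoin S \<subseteq> T"
proof
  interpret complex_subfield T by fact
  fix x assume "x \<in> rat_adjoin S"
  thus "x \<in> T" unfolding rat_adjoin_def
    by (induction rule: generate_field.induct)
       (use assms(2) in \<open>auto simp: complex_field_m_inv intro: one_F uminus_F inverse_F add_F mult_F\<close>)
qed

text \<open>Rational polynomials are kept as complex ones, so that evaluation and composition stay
  within one type.\<close>

definition rat_poly :: "complex poly \<Rightarrow> bool" where
  "rat_poly p \<longleftrightarrow> (\<forall>i. coeff p i \<in> \<rat>)"

lemma rat_poly_intros:
  "rat_poly p \<Longrightarrow> rat_poly q \<Longrightarrow> rat_poly (p + q)"
  "rat_poly p \<Longrightarrow> rat_poly q \<Longrightarrow> rat_poly (p * q)"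
  "rat_poly p \<Longrightarrow> rat_poly (- p)"
  "rat_poly p \<Longrightarrow> rat_poly q \<Longrightarrow> rat_poly (p - q)"
  "c \<in> \<rat> \<Longrightarrow> rat_poly (monom c i)"
  "c \<in> \<rat> \<Longrightarrow> rat_poly [:c:]"
  "(\<And>j. j < m \<Longrightarrow> r j \<in> \<rat>) \<Longrightarrow> rat_poly (poly_of_fun m r)"
  by (auto simp: rat_poly_def coeff_mult coeff_poly_of_fun coeff_pCons intro!: Rats_sum Rats_mult
      split: nat.splits)

lemma rat_poly_pcompose: "rat_poly p \<Longrightarrow> rat_poly q \<Longrightarrow> rat_poly (pcompose p q)"
  unfolding rat_poly_def by (intro allI coeff_pcompose_semiring_closed) auto

context cyclotomic
begin

text \<open>Coefficients of the remainder of \<open>p\<close> modulo X^l - 1.\<close>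

definition red :: "complex poly \<Rightarrow> nat \<Rightarrow> complex" where
  "red p j = (\<Sum>i\<in>{i\<in>{..degree p}. i mod l = j}. coeff p i)"

lemma red_rat: "rat_poly p \<Longrightarrow> red p j \<in> \<rat>"
  by (auto simp: red_def rat_poly_def intro: Rats_sum)

lemma poly_red:
  assumes "z ^ l = 1" shows "poly p z = (\<Sum>j<l. red p j * z ^ j)"
proof -
  have "(\<Sum>j<l. red p j * z ^ j) = (\<Sum>j<l. \<Sum>i\<in>{i\<in>{..degree p}. i mod l = j}. coeff p i * z ^ i)"
    using power_mod_l[OF assms] by (auto simp: red_def sum_distrib_right intro!: sum.cong)
  also have "\<dots> = (\<Sum>i\<le>degree p. coeff p i * z ^ i)"
    by (rule sum.group) (use l0 in auto)
  finally show ?thesis by (simp add: poly_altdef)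
qed

text \<open>A rational relation for \<zeta> has all its reduced coefficients equal, so modulo X^l -
  1 it is a multiple of 1 + X + ... + X^(l-1), which also kills \<open>\<zeta> ^ a\<close>.\<close>

lemma conjugate_root:
  assumes "rat_poly p" "poly p \<zeta> = 0" "\<not> l dvd a"
  shows "poly p (\<zeta> ^ a) = 0"
proof -
  have const: "red p j = red p (l - 1)" if "j < l" for j
    by (rule rational_relation[OF red_rat[OF assms(1)] _ that]) (use assms(2) poly_red[OF zeta_l] in simp)
  have "poly p (\<zeta> ^ a) = (\<Sum>j<l. red p (l - 1) * (\<zeta> ^ a) ^ j)"
    unfolding poly_red[OF zeta_pow_l] by (intro sum.cong refl arg_cong2[of _ _ _ _ "(*)"] const) simp
  also have "\<dots> = 0" unfolding sum_distrib_left[symmetric] sum_zeta_pow using assms(3) by simp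
  finally show ?thesis .
qed

definition E :: "complex set" where "E = {poly p \<zeta> |p. rat_poly p}"

lemma E_cases [consumes 1]:
  assumes "x \<in> E" obtains p where "rat_poly p" "x = poly p \<zeta>"
  using assms by (auto simp: E_def)

lemma EI: "rat_poly p \<Longrightarrow> poly p \<zeta> \<in> E" by (auto simp: E_def)

text \<open>The automorphism of \<open>E\<close> sending \<zeta> to \<open>\<zeta> ^ a\<close>;
  \<open>sig_poly\<close> shows that the choice of the polynomial is immaterial. The value carries
  meaning only on \<open>E\<close> and for \<open>a\<close> prime to \<open>l\<close>.\<close>

definition sig :: "nat \<Rightarrow> complex \<Rightarrow> complex" where
  "sig a x = poly (SOME p. rat_poly p \<and> x = poly p \<zeta>) (\<zeta> ^ a)"

lemma sig_poly:
  assumes "rat_poly p" "\<not> l dvd a" shows "sig a (poly p \<zeta>) = poly p (\<zeta> ^ a)"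
proof -
  define q where "q = (SOME q. rat_poly q \<and> poly p \<zeta> = poly q \<zeta>)"
  have q: "rat_poly q \<and> poly p \<zeta> = poly q \<zeta>" unfolding q_def by (rule someI) (use assms in auto)
  have "poly (q - p) (\<zeta> ^ a) = 0"
    using q assms by (intro conjugate_root rat_poly_intros) auto
  thus ?thesis by (simp add: sig_def flip: q_def)
qed

lemma sig_cong: "[a = b] (mod l) \<Longrightarrow> sig a = sig b"
  unfolding sig_def by (auto dest: zeta_pow_cong)

lemma E_add: "x \<in> E \<Longrightarrow> y \<in> E \<Longrightarrow> x + y \<in> E"
  and E_mult: "x \<in> E \<Longrightarrow> y \<in> E \<Longrightarrow> x * y \<in> E"
  and E_uminus: "x \<in> E \<Longrightarrow> - x \<in> E"
  by (auto elim!: E_cases simp flip: poly_add poly_mult poly_minus intro!: EI intro: rat_poly_intros)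

lemma E_rat: "c \<in> \<rat> \<Longrightarrow> c \<in> E"
  using EI[of "[:c:]"] by (simp add: rat_poly_intros)

lemma E_zeta_pow: "\<zeta> ^ j \<in> E"
  using EI[of "monom 1 j"] by (simp add: rat_poly_intros poly_monom)

lemma E_sum: "(\<And>i. i \<in> I \<Longrightarrow> f i \<in> E) \<Longrightarrow> sum f I \<in> E"
  by (induction I rule: infinite_finite_induct) (auto intro: E_add E_rat)

lemma E_prod: "(\<And>i. i \<in> I \<Longrightarrow> f i \<in> E) \<Longrightarrow> prod f I \<in> E"
  by (induction I rule: infinite_finite_induct) (auto intro: E_mult E_rat)

context
  fixes a assumes a: "\<not> l dvd a"
begin

lemma sig_E: "x \<in> E \<Longrightarrow> sig a x \<in> E"
proof (elim E_cases)
  fix p assume p: "rat_poly p" "x = poly p \<zeta>"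
  have "poly (pcompose p (monom 1 a)) \<zeta> \<in> E"
    using p by (intro EI rat_poly_pcompose rat_poly_intros) auto
  thus "sig a x \<in> E" using p a by (simp add: sig_poly poly_pcompose poly_monom)
qed

lemma sig_add: "x \<in> E \<Longrightarrow> y \<in> E \<Longrightarrow> sig a (x + y) = sig a x + sig a y"
  and sig_mult: "x \<in> E \<Longrightarrow> y \<in> E \<Longrightarrow> sig a (x * y) = sig a x * sig a y"
  by (auto elim!: E_cases simp flip: poly_add poly_mult simp: sig_poly a rat_poly_intros)

lemma sig_rat: "c \<in> \<rat> \<Longrightarrow> sig a c = c"
  using sig_poly[of "[:c:]" a] a by (simp add: rat_poly_intros)

lemma sig_0 [simp]: "sig a 0 = 0" and sig_1 [simp]: "sig a 1 = 1"
  using sig_rat by auto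

lemma sig_uminus: "x \<in> E \<Longrightarrow> sig a (- x) = - sig a x"
  using sig_add[of x "- x"] E_uminus[of x] by (simp add: eq_neg_iff_add_eq_0 add.commute)

lemma sig_diff: "x \<in> E \<Longrightarrow> y \<in> E \<Longrightarrow> sig a (x - y) = sig a x - sig a y"
  using sig_add[of x "- y"] E_uminus[of y] sig_uminus[of y] by simp

lemma sig_zeta_pow: "sig a (\<zeta> ^ j) = \<zeta> ^ (a * j)"
  using sig_poly[of "monom 1 j" a] a by (simp add: rat_poly_intros poly_monom power_mult)

lemma sig_sum: "(\<And>i. i \<in> I \<Longrightarrow> f i \<in> E) \<Longrightarrow> sig a (sum f I) = (\<Sum>i\<in>I. sig a (f i))"
  by (induction I rule: infinite_finite_induct) (auto simp: sig_add E_sum)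

lemma sig_prod: "(\<And>i. i \<in> I \<Longrightarrow> f i \<in> E) \<Longrightarrow> sig a (prod f I) = (\<Prod>i\<in>I. sig a (f i))"
  by (induction I rule: infinite_finite_induct) (auto simp: sig_mult E_prod)

text \<open>A monic integral polynomial killing \<open>x\<close>, composed with a rational
  polynomial representing \<open>x\<close>, vanishes at \<zeta> and hence at
  \<open>\<zeta> ^ a\<close>.\<close>

lemma sig_int:
  assumes x: "x \<in> E" "algebraic_int x" shows "algebraic_int (sig a x)"
proof -
  obtain q where q: "lead_coeff q = 1" "\<forall>i. coeff q i \<in> \<int>" "poly q x = 0"
    using x(2) by (auto elim: algebraic_int.cases)
  obtain p where p: "rat_poly p" "x = poly p \<zeta>" using x(1) by (rule E_cases)
  have "rat_poly q" using q(2) Ints_subset_Rats by (auto simp: rat_poly_def)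
  hence "poly (pcompose q p) (\<zeta> ^ a) = 0"
    using p q(3) a by (intro conjugate_root rat_poly_pcompose) (auto simp: poly_pcompose)
  hence "poly q (sig a x) = 0" using p a by (simp add: sig_poly poly_pcompose)
  thus ?thesis using q by (auto intro: algebraic_int.intros)
qed

end

lemma sig_sig:
  assumes "\<not> l dvd a" "\<not> l dvd b" "x \<in> E" shows "sig a (sig b x) = sig (a * b) x"
proof -
  obtain p where p: "rat_poly p" "x = poly p \<zeta>" using assms(3) by (rule E_cases)
  have ab: "\<not> l dvd a * b" using assms prime_l prime_dvd_mult_nat by blast
  have "sig b x = poly (pcompose p (monom 1 b)) \<zeta>"
    using p assms by (simp add: sig_poly poly_pcompose poly_monom)
  also have "sig a \<dots> = poly (pcompose p (monom 1 b)) (\<zeta> ^ a)"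
    using p assms by (intro sig_poly rat_poly_pcompose rat_poly_intros) auto
  also have "\<dots> = sig (a * b) x"
    using p ab by (simp add: sig_poly poly_pcompose poly_monom power_mult)
  finally show ?thesis .
qed

lemma sig_id: "x \<in> E \<Longrightarrow> sig 1 x = x"
  using l_gt_2 by (auto elim!: E_cases simp: sig_poly)

lemma sig_one: "[a = 1] (mod l) \<Longrightarrow> x \<in> E \<Longrightarrow> sig a x = x"
  using sig_cong[of a 1] sig_id by simp

lemma inverse_mod:
  assumes "\<not> l dvd a" obtains b where "\<not> l dvd b" "[a * b = 1] (mod l)"
proof -
  have "coprime a l" using assms prime_l prime_imp_coprime_nat coprime_commute by blast
  then obtain b where b: "[a * b = 1] (mod l)" using cong_solve_coprime_nat by auto
  have "\<not> l dvd b"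
  proof
    assume "l dvd b"
    hence "(a * b) mod l = 0" by (simp add: dvd_eq_mod_eq_0[symmetric])
    thus False using b l_gt_2 by (simp add: cong_def)
  qed
  thus ?thesis using b that by blast
qed

lemma not_dvd_unit: "a \<in> {1..<l} \<Longrightarrow> \<not> l dvd a"
  by (auto dest: dvd_imp_le)

lemma bij_mult_mod:
  assumes b: "\<not> l dvd b" shows "bij_betw (\<lambda>a. (a * b) mod l) {1..<l} {1..<l}"
proof (rule bij_betw_imageI)
  show inj: "inj_on (\<lambda>a. (a * b) mod l) {1..<l}"
  proof (rule inj_onI)
    fix x y assume xy: "x \<in> {1..<l}" "y \<in> {1..<l}" "(x * b) mod l = (y * b) mod l"
    have "coprime b l" using b prime_l prime_imp_coprime_nat coprime_commute by blast
    hence "[x = y] (mod l)" using xy(3) by (simp add: cong_def[symmetric] cong_mult_rcancel_nat)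
    thus "x = y" using xy by (simp add: cong_def)
  qed
  have "(\<lambda>a. (a * b) mod l) ` {1..<l} \<subseteq> {1..<l}"
  proof clarify
    fix a assume "a \<in> {1..<l}"
    hence "\<not> l dvd a * b" using b not_dvd_unit prime_l prime_dvd_mult_nat by blast
    thus "(a * b) mod l \<in> {1..<l}" using l0 by (auto simp: dvd_eq_mod_eq_0)
  qed
  thus "(\<lambda>a. (a * b) mod l) ` {1..<l} = {1..<l}"
    by (rule card_subset_eq[OF finite_atLeastLessThan _ card_image[OF inj]])
qed

lemma sig_mod: "sig (a mod l) = sig a"
  by (rule sig_cong) (simp add: cong_def)

lemma E_repr:
  assumes "x \<in> E" obtains r where "\<And>j. r j \<in> \<rat>" "x = (\<Sum>j<l. r j * \<zeta> ^ j)"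
  using assms red_rat poly_red[OF zeta_l] by (elim E_cases) metis

lemma sig_repr:
  "\<not> l dvd a \<Longrightarrow> (\<And>j. j < l \<Longrightarrow> r j \<in> \<rat>) \<Longrightarrow> sig a (\<Sum>j<l. r j * \<zeta> ^ j) = (\<Sum>j<l. r j * \<zeta> ^ (a * j))"
  by (subst sig_sum) (auto simp: sig_mult sig_rat sig_zeta_pow E_rat E_zeta_pow intro!: E_mult)

lemma sum_zeta_units:
  "(\<Sum>a\<in>{1..<l}. \<zeta> ^ (a * j)) = (if l dvd j then of_nat l else 0) - 1"
proof -
  have "{..<l} = insert 0 {1..<l}" using l0 by auto
  hence "(\<Sum>a<l. (\<zeta> ^ j) ^ a) = 1 + (\<Sum>a\<in>{1..<l}. (\<zeta> ^ j) ^ a)" by simp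
  moreover have "(\<zeta> ^ j) ^ a = \<zeta> ^ (a * j)" for a by (simp add: mult.commute flip: power_mult)
  ultimately show ?thesis using sum_zeta_pow[of j] by (simp add: algebra_simps)
qed

text \<open>The trace of \<open>\<zeta> ^ j\<close> is \<open>l - 1\<close> for \<open>j = 0\<close>
  and -1 for the other \<open>j < l\<close>.\<close>

lemma trace_repr:
  assumes "\<And>j. j < l \<Longrightarrow> r j \<in> \<rat>"
  shows "(\<Sum>a\<in>{1..<l}. sig a (\<Sum>j<l. r j * \<zeta> ^ j)) = of_nat l * r 0 - (\<Sum>j<l. r j)"
proof -
  have "(\<Sum>a\<in>{1..<l}. sig a (\<Sum>j<l. r j * \<zeta> ^ j)) = (\<Sum>a\<in>{1..<l}. \<Sum>j<l. r j * \<zeta> ^ (a * j))"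
    using assms not_dvd_unit by (intro sum.cong refl sig_repr) auto
  also have "\<dots> = (\<Sum>j<l. r j * (\<Sum>a\<in>{1..<l}. \<zeta> ^ (a * j)))"
    by (subst sum.swap) (simp add: sum_distrib_left)
  also have "\<dots> = (\<Sum>j<l. (if j = 0 then of_nat l * r 0 else 0) - r j)"
    unfolding sum_zeta_units by (intro sum.cong) (auto simp: algebra_simps dest: dvd_imp_le)
  also have "\<dots> = of_nat l * r 0 - (\<Sum>j<l. r j)"
    using l0 by (simp add: sum_subtractf sum.delta)
  finally show ?thesis .
qed

lemma trace_rat:
  assumes "x \<in> E" shows "(\<Sum>a\<in>{1..<l}. sig a x) \<in> \<rat>"
proof -
  obtain r where r: "\<And>j. r j \<in> \<rat>" "x = (\<Sum>j<l. r j * \<zeta> ^ j)" using E_repr[OF assms] by blast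
  show ?thesis unfolding r(2) by (subst trace_repr) (auto simp: r intro!: Rats_diff Rats_mult Rats_sum)
qed

text \<open>The trace of \<open>x\<close> is rational and here equals
  \<open>(l - 1) * x\<close>.\<close>

lemma fixed_rat:
  assumes "x \<in> E" "\<And>a. a \<in> {1..<l} \<Longrightarrow> sig a x = x" shows "x \<in> \<rat>"
proof -
  have "(\<Sum>a\<in>{1..<l}. sig a x) = (\<Sum>a\<in>{1..<l}. x)" using assms(2) by (intro sum.cong) auto
  hence "of_nat (l - 1) * x \<in> \<rat>" using trace_rat[OF assms(1)] by simp
  hence "of_nat (l - 1) * x / of_nat (l - 1) \<in> \<rat>" by (intro Rats_divide) auto
  thus ?thesis using l_gt_2 by simp
qed

definition nrm :: "complex \<Rightarrow> complex" where "nrm x = (\<Prod>a\<in>{1..<l}. sig a x)"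

lemma sig_perm_prod:
  assumes "x \<in> E" "\<not> l dvd b"
  shows "(\<Prod>a\<in>{1..<l}. sig b (sig a x)) = (\<Prod>a\<in>{1..<l}. sig a x)"
proof -
  have "(\<Prod>a\<in>{1..<l}. sig b (sig a x)) = (\<Prod>a\<in>{1..<l}. sig ((a * b) mod l) x)"
    using assms not_dvd_unit by (intro prod.cong) (auto simp: sig_sig sig_mod mult.commute)
  also have "\<dots> = (\<Prod>a\<in>{1..<l}. sig a x)" by (rule prod.reindex_bij_betw[OF bij_mult_mod[OF assms(2)]])
  finally show ?thesis .
qed

lemma nrm_rat: assumes "x \<in> E" shows "nrm x \<in> \<rat>"
proof (rule fixed_rat)
  show "nrm x \<in> E" unfolding nrm_def using assms not_dvd_unit by (intro E_prod sig_E) auto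
  fix b assume b: "b \<in> {1..<l}"
  have "sig b (nrm x) = (\<Prod>a\<in>{1..<l}. sig b (sig a x))"
    unfolding nrm_def using assms b not_dvd_unit by (intro sig_prod sig_E) auto
  thus "sig b (nrm x) = nrm x" using sig_perm_prod[OF assms not_dvd_unit[OF b]] by (simp add: nrm_def)
qed

lemma sig_nonzero:
  assumes "x \<in> E" "x \<noteq> 0" "\<not> l dvd a" shows "sig a x \<noteq> 0"
proof
  assume 0: "sig a x = 0"
  obtain b where b: "\<not> l dvd b" "[a * b = 1] (mod l)" using inverse_mod[OF assms(3)] by blast
  have "x = sig (b * a) x" using sig_one[of "b * a" x] b assms by (simp add: mult.commute)
  also have "\<dots> = sig b (sig a x)" using b assms by (simp add: sig_sig)
  also have "\<dots> = 0" using 0 b by simp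
  finally show False using assms by simp
qed

lemma nrm_nonzero: "x \<in> E \<Longrightarrow> x \<noteq> 0 \<Longrightarrow> nrm x \<noteq> 0"
  unfolding nrm_def using sig_nonzero not_dvd_unit by auto

text \<open>The inverse of \<open>x\<close> is the product of its other conjugates divided by its
  rational norm.\<close>

lemma complex_subfield_E: "complex_subfield E"
proof
  show "inverse x \<in> E" if x: "x \<in> E" for x
  proof (cases "x = 0")
    case False
    define y where "y = (\<Prod>a\<in>{2..<l}. sig a x)"
    have "{1..<l} = insert 1 {2..<l}" using l_gt_2 by auto
    hence "nrm x = x * y" using x by (simp add: nrm_def y_def sig_id[simplified])
    hence "inverse x = y * inverse (nrm x)" using False nrm_nonzero[OF x False] by (simp add: field_simps)
    moreover have "y \<in> E" unfolding y_def using x by (intro E_prod sig_E not_dvd_unit) auto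
    ultimately show ?thesis using nrm_rat[OF x] by (metis E_mult E_rat Rats_inverse)
  qed (auto intro: E_rat)
qed (auto intro: E_add E_mult E_uminus E_rat)

lemma rat_adjoin_zeta: "rat_adjoin {\<zeta>} = E"
proof
  show "rat_adjoin {\<zeta>} \<subseteq> E"
    using E_zeta_pow[of 1] by (intro rat_adjoin_minimal complex_subfield_E) auto
  interpret complex_subfield "rat_adjoin {\<zeta>}" by (rule complex_subfield_rat_adjoin)
  show "E \<subseteq> rat_adjoin {\<zeta>}"
  proof
    fix x assume "x \<in> E"
    then obtain r where r: "\<And>j. r j \<in> \<rat>" "x = (\<Sum>j<l. r j * \<zeta> ^ j)" using E_repr by blast
    have "r j \<in> rat_adjoin {\<zeta>}" for j using r(1)[of j] of_rat_F by (auto elim!: Rats_cases)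
    thus "x \<in> rat_adjoin {\<zeta>}" unfolding r(2)
      by (intro sum_F mult_F power_F rat_adjoin_base[of \<zeta>]) auto
  qed
qed

text \<open>The integers of \<open>E\<close> are \<int>[\<zeta>]. The traces of the
  \<open>x * \<zeta> ^ (l - k)\<close> are integral, so \<open>l * x\<close> is an integer
  polynomial in \<zeta> of degree below \<open>l - 1\<close>; its value is divisible by
  \<open>\<pi> ^ (l - 1)\<close> because \<open>l\<close> is, and \<open>l_dvd_ipoly\<close> cancels
  \<open>l\<close>.\<close>

lemma integers_E:
  assumes x: "x \<in> E" "algebraic_int x"
  shows "\<exists>c :: nat \<Rightarrow> int. x = (\<Sum>j<l - 1. of_int (c j) * \<zeta> ^ j)"
proof -
  obtain r where r: "\<And>j. r j \<in> \<rat>" "x = (\<Sum>j<l. r j * \<zeta> ^ j)" using E_repr[OF x(1)] by blast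
  have tr: "algebraic_int (of_nat l * r k - (\<Sum>j<l. r j))" if k: "k < l" for k
  proof -
    \<comment> \<open>Multiplication by \<open>\<zeta> ^ (l - k)\<close> rotates the coefficients by
      \<open>k\<close>, so that \<open>trace_repr\<close> picks out \<open>r k\<close>.\<close>
    define s where "s = (\<lambda>j. r ((j + k) mod l))"
    have bij: "bij_betw (\<lambda>j. (j + k) mod l) {..<l} {..<l}"
    proof (rule bij_betw_imageI)
      show inj: "inj_on (\<lambda>j. (j + k) mod l) {..<l}"
      proof (rule inj_onI)
        fix x y assume xy: "x \<in> {..<l}" "y \<in> {..<l}" "(x + k) mod l = (y + k) mod l"
        hence "[x + k = y + k] (mod l)" by (simp add: cong_def)
        hence "[x = y] (mod l)" by (simp only: cong_add_rcancel_nat)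
        thus "x = y" using xy by (simp add: cong_def)
      qed
      show "(\<lambda>j. (j + k) mod l) ` {..<l} = {..<l}"
        using l0 by (intro card_subset_eq) (auto simp: card_image[OF inj])
    qed
    have "x * \<zeta> ^ (l - k) = (\<Sum>j<l. r ((j + k) mod l) * \<zeta> ^ ((j + k) mod l)) * \<zeta> ^ (l - k)"
      unfolding r(2) using sum.reindex_bij_betw[OF bij, of "\<lambda>j. r j * \<zeta> ^ j"] by simp
    also have "\<dots> = (\<Sum>j<l. s j * \<zeta> ^ j)"
      unfolding sum_distrib_right
    proof (intro sum.cong refl)
      fix j
      have "\<zeta> ^ ((j + k) mod l) * \<zeta> ^ (l - k) = \<zeta> ^ (j + k + (l - k))"
        unfolding power_mod_l[OF zeta_l] by (simp only: power_add)
      also have "j + k + (l - k) = j + l" using k by simp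
      also have "\<zeta> ^ (j + l) = \<zeta> ^ j" by (simp add: power_add zeta_l)
      finally show "r ((j + k) mod l) * \<zeta> ^ ((j + k) mod l) * \<zeta> ^ (l - k) = s j * \<zeta> ^ j"
        by (simp add: s_def mult.assoc)
    qed
    finally have eq: "x * \<zeta> ^ (l - k) = (\<Sum>j<l. s j * \<zeta> ^ j)" .
    have "algebraic_int (\<Sum>a\<in>{1..<l}. sig a (x * \<zeta> ^ (l - k)))"
      using x not_dvd_unit
      by (intro algebraic_int_sum sig_int E_mult E_zeta_pow algebraic_int_mult alg_zeta_pow) auto
    also have "(\<Sum>a\<in>{1..<l}. sig a (x * \<zeta> ^ (l - k))) = of_nat l * s 0 - (\<Sum>j<l. s j)"
      unfolding eq by (rule trace_repr) (simp add: s_def r)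
    also have "(\<Sum>j<l. s j) = (\<Sum>j<l. r j)" unfolding s_def by (rule sum.reindex_bij_betw[OF bij])
    finally show ?thesis using k by (simp add: s_def)
  qed
  \<comment> \<open>Differences remove the common sum of all \<open>r j\<close> and make the
    coefficient of index \<open>l - 1\<close> vanish.\<close>
  have "\<exists>e. k < l \<longrightarrow> of_nat l * (r k - r (l - 1)) = of_int e" for k
  proof (cases "k < l")
    case True
    have "algebraic_int ((of_nat l * r k - (\<Sum>j<l. r j)) - (of_nat l * r (l - 1) - (\<Sum>j<l. r j)))"
      using True l0 by (intro algebraic_int_diff tr) auto
    hence "algebraic_int (of_nat l * (r k - r (l - 1)))" by (simp add: algebra_simps)
    hence "of_nat l * (r k - r (l - 1)) \<in> \<int>"
      by (rule rational_algebraic_int_is_int) (auto simp: r intro!: Rats_mult Rats_diff)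
    thus ?thesis by (auto elim: Ints_cases)
  qed auto
  then obtain e where e: "\<And>k. k < l \<Longrightarrow> of_nat l * (r k - r (l - 1)) = of_int (e k)" by metis
  define p where "p = poly_of_fun (l - 1) e"
  have ls: "{..<l} = insert (l - 1) {..<l - 1}" using l0 by auto
  have e0: "e (l - 1) = 0" using e[of "l - 1"] l0 by simp
  have "of_nat l * x = of_nat l * ((\<Sum>j<l. r j * \<zeta> ^ j) - r (l - 1) * (\<Sum>j<l. \<zeta> ^ j))"
    using sum_powers_root[OF zeta_l] zeta_pow_ne_1[of 1] l_gt_2 by (simp add: r(2))
  also have "\<dots> = (\<Sum>j<l. of_nat l * (r j - r (l - 1)) * \<zeta> ^ j)"
    unfolding sum_distrib_left sum_subtractf[symmetric]
    by (intro sum.cong refl) (simp add: algebra_simps)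
  also have "\<dots> = (\<Sum>j<l. of_int (e j) * \<zeta> ^ j)" by (intro sum.cong refl) (simp only: lessThan_iff e)
  also have "\<dots> = ipoly_at p \<zeta>" unfolding p_def ipoly_at_poly_of_fun ls using e0 by simp
  finally have lx: "of_nat l * x = ipoly_at p \<zeta>" .
  have "ipoly_at p \<zeta> / \<pi> ^ (l - 1) = (of_nat l / \<pi> ^ (l - 1)) * x" by (simp flip: lx)
  also have "algebraic_int \<dots>" by (intro algebraic_int_mult x l_div_pi_pow) simp
  finally obtain q where q: "p = smult (int l) q"
    using l_dvd_ipoly[of "l - 1" p] degree_poly_of_fun[of "l - 1" e] l_gt_2 by (auto simp: p_def)
  have "degree p < l - 1" unfolding p_def using l_gt_2 by (intro degree_poly_of_fun) simp
  hence "degree q < l - 1" using q l0 by simp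
  hence "q = poly_of_fun (l - 1) (coeff q)"
    by (auto simp: poly_eq_iff coeff_poly_of_fun intro: coeff_eq_0)
  hence "ipoly_at q \<zeta> = (\<Sum>j<l - 1. of_int (coeff q j) * \<zeta> ^ j)"
    by (metis ipoly_at_poly_of_fun)
  moreover have "x = ipoly_at q \<zeta>" using lx l0 unfolding q ipoly_at_smult by simp
  ultimately show ?thesis by blast
qed

text \<open>Every subfield of \<open>E\<close> inherits the automorphisms and the norm of
  \<open>E\<close>. The spanning family is indexed, possibly with repetitions, so coefficients are
  added up over equal values.\<close>

lemma number_fieldI:
  assumes "complex_subfield F" "F \<subseteq> E" "finite I" "b ` I \<subseteq> integers_of F"
    and span: "\<And>x. x \<in> F \<Longrightarrow> \<exists>r. x = (\<Sum>i\<in>I. of_rat (r i) * b i)"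
  shows "number_field F (b ` I) (sig ` {1..<l})"
proof -
  interpret complex_subfield F by fact
  have inj: "inj_on sig {1..<l}"
  proof (rule inj_onI)
    fix a c assume ac: "a \<in> {1..<l}" "c \<in> {1..<l}" "sig a = sig c"
    hence "\<zeta> ^ a = \<zeta> ^ c"
      using sig_zeta_pow[OF not_dvd_unit, of a 1] sig_zeta_pow[OF not_dvd_unit, of c 1] by simp
    thus "a = c" using ac by (simp add: zeta_pow_eq_iff cong_def)
  qed
  show ?thesis
  proof
    show "\<exists>r. x = (\<Sum>y\<in>b ` I. of_rat (r y) * y)" if x: "x \<in> F" for x
    proof -
      obtain r where r: "x = (\<Sum>i\<in>I. of_rat (r i) * b i)" using span[OF x] by blast
      have "x = (\<Sum>y\<in>b ` I. \<Sum>i\<in>{i \<in> I. b i = y}. of_rat (r i) * b i)"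
        unfolding r by (rule sum.image_gen) fact
      also have "\<dots> = (\<Sum>y\<in>b ` I. of_rat (\<Sum>i\<in>{i \<in> I. b i = y}. r i) * y)"
        by (intro sum.cong refl) (auto simp: of_rat_sum sum_distrib_right intro!: sum.cong)
      finally show ?thesis by (intro exI[of _ "\<lambda>y. \<Sum>i\<in>{i \<in> I. b i = y}. r i"])
    qed
    show "(\<Prod>\<sigma>\<in>sig ` {1..<l}. \<sigma> x) \<in> \<rat>" if "x \<in> F" for x
    proof -
      have "(\<Prod>\<sigma>\<in>sig ` {1..<l}. \<sigma> x) = nrm x" unfolding nrm_def by (subst prod.reindex[OF inj]) simp
      moreover have "x \<in> E" using that assms(2) by blast
      ultimately show ?thesis using nrm_rat by simp
    qed
    fix D :: nat assume D: "D > 0"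
    \<comment> \<open>Residues modulo \<open>D\<close> are read off from coordinates in
      \<int>[\<zeta>], also when \<open>F\<close> is smaller than \<open>E\<close>.\<close>
    define c where "c = (\<lambda>x. SOME c :: nat \<Rightarrow> int. x = (\<Sum>j<l - 1. of_int (c j) * \<zeta> ^ j))"
    have c: "x = (\<Sum>j<l - 1. of_int (c x j) * \<zeta> ^ j)" if "x \<in> \<O>" for x
    proof -
      have "x \<in> E" "algebraic_int x" using that assms(2) by (auto simp: integers_of_def)
      thus ?thesis unfolding c_def by (rule someI_ex[OF integers_E])
    qed
    define f where "f = (\<lambda>x. restrict (\<lambda>j. nat (c x j mod int D)) {..<l - 1})"
    have "f ` \<O> \<subseteq> ({..<l - 1} \<rightarrow>\<^sub>E {..<D})"
      unfolding f_def image_subset_iff restrict_PiE_iff using D by (simp add: nat_less_iff)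
    hence "finite (f ` \<O>)" by (rule finite_subset) (auto intro: finite_PiE)
    moreover have "algebraic_int ((x - y) / of_nat D)" if xy: "x \<in> \<O>" "y \<in> \<O>" "f x = f y" for x y
    proof -
      have "\<exists>k. j < l - 1 \<longrightarrow> c x j - c y j = int D * k" for j
      proof (cases "j < l - 1")
        case True
        have "nat (c x j mod int D) = nat (c y j mod int D)"
          using fun_cong[OF xy(3), of j] True by (simp add: f_def)
        hence "c x j mod int D = c y j mod int D" using D by (simp add: eq_nat_nat_iff)
        hence "int D dvd c x j - c y j" by (rule mod_eq_dvd_iff[THEN iffD1])
        thus ?thesis by (auto simp: dvd_def)
      qed auto
      then obtain k where k: "\<And>j. j < l - 1 \<Longrightarrow> c x j - c y j = int D * k j" by metis
      have "x - y = (\<Sum>j<l - 1. of_int (c x j - c y j) * \<zeta> ^ j)"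
        by (subst c[OF xy(1)], subst c[OF xy(2)])
           (simp add: left_diff_distrib sum_subtractf)
      also have "\<dots> = of_nat D * (\<Sum>j<l - 1. of_int (k j) * \<zeta> ^ j)"
        by (simp add: k sum_distrib_left mult.assoc)
      finally have "(x - y) / of_nat D = (\<Sum>j<l - 1. of_int (k j) * \<zeta> ^ j)" using D by simp
      thus ?thesis by (simp add: algebraic_int_sum algebraic_int_mult alg_zeta_pow)
    qed
    ultimately show "\<exists>f :: complex \<Rightarrow> nat \<Rightarrow> nat. finite (f ` \<O>) \<and>
          (\<forall>x\<in>\<O>. \<forall>y\<in>\<O>. f x = f y \<longrightarrow> algebraic_int ((x - y) / of_nat D))" by blast
  next
    show "sig ` {1..<l} \<noteq> {}" using l_gt_2 by auto
    fix \<sigma> assume \<sigma>: "\<sigma> \<in> sig ` {1..<l}"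
    then obtain a where a: "\<sigma> = sig a" "\<not> l dvd a" using not_dvd_unit by auto
    show "\<sigma> (of_rat r) = of_rat r" for r using a by (simp add: sig_rat)
    show "\<sigma> (x + y) = \<sigma> x + \<sigma> y" "\<sigma> (x * y) = \<sigma> x * \<sigma> y" if "x \<in> F" "y \<in> F" for x y
    proof -
      have "x \<in> E" "y \<in> E" using that assms(2) by auto
      thus "\<sigma> (x + y) = \<sigma> x + \<sigma> y" "\<sigma> (x * y) = \<sigma> x * \<sigma> y"
        using a by (simp_all add: sig_add sig_mult)
    qed
    show "algebraic_int (\<sigma> x)" if "x \<in> \<O>" for x
    proof -
      have "x \<in> E" "algebraic_int x" using that assms(2) by (auto simp: integers_of_def)
      thus ?thesis using a by (simp add: sig_int)
    qed
  qed (use assms in auto)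
qed

end

subsection \<open>Quadratic residues and the Gauss sum\<close>

lemma cong_nat_1: "[(x::nat) = 1] (mod n) \<longleftrightarrow> [int x = 1] (mod int n)"
  by (metis cong_int_iff of_nat_1)

locale cyclotomic_5_mod_8 = cyclotomic +
  assumes l_mod_8: "[l = 5] (mod 8)"
begin

definition h :: nat where "h = (l - 1) div 2"
definition n :: nat where "n = (l - 1) div 4"

lemma h_eq: "h = 2 * n" and l_eq: "l = 2 * h + 1" and odd_n: "odd n"
proof -
  have "l mod 8 = 5" using l_mod_8 by (simp add: cong_def)
  hence "l = 8 * (l div 8) + 5" by (metis mult_div_mod_eq)
  then obtain k where k: "l = 8 * k + 5" by blast
  show "h = 2 * n" "l = 2 * h + 1" "odd n" unfolding h_def n_def using k by presburger+
qed

text \<open>The Legendre symbol by Euler's criterion. Multiples of \<open>l\<close> receive -1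
  rather than 0, so \<open>chi a = 1\<close> already forces \<open>a\<close> to be prime to
  \<open>l\<close>.\<close>

definition chi :: "nat \<Rightarrow> int" where
  "chi a = (if [int a ^ h = 1] (mod int l) then 1 else -1)"

lemma chi_pm1: "chi a = 1 \<or> chi a = -1" by (simp add: chi_def)

lemma chi_square [simp]: "chi a * chi a = 1" by (simp add: chi_def)

lemma pm1_cong_imp_eq:
  assumes "c = 1 \<or> c = -1" "d = 1 \<or> d = -1" "[c = d] (mod int l)" shows "c = (d::int)"
proof (rule ccontr)
  assume "c \<noteq> d"
  hence "int l dvd 2" using assms by (auto simp: cong_iff_dvd_diff)
  hence "int l \<le> 2" by (rule zdvd_imp_le) simp
  thus False using l_gt_2 by simp
qed

text \<open>By Fermat, \<open>a ^ h\<close> is a square root of 1 modulo a prime.\<close>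

lemma chi_cong:
  assumes "\<not> l dvd a" shows "[int a ^ h = chi a] (mod int l)"
proof -
  have "[a ^ (l - 1) = 1] (mod l)" by (rule fermat_theorem[OF prime_l assms])
  hence "[int a ^ (l - 1) = 1] (mod int l)" by (metis cong_nat_1 of_nat_power)
  moreover have "l - 1 = h + h" using l_eq by simp
  hence "int a ^ (l - 1) = int a ^ h * int a ^ h" by (simp only: power_add)
  ultimately have "int l dvd int a ^ h * int a ^ h - 1" by (simp add: cong_iff_dvd_diff)
  also have "int a ^ h * int a ^ h - 1 = (int a ^ h - 1) * (int a ^ h + 1)" by (simp add: algebra_simps)
  finally have "int l dvd int a ^ h - 1 \<or> int l dvd int a ^ h + 1"
    using prime_l by (simp add: prime_dvd_mult_iff)
  thus ?thesis by (auto simp: chi_def cong_iff_dvd_diff)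
qed

lemma chi_eqI:
  assumes "\<not> l dvd a" "c = 1 \<or> c = -1" "[int a ^ h = c] (mod int l)" shows "chi a = c"
  using pm1_cong_imp_eq[OF chi_pm1 assms(2)] chi_cong[OF assms(1)] assms(3)
  by (metis cong_sym cong_trans)

lemma not_dvd_mult: "\<not> l dvd a \<Longrightarrow> \<not> l dvd b \<Longrightarrow> \<not> l dvd a * b"
  using prime_l prime_dvd_mult_nat by blast

lemma chi_mult:
  assumes "\<not> l dvd a" "\<not> l dvd b" shows "chi (a * b) = chi a * chi b"
proof (rule chi_eqI[OF not_dvd_mult[OF assms]])
  show "chi a * chi b = 1 \<or> chi a * chi b = - 1" using chi_pm1[of a] chi_pm1[of b] by auto
  show "[int (a * b) ^ h = chi a * chi b] (mod int l)"
    unfolding of_nat_mult power_mult_distrib by (intro cong_mult chi_cong assms)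
qed

lemma chi_congr: "[a = b] (mod l) \<Longrightarrow> chi a = chi b"
proof -
  assume "[a = b] (mod l)"
  hence "[int a ^ h = int b ^ h] (mod int l)" by (intro cong_pow) (simp add: cong_int_iff)
  thus ?thesis unfolding chi_def by (metis cong_sym cong_trans)
qed

lemma chi_mod [simp]: "chi (a mod l) = chi a" by (rule chi_congr) (simp add: cong_def)

lemma chi_1 [simp]: "chi 1 = 1" "chi (Suc 0) = 1" by (simp_all add: chi_def)

text \<open>The exponent \<open>h = 2 * n\<close> is even; this is what places \<open>K\<close>
  inside the real subfield.\<close>

lemma chi_minus_1: "chi (l - 1) = 1"
proof (rule chi_eqI)
  show "\<not> l dvd l - 1" using l_gt_2 by (intro not_dvd_unit) auto
  have "[int (l - 1) = - 1] (mod int l)" using l0 by (simp add: cong_iff_dvd_diff of_nat_diff)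
  hence "[int (l - 1) ^ h = (- 1) ^ h] (mod int l)" by (rule cong_pow)
  thus "[int (l - 1) ^ h = 1] (mod int l)" by (simp add: h_eq)
qed simp

text \<open>\<open>p ^ h = (p * p) ^ n\<close> is congruent to \<open>(-1) ^ n\<close>, and
  \<open>n\<close> is odd.\<close>

lemma chi_sqrt_minus_1:
  assumes "[p * p = l - 1] (mod l)" shows "chi p = -1"
proof (rule chi_eqI)
  show "\<not> l dvd p"
  proof
    assume "l dvd p"
    hence "(p * p) mod l = 0" by (simp add: dvd_eq_mod_eq_0[symmetric])
    thus False using assms l_gt_2 by (simp add: cong_def)
  qed
  have "[int (p * p) = int (l - 1)] (mod int l)" using assms by (simp only: cong_int_iff)
  moreover have "[int (l - 1) = - 1] (mod int l)" using l0 by (simp add: cong_iff_dvd_diff of_nat_diff)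
  ultimately have "[int (p * p) = -1] (mod int l)" by (rule cong_trans)
  hence "[int (p * p) ^ n = (-1) ^ n] (mod int l)" by (rule cong_pow)
  moreover have "int (p * p) ^ n = int p ^ h" unfolding h_eq power_mult by (simp add: power2_eq_square)
  ultimately show "[int p ^ h = -1] (mod int l)" using odd_n by simp
qed simp

text \<open>A primitive root has order \<open>l - 1\<close>, which exceeds \<open>h\<close>.\<close>

lemma nonresidue_exists: obtains g where "\<not> l dvd g" "chi g = -1"
proof -
  obtain g where g: "residue_primroot l g" using prime_primitive_root_exists[of l] prime_l l_gt_2 by auto
  hence ord: "ord l g = l - 1" "coprime l g" by (auto simp: residue_primroot_def totient_prime prime_l)
  have "\<not> [g ^ h = 1] (mod l)"
  proof
    assume "[g ^ h = 1] (mod l)"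
    hence "l - 1 dvd h" using ord ord_divides[of g h l] by simp
    moreover have "h > 0" "h < l - 1" using l_eq l_gt_2 by auto
    ultimately show False by (auto dest: dvd_imp_le)
  qed
  hence "chi g = -1" by (metis chi_def cong_nat_1 of_nat_power)
  moreover have "\<not> l dvd g" using ord(2) prime_l
    by (metis coprime_absorb_left not_prime_unit)
  ultimately show ?thesis using that by blast
qed

lemma reindex_units:
  assumes "\<not> l dvd b" shows "(\<Sum>a\<in>{1..<l}. f ((a * b) mod l)) = (\<Sum>a\<in>{1..<l}. f a)"
  by (rule sum.reindex_bij_betw[OF bij_mult_mod[OF assms]])

text \<open>Multiplication by a non-residue permutes the units and flips the sign of the
  sum.\<close>

lemma sum_chi: "(\<Sum>a\<in>{1..<l}. chi a) = 0"
proof -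
  obtain g where g: "\<not> l dvd g" "chi g = -1" using nonresidue_exists by blast
  have "(\<Sum>a\<in>{1..<l}. chi a) = (\<Sum>a\<in>{1..<l}. chi ((a * g) mod l))" using reindex_units[OF g(1), of chi] by simp
  also have "\<dots> = (\<Sum>a\<in>{1..<l}. - chi a)"
    using g not_dvd_unit by (intro sum.cong) (auto simp: chi_mult)
  finally show ?thesis by (simp add: sum_negf)
qed

text \<open>The quadratic Gauss sum, a square root of \<open>l\<close> inside
  \<open>E\<close>.\<close>

definition \<tau> :: complex where "\<tau> = (\<Sum>a\<in>{1..<l}. of_int (chi a) * \<zeta> ^ a)"

text \<open>For \<open>j\<close> prime to \<open>l\<close>, substitute \<open>a * j\<close> for
  \<open>a\<close> in \<tau>; otherwise all powers of \<zeta> are 1 and \<open>sum_chi\<close>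
  applies.\<close>

lemma gauss_sum:
  "(\<Sum>a\<in>{1..<l}. of_int (chi a) * \<zeta> ^ (a * j)) = (if l dvd j then 0 else of_int (chi j) * \<tau>)"
proof (cases "l dvd j")
  case True
  hence "\<zeta> ^ (a * j) = 1" for a using zeta_pow_eq_1_iff by simp
  hence "(\<Sum>a\<in>{1..<l}. of_int (chi a) * \<zeta> ^ (a * j)) = of_int (\<Sum>a\<in>{1..<l}. chi a)" by simp
  also have "\<dots> = 0" unfolding sum_chi by simp
  finally show ?thesis using True by simp
next
  case False
  have "of_int (chi j) * \<tau> = of_int (chi j) * (\<Sum>a\<in>{1..<l}. of_int (chi ((a * j) mod l)) * \<zeta> ^ ((a * j) mod l))"
    unfolding \<tau>_def using reindex_units[OF False, of "\<lambda>a. of_int (chi a) * \<zeta> ^ a"] by simp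
  also have "\<dots> = (\<Sum>a\<in>{1..<l}. of_int (chi a) * \<zeta> ^ (a * j))"
    unfolding sum_distrib_left
  proof (intro sum.cong refl)
    fix a assume "a \<in> {1..<l}"
    hence "chi (a * j) = chi a * chi j" using False not_dvd_unit by (intro chi_mult) auto
    hence "chi j * chi (a * j) = chi a" by (simp add: mult.left_commute)
    hence "of_int (chi j) * of_int (chi (a * j)) = (of_int (chi a) :: complex)" by (metis of_int_mult)
    thus "of_int (chi j) * (of_int (chi (a * j mod l)) * \<zeta> ^ (a * j mod l)) = of_int (chi a) * \<zeta> ^ (a * j)"
      by (simp add: power_mod_l[OF zeta_l] flip: mult.assoc)
  qed
  finally show ?thesis using False by simp
qed

lemma tau_E: "\<tau> \<in> E" unfolding \<tau>_def by (intro E_sum E_mult E_rat E_zeta_pow) auto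

lemma alg_tau: "algebraic_int \<tau>"
  unfolding \<tau>_def by (intro algebraic_int_sum algebraic_int_mult alg_zeta_pow) auto

lemma sig_tau: "\<not> l dvd b \<Longrightarrow> sig b \<tau> = of_int (chi b) * \<tau>"
proof -
  assume b: "\<not> l dvd b"
  have "sig b \<tau> = (\<Sum>a\<in>{1..<l}. of_int (chi a) * \<zeta> ^ (a * b))"
    unfolding \<tau>_def using b
    by (subst sig_sum) (auto simp: sig_mult sig_rat sig_zeta_pow E_rat E_zeta_pow mult.commute[of b] intro!: E_mult)
  thus ?thesis using gauss_sum[of b] b by simp
qed

text \<open>One factor is expanded and \<open>chi a * \<tau>\<close> is reopened by
  \<open>gauss_sum\<close>. Summing over \<open>a\<close> first, only \<open>b = l - 1\<close>
  contributes \<open>l\<close>, with sign \<open>chi (l - 1) = 1\<close>; what remains is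
  \<open>sum_chi\<close>.\<close>

lemma tau_square: "\<tau> * \<tau> = of_nat l"
proof -
  have "\<tau> * \<tau> = (\<Sum>a\<in>{1..<l}. of_int (chi a) * \<zeta> ^ a) * \<tau>"
    using arg_cong[OF \<tau>_def, of "\<lambda>x. x * \<tau>"] .
  also have "\<dots> = (\<Sum>a\<in>{1..<l}. \<zeta> ^ a * (of_int (chi a) * \<tau>))"
    unfolding sum_distrib_right by (intro sum.cong refl) simp
  also have "\<dots> = (\<Sum>a\<in>{1..<l}. \<zeta> ^ a * (\<Sum>b\<in>{1..<l}. of_int (chi b) * \<zeta> ^ (b * a)))"
  proof (intro sum.cong refl)
    fix a assume "a \<in> {1..<l}"
    thus "\<zeta> ^ a * (of_int (chi a) * \<tau>) = \<zeta> ^ a * (\<Sum>b\<in>{1..<l}. of_int (chi b) * \<zeta> ^ (b * a))"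
      using gauss_sum[of a] not_dvd_unit[of a] by simp
  qed
  also have "\<dots> = (\<Sum>b\<in>{1..<l}. of_int (chi b) * (\<Sum>a\<in>{1..<l}. \<zeta> ^ (a * (b + 1))))"
    unfolding sum_distrib_left by (subst sum.swap) (simp add: power_add mult_ac)
  also have "\<dots> = (\<Sum>b\<in>{1..<l}. (if b = l - 1 then of_nat l else 0) - of_int (chi b))"
  proof (intro sum.cong refl)
    fix b assume b: "b \<in> {1..<l}"
    have "l dvd b + 1 \<longleftrightarrow> b = l - 1" using b by (auto dest: dvd_imp_le)
    thus "of_int (chi b) * (\<Sum>a\<in>{1..<l}. \<zeta> ^ (a * (b + 1))) =
       (if b = l - 1 then of_nat l else 0) - of_int (chi b)"
      unfolding sum_zeta_units using chi_minus_1 l0 by (auto simp: right_diff_distrib)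
  qed
  also have "\<dots> = of_nat l - of_int (\<Sum>b\<in>{1..<l}. chi b)"
    using l_gt_2 by (simp add: sum_subtractf)
  also have "\<dots> = of_nat l" unfolding sum_chi by simp
  finally show ?thesis .
qed

text \<open>The sign of the Gauss sum is left open, since both signs generate the same
  field.\<close>

lemma sqrt_l_cases: "complex_of_real (sqrt (real l)) = \<tau> \<or> complex_of_real (sqrt (real l)) = - \<tau>"
proof -
  have "complex_of_real (sqrt (real l)) * complex_of_real (sqrt (real l)) = complex_of_real (sqrt (real l) * sqrt (real l))"
    by (simp only: of_real_mult)
  also have "\<dots> = of_nat l" by simp
  finally have "complex_of_real (sqrt (real l)) ^ 2 = \<tau> ^ 2" by (simp add: power2_eq_square tau_square)
  thus ?thesis by (simp only: power2_eq_iff)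
qed

section \<open>The fields \<open>K\<close> and \<open>L\<close> as fixed fields\<close>

definition Fix :: "nat set \<Rightarrow> complex set" where
  "Fix A = {x \<in> E. \<forall>a\<in>A. \<not> l dvd a \<longrightarrow> sig a x = x}"

lemma Fix_subset: "Fix A \<subseteq> E" by (auto simp: Fix_def)

lemma complex_subfield_Fix: "complex_subfield (Fix A)"
proof -
  interpret E: complex_subfield E by (rule complex_subfield_E)
  show ?thesis
  proof
    show "inverse x \<in> Fix A" if x: "x \<in> Fix A" for x
    proof (cases "x = 0")
      case False
      have "sig a (inverse x) = inverse x" if a: "a \<in> A" "\<not> l dvd a" for a
      proof -
        have xE: "x \<in> E" "sig a x = x" using x a by (auto simp: Fix_def)
        have "x * sig a (inverse x) = sig a (x * inverse x)"
          using a xE by (simp add: sig_mult E.inverse_F)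
        also have "\<dots> = 1" using False a by simp
        finally show ?thesis using False by (simp add: field_simps)
      qed
      thus ?thesis using x by (auto simp: Fix_def E.inverse_F)
    qed (use x in simp)
  qed (auto simp: Fix_def E_rat E_add E_mult E_uminus sig_add sig_mult sig_uminus)
qed

lemma Fix_sig:
  assumes "x \<in> Fix A" "\<not> l dvd b" shows "sig b x \<in> Fix A"
proof -
  have "sig a (sig b x) = sig b x" if "a \<in> A" "\<not> l dvd a" for a
  proof -
    have x: "x \<in> E" "sig a x = x" using assms(1) that by (auto simp: Fix_def)
    have "sig a (sig b x) = sig (b * a) x" using assms(2) that x by (simp add: sig_sig mult.commute)
    also have "\<dots> = sig b (sig a x)" using assms(2) that x(1) by (simp add: sig_sig)
    finally show ?thesis using x(2) by simp
  qed
  thus ?thesis using assms by (auto simp: Fix_def sig_E)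
qed

definition K :: "complex set" where "K = Fix {a. chi a = 1}"
definition L :: "complex set" where "L = Fix {l - 1}"

lemma l_minus_1: "\<not> l dvd l - 1" using l_gt_2 by (intro not_dvd_unit) auto

lemma K_subset_L: "K \<subseteq> L" using chi_minus_1 by (auto simp: K_def L_def Fix_def)

lemma tau_K: "\<tau> \<in> K" by (simp add: K_def Fix_def tau_E sig_tau)

text \<open>The indicator of the residues is half of \<open>1 + chi\<close>.\<close>

lemma sum_residues:
  "(\<Sum>a\<in>{a\<in>{1..<l}. chi a = 1}. \<zeta> ^ (a * j)) =
     (((if l dvd j then of_nat l else 0) - 1) + (if l dvd j then 0 else of_int (chi j) * \<tau>)) / 2"
proof -
  have "(\<Sum>a\<in>{a\<in>{1..<l}. chi a = 1}. \<zeta> ^ (a * j)) = (\<Sum>a\<in>{1..<l}. if chi a = 1 then \<zeta> ^ (a * j) else 0)"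
    by (simp add: sum.If_cases Int_def)
  also have "\<dots> = (\<Sum>a\<in>{1..<l}. (\<zeta> ^ (a * j) + of_int (chi a) * \<zeta> ^ (a * j)) / 2)"
    using chi_pm1 by (intro sum.cong refl) (auto simp: chi_def)
  also have "\<dots> = ((\<Sum>a\<in>{1..<l}. \<zeta> ^ (a * j)) + (\<Sum>a\<in>{1..<l}. of_int (chi a) * \<zeta> ^ (a * j))) / 2"
    by (simp add: sum.distrib flip: sum_divide_distrib)
  finally show ?thesis unfolding gauss_sum sum_zeta_units .
qed

lemma card_residues: "card {a\<in>{1..<l}. chi a = 1} = h"
proof -
  have "(of_nat (card {a\<in>{1..<l}. chi a = 1}) :: complex) = (of_nat l - 1) / 2"
    using sum_residues[of 0] by simp
  also have "\<dots> = of_nat h" by (subst l_eq) simp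
  finally show ?thesis by (simp only: of_nat_eq_iff)
qed

lemma h_pos: "h > 0" using l_eq l_gt_2 by auto

text \<open>Averaging over the residues does not change \<open>x\<close>, but turns each power of
  \<zeta> into a rational combination of 1 and \<tau>.\<close>

lemma K_cases:
  assumes "x \<in> K" obtains u v where "u \<in> \<rat>" "v \<in> \<rat>" "x = u + v * \<tau>"
proof -
  obtain r where r: "\<And>j. r j \<in> \<rat>" "x = (\<Sum>j<l. r j * \<zeta> ^ j)"
    using E_repr[of x] assms by (auto simp: K_def Fix_def)
  define Q where "Q = {a\<in>{1..<l}. chi a = 1}"
  define c where "c = (\<lambda>j. (if l dvd j then of_nat l else 0) - 1 :: complex)"
  define d where "d = (\<lambda>j. if l dvd j then 0 else of_int (chi j) :: complex)"
  have "of_nat h * x = (\<Sum>a\<in>Q. x)" using card_residues by (simp add: Q_def)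
  also have "\<dots> = (\<Sum>a\<in>Q. sig a x)"
    using assms not_dvd_unit by (intro sum.cong refl) (auto simp: Q_def K_def Fix_def)
  also have "\<dots> = (\<Sum>a\<in>Q. \<Sum>j<l. r j * \<zeta> ^ (a * j))"
    unfolding r(2) using r(1) not_dvd_unit by (intro sum.cong refl sig_repr) (auto simp: Q_def)
  also have "\<dots> = (\<Sum>j<l. r j * (\<Sum>a\<in>Q. \<zeta> ^ (a * j)))" by (subst sum.swap) (simp add: sum_distrib_left)
  also have "\<dots> = (\<Sum>j<l. r j * (c j / 2) + r j * (d j / 2) * \<tau>)"
    unfolding Q_def sum_residues by (intro sum.cong refl) (auto simp: c_def d_def field_simps)
  also have "\<dots> = (\<Sum>j<l. r j * (c j / 2)) + (\<Sum>j<l. r j * (d j / 2)) * \<tau>"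
    by (simp only: sum.distrib sum_distrib_right)
  finally have "x = (\<Sum>j<l. r j * (c j / 2)) / of_nat h + (\<Sum>j<l. r j * (d j / 2)) / of_nat h * \<tau>"
    using h_pos by (simp add: field_simps)
  moreover have "c j \<in> \<rat>" "d j \<in> \<rat>" for j by (auto simp: c_def d_def)
  hence "(\<Sum>j<l. r j * (c j / 2)) / of_nat h \<in> \<rat>" "(\<Sum>j<l. r j * (d j / 2)) / of_nat h \<in> \<rat>"
    using r(1) by (auto intro!: Rats_divide Rats_sum Rats_mult)
  ultimately show ?thesis using that by blast
qed

lemma rat_adjoin_sqrt_l: "rat_adjoin {complex_of_real (sqrt (real l))} = K" (is "rat_adjoin {?s} = _")
proof
  interpret K: complex_subfield K unfolding K_def by (rule complex_subfield_Fix)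
  show "rat_adjoin {?s} \<subseteq> K"
    using sqrt_l_cases tau_K K.uminus_F[OF tau_K] by (intro rat_adjoin_minimal K.complex_subfield_axioms) auto
  interpret S: complex_subfield "rat_adjoin {?s}" by (rule complex_subfield_rat_adjoin)
  have t: "\<tau> \<in> rat_adjoin {?s}"
    using sqrt_l_cases rat_adjoin_base[of ?s "{?s}"] S.uminus_F[of ?s] by auto
  have q: "u \<in> rat_adjoin {?s}" if "u \<in> \<rat>" for u using that S.of_rat_F by (auto elim!: Rats_cases)
  show "K \<subseteq> rat_adjoin {?s}"
  proof
    fix x assume "x \<in> K"
    then obtain u v where uv: "u \<in> \<rat>" "v \<in> \<rat>" "x = u + v * \<tau>" by (rule K_cases)
    show "x \<in> rat_adjoin {?s}" unfolding uv(3) by (intro S.add_F S.mult_F t q uv(1,2))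
  qed
qed

text \<open>\<zeta> has absolute value 1, so its complex conjugate is its inverse
  \<open>\<zeta> ^ (l - 1)\<close>.\<close>

lemma cnj_sig: assumes "x \<in> E" shows "cnj x = sig (l - 1) x"
proof -
  obtain r where r: "\<And>j. r j \<in> \<rat>" "x = (\<Sum>j<l. r j * \<zeta> ^ j)" using E_repr[OF assms] by blast
  have "cmod \<zeta> ^ l = 1" by (metis zeta_l norm_one norm_power)
  hence "cmod \<zeta> = 1" using l0 power_eq_imp_eq_base[of "cmod \<zeta>" l 1] by simp
  hence "\<zeta> * cnj \<zeta> = 1" by (simp add: complex_norm_square[symmetric])
  moreover have "\<zeta> * \<zeta> ^ (l - 1) = 1" using zeta_l l0 by (simp add: power_eq_if)
  ultimately have z: "cnj \<zeta> = \<zeta> ^ (l - 1)" using zeta_ne_0 by (metis mult_left_cancel)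
  have q: "cnj (r j) = r j" for j using r(1)[of j] by (auto elim!: Rats_cases')
  have "cnj x = (\<Sum>j<l. r j * \<zeta> ^ ((l - 1) * j))" by (simp add: r(2) q z power_mult)
  also have "\<dots> = sig (l - 1) x" unfolding r(2) using r(1) l_minus_1 by (intro sig_repr[symmetric]) auto
  finally show ?thesis .
qed

lemma maximal_real_subfield_zeta: "maximal_real_subfield (rat_adjoin {\<zeta>}) = L"
  unfolding maximal_real_subfield_def rat_adjoin_zeta L_def Fix_def
  using cnj_sig l_minus_1 by (auto simp: Reals_cnj_iff)

lemma number_field_K: "\<exists>B. number_field K B (sig ` {1..<l})"
proof -
  define b where "b = (\<lambda>i::nat. if i = 0 then 1 else \<tau>)"
  interpret K: complex_subfield K unfolding K_def by (rule complex_subfield_Fix)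
  have "number_field K (b ` {0,1}) (sig ` {1..<l})"
  proof (rule number_fieldI)
    fix x assume "x \<in> K"
    then obtain u v where uv: "u \<in> \<rat>" "v \<in> \<rat>" "x = u + v * \<tau>" by (rule K_cases)
    then obtain u' v' where "u = of_rat u'" "v = of_rat v'" by (auto elim!: Rats_cases)
    thus "\<exists>r. x = (\<Sum>i\<in>{0,1}. of_rat (r i) * b i)"
      using uv by (intro exI[of _ "\<lambda>i. if i = 0 then u' else v'"]) (simp add: b_def)
  next
    show "K \<subseteq> E" unfolding K_def by (rule Fix_subset)
  qed (auto simp: b_def integers_of_def K.one_F tau_K alg_tau K.complex_subfield_axioms)
  thus ?thesis by blast
qed

lemma minus_1_square: "[(l - 1) * ((l - 1) * a) = a] (mod l)"
proof -
  define m where "m = l - 2"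
  have "l = m + 2" using l_gt_2 by (simp add: m_def)
  hence "(l - 1) * (l - 1) = l * (l - 2) + 1" by simp
  hence "(l - 1) * ((l - 1) * a) = l * ((l - 2) * a) + a" by (metis distrib_right mult.assoc mult_1)
  thus ?thesis by (simp add: cong_def)
qed

text \<open>The spanning family consists of the doubled real parts of the powers of \<zeta> and has
  repetitions. For \<open>x\<close> in \<open>L\<close>, \<open>2 * x\<close> is the sum of
  \<open>x\<close> and its conjugate.\<close>

lemma number_field_L: "\<exists>B. number_field L B (sig ` {1..<l})"
proof -
  define b where "b = (\<lambda>i. \<zeta> ^ i + \<zeta> ^ ((l - 1) * i))"
  have bE: "b i \<in> E" for i unfolding b_def by (intro E_add E_zeta_pow)
  have "sig (l - 1) (b i) = b i" for i
  proof -
    have "\<zeta> ^ ((l - 1) * ((l - 1) * i)) = \<zeta> ^ i" by (rule zeta_pow_cong[OF minus_1_square])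
    thus ?thesis unfolding b_def using l_minus_1
      by (subst sig_add) (auto simp: E_zeta_pow sig_zeta_pow add.commute)
  qed
  hence bL: "b i \<in> L" for i using bE by (simp add: L_def Fix_def)
  have "number_field L (b ` {..<l}) (sig ` {1..<l})"
  proof (rule number_fieldI)
    fix x assume "x \<in> L"
    hence x: "x \<in> E" "sig (l - 1) x = x" using l_minus_1 by (auto simp: L_def Fix_def)
    obtain r where r: "\<And>j. r j \<in> \<rat>" "x = (\<Sum>j<l. r j * \<zeta> ^ j)" using E_repr[OF x(1)] by blast
    have "\<forall>j. \<exists>q. r j = of_rat q" using r(1) by (auto elim!: Rats_cases)
    then obtain q where q: "\<And>j. r j = of_rat (q j)" by metis
    have "2 * x = x + sig (l - 1) x" using x by simp
    also have "\<dots> = (\<Sum>j<l. r j * b j)"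
      unfolding r(2) using r(1) l_minus_1 by (subst sig_repr) (auto simp: b_def distrib_left sum.distrib)
    finally have eq: "2 * x = (\<Sum>j<l. r j * b j)" .
    have "x = (2 * x) / 2" by simp
    also have "\<dots> = (\<Sum>j<l. of_rat (q j / 2) * b j)"
      unfolding eq by (simp add: q of_rat_divide sum_divide_distrib)
    finally have "x = (\<Sum>j<l. of_rat (q j / 2) * b j)" .
    thus "\<exists>r. x = (\<Sum>i\<in>{..<l}. of_rat (r i) * b i)" by (intro exI[of _ "\<lambda>j. q j / 2"])
  qed (use bL in \<open>auto simp: integers_of_def b_def L_def Fix_subset complex_subfield_Fix
        intro: algebraic_int_add alg_zeta_pow\<close>)
  thus ?thesis by blast
qed

text \<open>Representatives of the Galois group of \<open>L\<close> over \<open>K\<close>, that is,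
  of the squares modulo \<open>l\<close> up to sign.\<close>

definition H :: "nat set" where "H = {a \<in> {1..h}. chi a = 1}"

lemma chi_neg: "a \<in> {1..<l} \<Longrightarrow> chi (l - a) = chi a"
proof -
  assume a: "a \<in> {1..<l}"
  have "(l - 1) * a = l * (a - 1) + (l - a)" using a by (auto simp: algebra_simps diff_mult_distrib2)
  hence "[(l - 1) * a = l - a] (mod l)" by (simp add: cong_def)
  hence "chi (l - a) = chi ((l - 1) * a)" by (metis chi_congr)
  also have "\<dots> = chi a" using a l_minus_1 not_dvd_unit chi_minus_1 by (simp add: chi_mult)
  finally show ?thesis .
qed

lemma H_units: "a \<in> H \<Longrightarrow> a \<in> {1..<l}" "a \<in> H \<Longrightarrow> \<not> l dvd a" "a \<in> H \<Longrightarrow> chi a = 1"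
  using l_eq not_dvd_unit by (auto simp: H_def)

lemma finite_H: "finite H" by (simp add: H_def)

text \<open>The \<open>h = 2 * n\<close> residues come in pairs \<open>a\<close>,
  \<open>l - a\<close>, exactly one member of which is at most \<open>h\<close>.\<close>

lemma card_H: "card H = n"
proof -
  have "{a\<in>{1..<l}. chi a = 1} = H \<union> (\<lambda>a. l - a) ` H" (is "?Q = _")
  proof
    show "?Q \<subseteq> H \<union> (\<lambda>a. l - a) ` H"
    proof
      fix a assume a: "a \<in> ?Q"
      show "a \<in> H \<union> (\<lambda>a. l - a) ` H"
      proof (cases "a \<le> h")
        case False
        hence "l - a \<in> H" using a chi_neg[of a] l_eq by (auto simp: H_def)
        moreover have "a = l - (l - a)" using a by auto
        ultimately show ?thesis by blast
      qed (use a in \<open>auto simp: H_def\<close>)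
    qed
    show "H \<union> (\<lambda>a. l - a) ` H \<subseteq> ?Q"
    proof (intro Un_least subsetI)
      fix x assume "x \<in> (\<lambda>a. l - a) ` H"
      then obtain a where a: "x = l - a" "a \<in> H" by blast
      thus "x \<in> ?Q" using H_units[OF a(2)] chi_neg[of a] by auto
    qed (use H_units in auto)
  qed
  moreover have "H \<inter> (\<lambda>a. l - a) ` H = {}" using l_eq by (auto simp: H_def)
  moreover have "card ((\<lambda>a. l - a) ` H) = card H"
    using l_eq by (intro card_image inj_onI) (auto simp: H_def)
  ultimately have "h = card H + card H" using card_residues finite_H by (simp add: card_Un_disjoint)
  thus ?thesis using h_eq by simp
qed

end

subsection \<open>Prime ideals and residue fields\<close>

text \<open>The coefficients of the quotient are determined from the top downwards by Horner's
  recursion, which stays inside \<open>R\<close>.\<close>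

lemma synthetic_div_coeff_mem:
  fixes f :: "complex poly"
  assumes R: "0 \<in> R" "\<And>x y. x \<in> R \<Longrightarrow> y \<in> R \<Longrightarrow> x + y \<in> R" "\<And>x. x \<in> R \<Longrightarrow> c * x \<in> R"
    and f: "\<And>i. coeff f i \<in> R"
  shows "coeff (synthetic_div f c) i \<in> R"
proof (induction "degree f - i" arbitrary: i rule: less_induct)
  case less
  show ?case
  proof (cases "i < degree f")
    case True
    have "coeff (f + smult c (synthetic_div f c)) (Suc i) = coeff (pCons (poly f c) (synthetic_div f c)) (Suc i)"
      by (simp only: synthetic_div_correct)
    hence "coeff (synthetic_div f c) i = coeff f (Suc i) + c * coeff (synthetic_div f c) (Suc i)"
      by simp
    moreover have "coeff (synthetic_div f c) (Suc i) \<in> R" using True by (intro less) auto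
    ultimately show ?thesis using R f by simp
  next
    case False
    hence "coeff (synthetic_div f c) i = 0"
    proof (cases "degree f = 0")
      case True
      hence "synthetic_div f c = 0" by (simp add: synthetic_div_eq_0_iff)
      thus ?thesis by simp
    qed (use False in \<open>auto intro!: coeff_eq_0 simp: degree_synthetic_div\<close>)
    thus ?thesis using R(1) by simp
  qed
qed

context number_field
begin

lemma integer_ring_simps [simp]:
  "carrier (integer_ring F) = \<O>"
  "x \<otimes>\<^bsub>integer_ring F\<^esub> y = x * y"
  "x \<oplus>\<^bsub>integer_ring F\<^esub> y = x + y"
  "\<one>\<^bsub>integer_ring F\<^esub> = 1"
  "\<zero>\<^bsub>integer_ring F\<^esub> = 0"
  using complex_field_simps by (simp_all add: integer_ring_def)

context
  fixes P assumes P: "P \<in> primes_of F"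
begin

interpretation P: primeideal P "integer_ring F"
  using P by (simp add: primes_of_def)

lemma prime_subset: "x \<in> P \<Longrightarrow> x \<in> \<O>" using P.Icarr by simp
lemma prime_add: "x \<in> P \<Longrightarrow> y \<in> P \<Longrightarrow> x + y \<in> P" using additive_subgroup.a_closed[OF P.additive_subgroup_axioms, of x y] by simp
lemma prime_zero: "0 \<in> P" using additive_subgroup.zero_closed[OF P.additive_subgroup_axioms] by simp
lemma prime_mult: "a \<in> \<O> \<Longrightarrow> x \<in> P \<Longrightarrow> a * x \<in> P" using P.I_l_closed by simp
lemma prime_uminus: "x \<in> P \<Longrightarrow> - x \<in> P"
  using prime_mult[of "- 1" x] uminus_O[OF one_O] by simp
lemma prime_diff: "x \<in> P \<Longrightarrow> y \<in> P \<Longrightarrow> x - y \<in> P"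
  using prime_add[of x "- y"] prime_uminus[of y] by simp
lemma prime_not_one: "1 \<notin> P" using P.I_notcarr P.one_imp_carrier by auto
lemma prime_prime: "x \<in> \<O> \<Longrightarrow> y \<in> \<O> \<Longrightarrow> x * y \<in> P \<Longrightarrow> x \<in> P \<or> y \<in> P"
  using P.I_prime by simp

lemma prime_power: "x \<in> \<O> \<Longrightarrow> x ^ k \<in> P \<Longrightarrow> x \<in> P"
  by (induction k) (use prime_not_one prime_prime power_O in auto)

lemma prime_frac: "fractional_ideal F P"
proof -
  obtain x where "x \<in> P" "x \<noteq> 0" using P prime_zero by (auto simp: primes_of_def)
  thus ?thesis
    using prime_subset O_F by (intro fractional_idealI[of _ x 1]) (auto intro: prime_add prime_mult one_O)
qed

text \<open>Over the domain \<O>/P a nonzero polynomial has at most as many roots as its degree. In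
  terms of representatives: synthetic division by a root \<open>c\<close> lowers the degree, and
  primality removes the factor \<open>x - c\<close> at the remaining roots.\<close>

lemma prime_few_roots:
  assumes "\<And>i. coeff f i \<in> \<O>" "finite X'" "degree f < card X'" "X' \<subseteq> \<O>"
    and "\<And>x y. x \<in> X' \<Longrightarrow> y \<in> X' \<Longrightarrow> x \<noteq> y \<Longrightarrow> x - y \<notin> P"
    and "\<And>x. x \<in> X' \<Longrightarrow> poly f x \<in> P"
  shows "coeff f i \<in> P"
  using assms
proof (induction "degree f" arbitrary: f X' i rule: less_induct)
  case less
  obtain c where c: "c \<in> X'" using less.prems(3) by fastforce
  show ?case
  proof (cases "degree f = 0")
    case True
    then obtain a where "f = [:a:]" by (metis degree_eq_zeroE)
    thus ?thesis using less.prems(6)[OF c] prime_zero by (auto simp: coeff_pCons split: nat.splits)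
  next
    case False
    define s where "s = synthetic_div f c"
    have f: "f + smult c s = pCons (poly f c) s" unfolding s_def by (rule synthetic_div_correct)
    have cO: "c \<in> \<O>" using c less.prems(4) by auto
    have sO: "coeff s i \<in> \<O>" for i unfolding s_def
      by (rule synthetic_div_coeff_mem) (auto intro: zero_O add_O mult_O cO less.prems(1))
    have eval: "poly f x = (x - c) * poly s x + poly f c" for x
      using arg_cong[OF f, of "\<lambda>q. poly q x"] by (simp add: algebra_simps)
    have "coeff s i \<in> P" for i
    proof (rule less.hyps[of s "X' - {c}"])
      show "degree s < degree f" using False by (simp add: s_def degree_synthetic_div)
      thus "degree s < card (X' - {c})" using c less.prems(2,3) by (simp add: card_Diff_singleton)
      fix x assume x: "x \<in> X' - {c}"
      have "(x - c) * poly s x = poly f x - poly f c" using eval[of x] by simp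
      also have "\<dots> \<in> P" by (rule prime_diff[OF less.prems(6) less.prems(6)[OF c]]) (use x in simp)
      finally have "(x - c) * poly s x \<in> P" .
      moreover have "poly s x \<in> \<O>" unfolding poly_altdef
        using x less.prems(4) by (intro sum_O mult_O sO power_O) auto
      ultimately show "poly s x \<in> P" using prime_prime[of "x - c" "poly s x"] x c less.prems(4,5)
        by (auto intro: diff_O)
    qed (use less.prems sO in auto)
    moreover have "f = pCons (poly f c) s - smult c s" using f by (simp add: eq_diff_eq)
    hence "coeff f i = coeff (pCons (poly f c) s - smult c s) i" by (rule arg_cong)
    hence "coeff f i = coeff (pCons (poly f c) s) i - c * coeff s i" by (simp only: coeff_diff coeff_smult)
    ultimately show ?thesis using less.prems(6)[OF c] cO
      by (auto simp: coeff_pCons intro!: prime_diff prime_mult split: nat.splits)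
  qed
qed

text \<open>Two powers of \<open>x\<close> agree modulo \<open>D\<close>, hence modulo
  \<open>P\<close>; cancelling the smaller one leaves \<open>x ^ (j - i)\<close> congruent to
  1.\<close>

lemma prime_inverse:
  assumes "D > 0" "of_nat D \<in> P" "x \<in> \<O>" "x \<notin> P"
  shows "\<exists>y\<in>\<O>. 1 - x * y \<in> P"
proof -
  obtain f :: "complex \<Rightarrow> nat \<Rightarrow> nat" where f: "finite (f ` \<O>)"
    "\<And>x y. x \<in> \<O> \<Longrightarrow> y \<in> \<O> \<Longrightarrow> f x = f y \<Longrightarrow> algebraic_int ((x - y) / of_nat D)"
    using residues_finite[OF assms(1)] by metis
  have "finite (range (\<lambda>k. f (x ^ k)))"
    using assms(3) by (intro finite_subset[OF _ f(1)]) (auto intro: power_O)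
  hence "\<not> inj (\<lambda>k. f (x ^ k))" using finite_imageD by blast
  then obtain i j where ij: "i < j" "f (x ^ i) = f (x ^ j)"
    unfolding inj_on_def by (metis UNIV_I linorder_neqE_nat)
  have "x ^ i - x ^ j \<in> F" by (intro diff_F power_F O_F assms(3))
  from of_nat_mult_subset[OF prime_frac assms(2) this f(2)[OF power_O power_O ij(2)] assms(1)] assms(3)
  have "x ^ i - x ^ j \<in> P" by simp
  also have "x ^ i - x ^ j = x ^ i * (1 - x * x ^ (j - i - 1))"
  proof -
    have "j = i + Suc (j - i - 1)" using ij(1) by simp
    hence "x ^ j = x ^ i * (x * x ^ (j - i - 1))" by (metis power_add power_Suc)
    thus ?thesis by (simp add: right_diff_distrib)
  qed
  finally have "x ^ i * (1 - x * x ^ (j - i - 1)) \<in> P" .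
  hence "x ^ i \<in> P \<or> 1 - x * x ^ (j - i - 1) \<in> P"
    using assms(3) by (intro prime_prime) (auto intro: power_O diff_O mult_O one_O)
  thus ?thesis using prime_power assms(3,4) power_O by blast
qed

text \<open>An integer prime to \<open>p\<close> in \<open>P\<close> would, by Bezout, put 1 into
  \<open>P\<close>.\<close>

lemma prime_int_iff:
  assumes "Factorial_Ring.prime (p::nat)" "of_nat p \<in> P"
  shows "of_int c \<in> P \<longleftrightarrow> int p dvd c"
proof
  assume "int p dvd c"
  then obtain k where "c = int p * k" by (auto simp: dvd_def)
  hence "(of_int c :: complex) = of_int k * of_nat p" by simp
  thus "of_int c \<in> P" using assms(2) prime_mult of_int_O by simp
next
  assume c: "of_int c \<in> P"
  show "int p dvd c"
  proof (rule ccontr)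
    assume "\<not> int p dvd c"
    hence "coprime c (int p)" using assms(1)
      by (metis coprime_commute prime_imp_coprime_int prime_nat_int_transfer)
    then obtain d where "[c * d = 1] (mod int p)" using cong_solve_coprime_int by blast
    then obtain k where "1 = c * d + int p * k" by (metis cong_iff_lin)
    hence "(of_int 1 :: complex) = of_int (c * d + int p * k)" by simp
    hence "(1 :: complex) = of_int d * of_int c + of_int k * of_nat p" by (simp add: mult.commute)
    also have "\<dots> \<in> P" using c assms(2) by (intro prime_add prime_mult of_int_O)
    finally show False using prime_not_one by simp
  qed
qed

text \<open>Turns the dimension into the two facts used later: not every integer of \<open>F\<close>
  is congruent to a rational integer, but each satisfies a nontrivial quadratic congruence, because
  \<open>x ^ 2\<close>, \<open>x\<close> and 1 are dependent in dimension two.\<close>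

lemma residue_degree_2:
  assumes p: "Factorial_Ring.prime (p::nat)" "of_nat p \<in> P" and deg: "residue_degree F \<rat> P = 2"
  shows "\<exists>x\<in>\<O>. \<forall>c. x - of_int c \<notin> P"
    and "\<And>x. x \<in> \<O> \<Longrightarrow> \<exists>a b c. \<not> (of_int a \<in> P \<and> of_int b \<in> P \<and> of_int c \<in> P) \<and>
           of_int a * x ^ 2 + of_int b * x + of_int c \<in> P"
proof -
  define R where "R = integer_ring F Quot P"
  define q where "q = (\<lambda>x. P +>\<^bsub>integer_ring F\<^esub> x)"
  have q_hom: "q \<in> Ring.ring_hom (integer_ring F) R" unfolding q_def R_def by (rule P.rcos_ring_hom)
  have carr: "carrier R = q ` \<O>" by (auto simp: R_def q_def FactRing_def A_RCOSETS_def')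
  have q_mult: "q (x * y) = q x \<otimes>\<^bsub>R\<^esub> q y" if "x \<in> \<O>" "y \<in> \<O>" for x y
    using ring_hom_mult[OF q_hom, of x y] that by simp
  have q_add: "q (x + y) = q x \<oplus>\<^bsub>R\<^esub> q y" if "x \<in> \<O>" "y \<in> \<O>" for x y
    using ring_hom_add[OF q_hom, of x y] that by simp
  have q_1: "q 1 = \<one>\<^bsub>R\<^esub>" using ring_hom_one[OF q_hom] by simp
  have q_carr: "q x \<in> carrier R" if "x \<in> \<O>" for x using that carr by auto
  have q_0: "q 0 = \<zero>\<^bsub>R\<^esub>"
    unfolding q_def using P.a_rcos_const[OF prime_zero] by (simp add: R_def FactRing_def)
  have q_0_iff: "q x = \<zero>\<^bsub>R\<^esub> \<longleftrightarrow> x \<in> P" if "x \<in> \<O>" for x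
  proof -
    have z: "\<zero>\<^bsub>R\<^esub> = P" by (simp add: R_def FactRing_def)
    show ?thesis unfolding z q_def using P.a_rcos_const P.rcos_const_imp_mem that by auto
  qed
  have q_eq_iff: "q x = q y \<longleftrightarrow> x - y \<in> P" if "x \<in> \<O>" "y \<in> \<O>" for x y
  proof -
    have "abelian_group R" unfolding R_def
      using P.quotient_is_cring[OF P.is_cring] by (simp add: cring_def ring_def)
    then interpret abelian_group R .
    have e: "q x = q (x - y) \<oplus>\<^bsub>R\<^esub> q y" using q_add[of "x - y" y] that diff_O by simp
    have "q x = q y \<longleftrightarrow> q (x - y) = \<zero>\<^bsub>R\<^esub>"
      unfolding e using q_carr[OF diff_O[OF that]] q_carr[OF that(2)] by auto
    thus ?thesis using q_0_iff[OF diff_O[OF that]] by simp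
  qed
  have "p > 0" using p(1) by (simp add: prime_gt_0_nat)
  have fieldR: "field R"
  proof (rule cring.cring_fieldI2)
    have "domain R" unfolding R_def by (rule P.quotient_is_domain)
    thus "cring R" "\<zero>\<^bsub>R\<^esub> \<noteq> \<one>\<^bsub>R\<^esub>" by (auto simp: domain_def domain_axioms_def)
    fix a assume a: "a \<in> carrier R" "a \<noteq> \<zero>\<^bsub>R\<^esub>"
    then obtain x where x: "x \<in> \<O>" "a = q x" using carr by auto
    then obtain y where y: "y \<in> \<O>" "1 - x * y \<in> P"
      using prime_inverse[OF \<open>p > 0\<close> p(2), of x] a q_0_iff by auto
    have "q 1 = q (x * y)" using q_eq_iff[OF one_O mult_O[OF x(1) y(1)]] y by simp
    hence "a \<otimes>\<^bsub>R\<^esub> q y = \<one>\<^bsub>R\<^esub>" using q_1 q_mult x y by simp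
    thus "\<exists>b\<in>carrier R. a \<otimes>\<^bsub>R\<^esub> b = \<one>\<^bsub>R\<^esub>" using q_carr y(1) by blast
  qed
  interpret R: field R by (rule fieldR)
  define k where "k = q ` integers_of \<rat>"
  \<comment> \<open>The residue field below is the prime field, the image of the rational
    integers.\<close>
  have k: "k = range (\<lambda>c. q (of_int c))"
    using rational_algebraic_int_is_int Ints_subset_Rats
    by (auto simp: k_def integers_of_def elim!: Ints_cases intro!: imageI)
  have k_mem: "q (of_int c) \<in> k" for c using k by blast
  have k_sub: "subfield k R"
  proof (rule R.subfieldI'[OF R.subringI])
    show "k \<subseteq> carrier R" using k q_carr of_int_O by auto
    show "\<one>\<^bsub>R\<^esub> \<in> k" unfolding k q_1[symmetric] by (rule range_eqI[of _ _ 1]) simp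
  next
    fix x y assume "x \<in> k" "y \<in> k"
    then obtain c d where cd: "x = q (of_int c)" "y = q (of_int d)" using k by auto
    have "x \<otimes>\<^bsub>R\<^esub> y = q (of_int (c * d))" "x \<oplus>\<^bsub>R\<^esub> y = q (of_int (c + d))"
      using cd q_mult[OF of_int_O of_int_O] q_add[OF of_int_O of_int_O] by auto
    thus "x \<otimes>\<^bsub>R\<^esub> y \<in> k" "x \<oplus>\<^bsub>R\<^esub> y \<in> k" by (simp_all only: k_mem)
  next
    fix x assume "x \<in> k"
    then obtain c where c: "x = q (of_int c)" using k by auto
    have "q (of_int (- c)) \<oplus>\<^bsub>R\<^esub> x = \<zero>\<^bsub>R\<^esub>"
      using c q_add[OF of_int_O of_int_O, of "- c" c] q_0 by simp
    hence "\<ominus>\<^bsub>R\<^esub> x = q (of_int (- c))" using c q_carr[OF of_int_O, of c] q_carr[OF of_int_O, of "- c"]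
      by (intro R.minus_equality) simp_all
    thus "\<ominus>\<^bsub>R\<^esub> x \<in> k" by (simp only: k_mem)
  next
    fix x assume x: "x \<in> k - {\<zero>\<^bsub>R\<^esub>}"
    then obtain c where c: "x = q (of_int c)" using k by auto
    have "\<not> int p dvd c" using x c q_0_iff[OF of_int_O] prime_int_iff[OF p] by auto
    hence "coprime c (int p)" using p(1)
      by (metis coprime_commute prime_imp_coprime_int prime_nat_int_transfer)
    then obtain d where "[c * d = 1] (mod int p)" using cong_solve_coprime_int by blast
    hence "int p dvd c * d - 1" by (simp add: cong_iff_dvd_diff)
    hence "of_int (c * d - 1) \<in> P" by (simp only: prime_int_iff[OF p])
    hence "q (of_int (c * d)) = q 1" using q_eq_iff[OF of_int_O one_O, of "c * d"] by simp
    hence "x \<otimes>\<^bsub>R\<^esub> q (of_int d) = \<one>\<^bsub>R\<^esub>" using c q_mult[OF of_int_O of_int_O] q_1 by simp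
    hence "inv\<^bsub>R\<^esub> x = q (of_int d)"
      using c q_carr[OF of_int_O] by (intro R.comm_inv_char) auto
    thus "inv\<^bsub>R\<^esub> x \<in> k" by (simp only: k_mem)
  qed
  \<comment> \<open>Finiteness of the residue field guarantees a finite dimension, which is needed
    before the value of \<open>dim\<close> says anything.\<close>
  have finR: "finite (carrier R)"
  proof -
    obtain f :: "complex \<Rightarrow> nat \<Rightarrow> nat" where f: "finite (f ` \<O>)"
      "\<And>x y. x \<in> \<O> \<Longrightarrow> y \<in> \<O> \<Longrightarrow> f x = f y \<Longrightarrow> algebraic_int ((x - y) / of_nat p)"
      using residues_finite[OF \<open>p > 0\<close>] by metis
    have f_q: "q x = q y" if xy: "x \<in> \<O>" "y \<in> \<O>" "f x = f y" for x y
      using of_nat_mult_subset[OF prime_frac p(2) diff_F[OF O_F[OF xy(1)] O_F[OF xy(2)]] f(2)[OF xy] \<open>p > 0\<close>]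
        q_eq_iff[OF xy(1,2)] by simp
    have "carrier R \<subseteq> (\<lambda>v. q (SOME x. x \<in> \<O> \<and> f x = v)) ` f ` \<O>"
    proof
      fix a assume "a \<in> carrier R"
      then obtain x where x: "x \<in> \<O>" "a = q x" using carr by auto
      have "(SOME y. y \<in> \<O> \<and> f y = f x) \<in> \<O> \<and> f (SOME y. y \<in> \<O> \<and> f y = f x) = f x"
        by (rule someI[of _ x]) (use x in simp)
      hence "a = q (SOME y. y \<in> \<O> \<and> f y = f x)" using f_q x by metis
      thus "a \<in> (\<lambda>v. q (SOME x. x \<in> \<O> \<and> f x = v)) ` f ` \<O>" using x by blast
    qed
    thus ?thesis using f(1) by (meson finite_imageI finite_subset)
  qed
  obtain Us where Us: "set Us = carrier R" using finite_list[OF finR] by blast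
  have UsC: "set Us \<subseteq> carrier R" using Us by simp
  have "R.Span k Us = carrier R"
    using R.Span_base_incl[OF k_sub UsC] R.Span_subgroup_props(1)[OF k_sub UsC] Us by auto
  hence fd: "R.finite_dimension k (carrier R)"
    using R.Span_finite_dimension[OF k_sub, of Us] Us by simp
  have "R.dim k (carrier R) = 2"
    using deg by (simp add: residue_degree_def Let_def R_def k_def q_def)
  hence dim2: "R.dimension 2 k (carrier R)"
    using R.finite_dimensionE[OF k_sub fd] by (simp add: over_def)
  show "\<exists>x\<in>\<O>. \<forall>c. x - of_int c \<notin> P"
  proof (rule ccontr)
    assume "\<not> ?thesis"
    hence all: "\<exists>c. x - of_int c \<in> P" if "x \<in> \<O>" for x using that by auto
    \<comment> \<open>Otherwise the residue field would coincide with its prime field and have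
      dimension one.\<close>
    have "carrier R \<subseteq> k"
    proof
      fix a assume "a \<in> carrier R"
      then obtain x where x: "x \<in> \<O>" "a = q x" using carr by blast
      obtain c where "x - of_int c \<in> P" using all[OF x(1)] by blast
      hence "a = q (of_int c)" using x q_eq_iff of_int_O by simp
      thus "a \<in> k" by (simp only: k_mem)
    qed
    hence "carrier R = k" using subfieldE(3)[OF k_sub] by auto
    hence "R.dimension 1 k (carrier R)" using R.dimension_one[OF k_sub] by simp
    thus False using R.dimension_is_inj[OF k_sub dim2] by force
  qed
  fix x assume x: "x \<in> \<O>"
  define Vs where "Vs = [q (x ^ 2), q x, \<one>\<^bsub>R\<^esub>]"
  have VsC: "set Vs \<subseteq> carrier R" using x q_carr power_O by (auto simp: Vs_def)
  have "\<not> R.independent k Vs"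
  proof
    assume "R.independent k Vs"
    from R.independent_length_le_dimension[OF k_sub dim2 this VsC] show False by (simp add: Vs_def)
  qed
  then obtain Ks where Ks: "length Ks = length Vs" "R.combine Ks Vs = \<zero>\<^bsub>R\<^esub>" "set Ks \<subseteq> k" "set Ks \<noteq> {\<zero>\<^bsub>R\<^esub>}"
    using R.dependent_imp_non_trivial_combine[OF k_sub VsC] by metis
  obtain A B C where ABC: "Ks = [A, B, C]" using Ks(1)
    by (auto simp: Vs_def length_Suc_conv)
  obtain a b c where abc: "A = q (of_int a)" "B = q (of_int b)" "C = q (of_int c)"
    using Ks(3) k ABC by auto
  have O: "of_int a * x ^ 2 \<in> \<O>" "of_int b * x \<in> \<O>" "of_int c \<in> \<O>"
    using x by (auto intro: mult_O power_O of_int_O)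
  have "q (of_int a * x ^ 2 + of_int b * x + of_int c)
      = (q (of_int a) \<otimes>\<^bsub>R\<^esub> q (x ^ 2) \<oplus>\<^bsub>R\<^esub> q (of_int b) \<otimes>\<^bsub>R\<^esub> q x) \<oplus>\<^bsub>R\<^esub> q (of_int c)"
    using O x by (simp add: q_add add_O q_mult of_int_O power_O)
  also have "\<dots> = R.combine Ks Vs"
    using x q_carr[OF of_int_O] q_carr[OF x] q_carr[OF power_O[OF x]]
    by (simp add: ABC Vs_def abc R.a_assoc)
  finally have "q (of_int a * x ^ 2 + of_int b * x + of_int c) = \<zero>\<^bsub>R\<^esub>" using Ks(2) by simp
  hence "of_int a * x ^ 2 + of_int b * x + of_int c \<in> P" using q_0_iff O by (simp add: add_O)
  moreover have "\<not> (of_int a \<in> P \<and> of_int b \<in> P \<and> of_int c \<in> P)"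
    using Ks(4) ABC abc q_0_iff[OF of_int_O] by auto
  ultimately show "\<exists>a b c. \<not> (of_int a \<in> P \<and> of_int b \<in> P \<and> of_int c \<in> P) \<and>
           of_int a * x ^ 2 + of_int b * x + of_int c \<in> P" by blast
qed

end

end

subsection \<open>The Frobenius automorphism\<close>

definition cong_int :: "nat \<Rightarrow> complex \<Rightarrow> complex \<Rightarrow> bool" where
  "cong_int p x y \<longleftrightarrow> algebraic_int ((x - y) / of_nat p)"

lemma cong_int_refl: "cong_int p x x" by (simp add: cong_int_def)

lemma cong_int_sym: "cong_int p x y \<Longrightarrow> cong_int p y x"
  unfolding cong_int_def by (drule algebraic_int_minus) (simp add: diff_divide_distrib)

lemma cong_int_trans: "cong_int p x y \<Longrightarrow> cong_int p y z \<Longrightarrow> cong_int p x z"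
  unfolding cong_int_def by (drule (1) algebraic_int_add) (simp add: diff_divide_distrib)

lemma cong_int_add: "cong_int p x y \<Longrightarrow> cong_int p x' y' \<Longrightarrow> cong_int p (x + x') (y + y')"
  unfolding cong_int_def by (drule (1) algebraic_int_add) (simp add: diff_divide_distrib add_divide_distrib algebra_simps)

lemma cong_int_mult:
  assumes "cong_int p x y" "cong_int p x' y'" "algebraic_int x'" "algebraic_int y"
  shows "cong_int p (x * x') (y * y')"
proof -
  have "algebraic_int ((x - y) / of_nat p * x' + y * ((x' - y') / of_nat p))"
    using assms unfolding cong_int_def by (intro algebraic_int_add algebraic_int_mult)
  also have "(x - y) / of_nat p * x' + y * ((x' - y') / of_nat p) = (x * x' - y * y') / of_nat p"
    by (simp add: diff_divide_distrib algebra_simps)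
  finally show ?thesis by (simp add: cong_int_def)
qed

lemma cong_int_power:
  assumes "cong_int p x y" "algebraic_int x" "algebraic_int y" shows "cong_int p (x ^ k) (y ^ k)"
  by (induction k) (auto intro!: cong_int_mult cong_int_refl assms algebraic_int_power)

lemma freshman:
  assumes p: "Factorial_Ring.prime (p::nat)" and a: "algebraic_int a" and b: "algebraic_int b"
  shows "cong_int p ((a + b) ^ p) (a ^ p + b ^ p)"
proof -
  have p0: "p > 0" using p prime_gt_0_nat by blast
  have "{..p} = insert 0 (insert p {1..<p})" using p0 by auto
  hence "(a + b) ^ p = a ^ p + b ^ p + (\<Sum>k\<in>{1..<p}. of_nat (p choose k) * a ^ k * b ^ (p - k))"
    using p0 by (simp add: binomial_ring add.commute)
  hence "((a + b) ^ p - (a ^ p + b ^ p)) / of_nat p =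
      (\<Sum>k\<in>{1..<p}. of_nat (p choose k) * a ^ k * b ^ (p - k) / of_nat p)"
    by (simp add: sum_divide_distrib)
  also have "algebraic_int \<dots>"
  proof (rule algebraic_int_sum)
    fix k assume "k \<in> {1..<p}"
    hence "p dvd p choose k" using p by (intro dvd_choose_prime) auto
    then obtain m where "p choose k = p * m" by (auto simp: dvd_def)
    hence "of_nat (p choose k) * a ^ k * b ^ (p - k) / of_nat p = of_nat m * a ^ k * b ^ (p - k)"
      using p0 by simp
    also have "algebraic_int \<dots>" by (intro algebraic_int_mult algebraic_int_power a b) simp
    finally show "algebraic_int (of_nat (p choose k) * a ^ k * b ^ (p - k) / of_nat p)" .
  qed
  finally show ?thesis by (simp add: cong_int_def)
qed

lemma freshman_sum:
  assumes p: "Factorial_Ring.prime (p::nat)" and a: "\<And>i. i \<in> I \<Longrightarrow> algebraic_int (a i)"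
  shows "cong_int p ((\<Sum>i\<in>I. a i) ^ p) (\<Sum>i\<in>I. a i ^ p)"
  using a
proof (induction I rule: infinite_finite_induct)
  case (insert i I)
  have "cong_int p ((a i + (\<Sum>i\<in>I. a i)) ^ p) (a i ^ p + (\<Sum>i\<in>I. a i) ^ p)"
    using insert by (intro freshman p algebraic_int_sum) auto
  moreover have "cong_int p (a i ^ p + (\<Sum>i\<in>I. a i) ^ p) (a i ^ p + (\<Sum>i\<in>I. a i ^ p))"
    using insert by (intro cong_int_add cong_int_refl) auto
  ultimately have "cong_int p ((a i + (\<Sum>i\<in>I. a i)) ^ p) (a i ^ p + (\<Sum>i\<in>I. a i ^ p))"
    by (rule cong_int_trans)
  thus ?case using insert.hyps by simp
qed (use p prime_gt_0_nat[of p] in \<open>auto simp: cong_int_def power_0_left\<close>)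

lemma fermat_int:
  assumes p: "Factorial_Ring.prime (p::nat)" shows "[c ^ p = c] (mod int p)"
proof -
  have p0: "p > 0" using p prime_gt_0_nat by blast
  define m where "m = nat (c mod int p)"
  have cm: "[c = int m] (mod int p)" using p0 by (simp add: m_def cong_def)
  have "[m ^ p = m] (mod p)"
  proof (cases "p dvd m")
    case True
    hence "p dvd m ^ p" using p0 by (metis dvd_power dvd_trans)
    thus ?thesis using True by (simp add: cong_def dvd_eq_mod_eq_0[THEN iffD1])
  next
    case False
    have "[m * m ^ (p - 1) = m * 1] (mod p)" by (intro cong_mult cong_refl fermat_theorem p False)
    thus ?thesis using p0 by (simp add: power_eq_if)
  qed
  hence "[int m ^ p = int m] (mod int p)" by (metis cong_int_iff of_nat_power)
  thus ?thesis using cm by (meson cong_pow cong_sym cong_trans)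
qed

context number_field
begin

lemma prod_O: "(\<And>i. i \<in> I \<Longrightarrow> f i \<in> \<O>) \<Longrightarrow> prod f I \<in> \<O>"
  by (induction I rule: infinite_finite_induct) (auto intro: mult_O one_O)

text \<open>For distinct maximal ideals, product and intersection agree. The properties of the
  \<open>Q i\<close> are listed elementwise because in the application they are conjugates of one
  prime, from which they are transported by an automorphism.\<close>

lemma finprod_primes:
  assumes "finite S"
    and "\<And>i. i \<in> S \<Longrightarrow> fractional_ideal F (Q i)" "\<And>i. i \<in> S \<Longrightarrow> Q i \<subseteq> \<O>" "\<And>i. i \<in> S \<Longrightarrow> 1 \<notin> Q i"
    and "\<And>i x y. i \<in> S \<Longrightarrow> x \<in> \<O> \<Longrightarrow> y \<in> \<O> \<Longrightarrow> x * y \<in> Q i \<Longrightarrow> x \<in> Q i \<or> y \<in> Q i"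
    and "\<And>i x. i \<in> S \<Longrightarrow> x \<in> \<O> \<Longrightarrow> x \<notin> Q i \<Longrightarrow> \<exists>y\<in>\<O>. 1 - x * y \<in> Q i"
    and "\<And>i j. i \<in> S \<Longrightarrow> j \<in> S \<Longrightarrow> i \<noteq> j \<Longrightarrow> \<not> Q j \<subseteq> Q i"
  shows "finprod FI Q S = {x \<in> \<O>. \<forall>i\<in>S. x \<in> Q i}"
  using assms
proof (induction S rule: finite_induct)
  case (insert a S)
  note Q = insert.prems
  let ?D = "{x \<in> \<O>. \<forall>i\<in>S. x \<in> Q i}"
  have IH: "finprod FI Q S = ?D" 
  proof (rule insert.IH)
    fix i j x y assume i: "i \<in> S"
    show "fractional_ideal F (Q i)" "Q i \<subseteq> \<O>" "1 \<notin> Q i"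
      using i insert.prems(1,2,3)[of i] by simp_all
    show "x \<in> Q i \<or> y \<in> Q i" if "x \<in> \<O>" "y \<in> \<O>" "x * y \<in> Q i"
      using insert.prems(4)[of i x y] i that by simp
    show "\<exists>y\<in>\<O>. 1 - x * y \<in> Q i" if "x \<in> \<O>" "x \<notin> Q i"
      using insert.prems(5)[of i x] i that by simp
    show "\<not> Q j \<subseteq> Q i" if "j \<in> S" "i \<noteq> j"
      using insert.prems(6)[of i j] i that by simp
  qed
  have FIQ: "Q \<in> S \<rightarrow> carrier FI" "Q a \<in> carrier FI" using insert.prems(1) by auto
  have D: "fractional_ideal F ?D" using FI.finprod_closed[OF FIQ(1)] IH by simp
  have Qa: "fractional_ideal F (Q a)" "Q a \<subseteq> \<O>" using insert.prems(1,2) by auto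
  \<comment> \<open>A product with one factor from each of the other ideals, chosen outside
    \<open>Q a\<close>, stays outside \<open>Q a\<close> by primality.\<close>
  have "\<exists>e. e \<in> ?D \<and> e \<notin> Q a"
  proof -
    have "\<exists>e. e \<in> \<O> \<and> (\<forall>i\<in>T. e \<in> Q i) \<and> e \<notin> Q a" if "finite T" "T \<subseteq> S" for T
      using that
    proof (induction T rule: finite_induct)
      case empty
      show ?case using one_O insert.prems(3)[of a] by (intro exI[of _ 1]) auto
    next
      case (insert b T)
      then obtain e where e: "e \<in> \<O>" "\<forall>i\<in>T. e \<in> Q i" "e \<notin> Q a" by auto
      have b: "b \<in> S" "b \<noteq> a" using insert.prems \<open>a \<notin> S\<close> by auto
      then obtain y where y: "y \<in> Q b" "y \<notin> Q a" using Q(6)[of a b] by auto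
      have yO: "y \<in> \<O>" using y b Q(2)[of b] by auto
      have QF: "fractional_ideal F (Q i)" if "i \<in> S" for i
        using that Q(1) by auto
      have "e * y \<notin> Q a" using Q(4)[of a e y] e y yO by auto
      moreover have "e * y \<in> Q i" if "i \<in> Set.insert b T" for i
      proof (cases "i = b")
        case True
        thus ?thesis using frac_mult[OF QF[OF b(1)] e(1) y(1)] by simp
      next
        case False
        hence "i \<in> T" "i \<in> S" using that insert.prems by auto
        thus ?thesis using frac_mult[OF QF[of i] yO, of e] e(2) by (simp add: mult.commute)
      qed
      ultimately show ?case using mult_O[OF e(1) yO] by blast
    qed
    from this[OF insert.hyps(1) subset_refl] show ?thesis by blast
  qed
  then obtain e where e: "e \<in> ?D" "e \<notin> Q a" by blast
  then obtain y where y: "y \<in> \<O>" "1 - e * y \<in> Q a" using insert.prems(5)[of a e] by auto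
  have "finprod FI Q (Set.insert a S) = Q a \<star> ?D"
    using insert.hyps FIQ IH by simp
  also have "\<dots> = {x \<in> \<O>. \<forall>i\<in>Set.insert a S. x \<in> Q i}"
  proof
    show "Q a \<star> ?D \<subseteq> {x \<in> \<O>. \<forall>i\<in>Set.insert a S. x \<in> Q i}"
    proof (rule set_prod_subset)
      fix u v assume "u \<in> Q a" "v \<in> ?D"
      moreover from this have "u * v \<in> ?D" using frac_mult[OF D, of u v] Qa(2) by blast
      moreover have "v * u \<in> Q a" using calculation frac_mult[OF Qa(1), of v u] by blast
      ultimately show "u * v \<in> {x \<in> \<O>. \<forall>i\<in>Set.insert a S. x \<in> Q i}" by (simp add: mult.commute)
    next
      fix u v assume "u \<in> {x \<in> \<O>. \<forall>i\<in>Set.insert a S. x \<in> Q i}" "v \<in> {x \<in> \<O>. \<forall>i\<in>Set.insert a S. x \<in> Q i}"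
      thus "u + v \<in> {x \<in> \<O>. \<forall>i\<in>Set.insert a S. x \<in> Q i}"
        using insert.prems(1) by (auto intro: add_O frac_add)
    qed
    show "{x \<in> \<O>. \<forall>i\<in>Set.insert a S. x \<in> Q i} \<subseteq> Q a \<star> ?D"
    proof
      fix x assume x: "x \<in> {x \<in> \<O>. \<forall>i\<in>Set.insert a S. x \<in> Q i}"
      \<comment> \<open>Split \<open>x = (1 - e * y) * x + x * (y * e)\<close>: in the first term
        \<open>1 - e * y\<close> lies in \<open>Q a\<close> and \<open>x\<close> in the intersection
        of the others; in the second the roles are exchanged.\<close>
      have "(1 - e * y) * x \<in> Q a \<star> ?D" using x y by (intro set_prodI) auto
      moreover have "y * e \<in> ?D" by (rule frac_mult[OF D y(1) e(1)])
      hence "x * (y * e) \<in> Q a \<star> ?D" using x by (intro set_prodI) auto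
      ultimately have "(1 - e * y) * x + x * (y * e) \<in> Q a \<star> ?D" by (rule set_prod_add)
      thus "x \<in> Q a \<star> ?D" by (simp add: algebra_simps)
    qed
  qed
  finally show ?case .
qed (simp add: integers_of_def)

end

context cyclotomic_5_mod_8
begin

text \<open>A fixed choice of spanning sets, so that both fields become instances of
  \<open>number_field\<close>.\<close>

definition BL :: "complex set" where "BL = (SOME B. number_field L B (sig ` {1..<l}))"
definition BK :: "complex set" where "BK = (SOME B. number_field K B (sig ` {1..<l}))"

sublocale L: number_field L BL "sig ` {1..<l}"
  unfolding BL_def by (rule someI_ex[OF number_field_L])

sublocale K: number_field K BK "sig ` {1..<l}"
  unfolding BK_def by (rule someI_ex[OF number_field_K])

lemma L_E: "x \<in> L \<Longrightarrow> x \<in> E" using Fix_subset by (auto simp: L_def)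

lemma sig_L: "x \<in> L \<Longrightarrow> \<not> l dvd a \<Longrightarrow> sig a x \<in> L" by (simp add: L_def Fix_sig)

lemma sig_OL: "x \<in> L.\<O> \<Longrightarrow> \<not> l dvd a \<Longrightarrow> sig a x \<in> L.\<O>"
  using L.O_F L.O_int L_E sig_int sig_L by (blast intro: L.OI)

lemma sig_neg: "x \<in> L \<Longrightarrow> \<not> l dvd a \<Longrightarrow> sig ((l - 1) * a) x = sig a x"
proof -
  assume x: "x \<in> L" and a: "\<not> l dvd a"
  have "sig (a * (l - 1)) x = sig a (sig (l - 1) x)" using x a l_minus_1 L_E by (simp add: sig_sig)
  also have "\<dots> = sig a x" using x l_minus_1 by (simp add: L_def Fix_def)
  finally show ?thesis by (simp add: mult.commute)
qed

lemma sig_inverse: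
  assumes "x \<in> L" "\<not> l dvd a" "\<not> l dvd b" "[a * b = 1] (mod l)" shows "sig a (sig b x) = x"
  using assms sig_one[OF assms(4)] L_E by (simp add: sig_sig)

text \<open>A test element of \<open>L\<close>: by \<open>theta_conj_cong\<close> its conjugates
  tell the automorphisms of \<open>L\<close> apart, even modulo the primes considered below.\<close>

definition \<theta> :: complex where "\<theta> = \<zeta> + \<zeta> ^ (l - 1)"

lemma theta_E: "\<theta> \<in> E" unfolding \<theta>_def using E_zeta_pow[of 1] by (intro E_add E_zeta_pow) auto

lemma sig_theta: "\<not> l dvd a \<Longrightarrow> sig a \<theta> = \<zeta> ^ a + \<zeta> ^ ((l - 1) * a)"
  unfolding \<theta>_def using sig_zeta_pow[of a 1] E_zeta_pow[of 1]
  by (subst sig_add) (auto simp: E_zeta_pow sig_zeta_pow mult.commute)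

lemma theta_OL: "\<theta> \<in> L.\<O>"
proof (rule L.OI)
  have "sig (l - 1) \<theta> = \<zeta> ^ (l - 1) + \<zeta>"
    using sig_theta[OF l_minus_1] zeta_pow_cong[OF minus_1_square[of 1]] by simp
  thus "\<theta> \<in> L" using theta_E by (simp add: L_def Fix_def \<theta>_def add.commute)
  show "algebraic_int \<theta>" unfolding \<theta>_def by (intro algebraic_int_add alg_zeta alg_zeta_pow)
qed

text \<open>In \<int>[\<zeta>] the \<open>p\<close>-th power acts modulo \<open>p\<close> on each
  term \<open>c j * \<zeta> ^ j\<close> separately and fixes the coefficients by Fermat. The
  congruence therefore holds modulo \<open>p\<close> itself, not merely modulo one prime above
  it.\<close>

lemma frobenius:
  assumes p: "Factorial_Ring.prime (p::nat)" "p \<noteq> l" and x: "x \<in> L.\<O>"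
  shows "cong_int p (sig p x) (x ^ p)"
proof -
  have lp: "\<not> l dvd p" using primes_dvd_imp_eq[OF prime_l p(1)] p(2) by auto
  have p0: "p > 0" using p prime_gt_0_nat by blast
  obtain c :: "nat \<Rightarrow> int" where c: "x = (\<Sum>j<l - 1. of_int (c j) * \<zeta> ^ j)"
    using integers_E[of x] x L.O_F L.O_int L_E by blast
  have "sig p x = (\<Sum>j<l - 1. of_int (c j) * \<zeta> ^ (p * j))"
    unfolding c using lp by (subst sig_sum) (auto simp: sig_mult sig_rat sig_zeta_pow E_rat E_zeta_pow intro!: E_mult)
  moreover have "cong_int p (\<Sum>j<l - 1. of_int (c j) * \<zeta> ^ (p * j)) (\<Sum>j<l - 1. (of_int (c j) * \<zeta> ^ j) ^ p)"
  proof -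
    have "\<exists>k. c j - c j ^ p = int p * k" for j
      using fermat_int[OF p(1), of "c j"] by (metis cong_iff_dvd_diff cong_sym dvd_def)
    then obtain k where k: "\<And>j. c j - c j ^ p = int p * k j" by metis
    have "((\<Sum>j<l - 1. of_int (c j) * \<zeta> ^ (p * j)) - (\<Sum>j<l - 1. (of_int (c j) * \<zeta> ^ j) ^ p))
        = (\<Sum>j<l - 1. of_int (c j - c j ^ p) * \<zeta> ^ (p * j))"
      by (simp add: power_mult_distrib left_diff_distrib sum_subtractf mult.commute[of p] power_mult)
    also have "\<dots> = of_nat p * (\<Sum>j<l - 1. of_int (k j) * \<zeta> ^ (p * j))"
      unfolding k by (simp add: sum_distrib_left mult.assoc)
    finally show ?thesis unfolding cong_int_def using p0
      by (auto intro!: algebraic_int_sum algebraic_int_mult alg_zeta_pow)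
  qed
  moreover have "cong_int p (x ^ p) (\<Sum>j<l - 1. (of_int (c j) * \<zeta> ^ j) ^ p)"
    unfolding c by (intro freshman_sum p algebraic_int_mult alg_zeta_pow) simp
  ultimately show ?thesis using cong_int_trans cong_int_sym by metis
qed

text \<open>The cofactor \<open>w\<close> is the product of the other conjugates; it serves to find
  rational integers in ideals and to divide modulo \<open>p\<close>.\<close>

lemma conj_prod_factor:
  assumes x: "x \<in> L.\<O>"
  obtains w N where "w \<in> L.\<O>" "nrm x = x * w" "nrm x = of_int N"
proof -
  define w where "w = (\<Prod>a\<in>{2..<l}. sig a x)"
  have xE: "x \<in> E" using x L.O_F L_E by blast
  have u: "\<not> l dvd a" if "a \<in> {2..<l}" for a using that not_dvd_unit[of a] by auto
  have "w \<in> L.\<O>" unfolding w_def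
    using x u sig_OL by (intro L.prod_O) auto
  moreover have "{1..<l} = Set.insert 1 {2..<l}" using l_gt_2 by auto
  hence "nrm x = x * w" using xE by (simp add: nrm_def w_def sig_id[simplified])
  moreover have "nrm x \<in> \<int>" 
    using nrm_rat[OF xE] x calculation L.O_int by (intro rational_algebraic_int_is_int) (auto intro: algebraic_int_mult)
  ultimately show ?thesis using that by (auto elim: Ints_cases)
qed

end

subsection \<open>Primes of residue degree two\<close>

context cyclotomic_5_mod_8
begin

lemma zeta_pow_minus: "\<zeta> ^ x * \<zeta> ^ ((l - 1) * x) = 1"
proof -
  have "\<zeta> ^ x * \<zeta> ^ ((l - 1) * x) = \<zeta> ^ (l * x)"
    using l0 by (simp add: diff_mult_distrib flip: power_add)
  thus ?thesis by (simp add: power_mult zeta_l)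
qed

text \<open>A difference of two conjugates of \<theta> is a unit times two factors of the form
  \<open>1 - \<zeta> ^ m\<close>, so only \<open>l\<close> can enter it.\<close>

lemma sig_theta_factor:
  "(\<zeta> ^ a + \<zeta> ^ ((l - 1) * a)) - (\<zeta> ^ b + \<zeta> ^ ((l - 1) * b))
     = - (\<zeta> ^ b * (1 - \<zeta> ^ (a + (l - 1) * b)) * (1 - \<zeta> ^ ((l - 1) * (a + b))))"
proof -
  define A A' B B' where "A = \<zeta> ^ a" "A' = \<zeta> ^ ((l - 1) * a)" "B = \<zeta> ^ b" "B' = \<zeta> ^ ((l - 1) * b)"
  have AB: "A * A' = 1" "B * B' = 1" using zeta_pow_minus by (simp_all add: A_A'_B_B'_def)
  have "\<zeta> ^ (a + (l - 1) * b) = A * B'" by (simp add: A_A'_B_B'_def power_add)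
  moreover have "\<zeta> ^ ((l - 1) * (a + b)) = A' * B'" by (simp add: A_A'_B_B'_def power_add add_mult_distrib2)
  moreover have "A + A' - (B + B') = - (B * (1 - A * B') * (1 - A' * B'))"
  proof -
    have "B * (1 - A * B') * (1 - A' * B') = B - (B * B') * A' - (B * B') * A + (A * A') * (B * B') * B'"
      by (simp add: algebra_simps)
    thus ?thesis unfolding AB by simp
  qed
  ultimately show ?thesis by (simp add: A_A'_B_B'_def)
qed

context
  fixes P and p :: nat
  assumes P: "P \<in> primes_of L" and p: "Factorial_Ring.prime p" "of_nat p \<in> P"
    and deg: "residue_degree L \<rat> P = 2"
begin

lemma of_nat_mult_P:
  assumes "p' > 0" "of_nat p' \<in> P" "x \<in> L" "algebraic_int (x / of_nat p')" shows "x \<in> P"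
  using L.of_nat_mult_subset[OF L.prime_frac[OF P] assms(2,3,4,1)] .

text \<open>Modulo a prime above \<open>l\<close> one has \<zeta> = 1, so every integer is congruent
  to its coefficient sum and the residue degree would be one.\<close>

lemma p_ne_l: "p \<noteq> l"
proof
  assume eq: "p = l"
  have "\<exists>c. x - of_int c \<in> P" if x: "x \<in> L.\<O>" for x
  proof -
    obtain c :: "nat \<Rightarrow> int" where c: "x = (\<Sum>j<l - 1. of_int (c j) * \<zeta> ^ j)"
      using integers_E[of x] x L.O_F L.O_int L_E by blast
    define s where "s = (\<Sum>j<l - 1. c j)"
    define w where "w = - (\<Sum>j<l - 1. of_int (c j) * (\<Sum>i<j. \<zeta> ^ i))"
    have "x - of_int s = (\<Sum>j<l - 1. of_int (c j) * (\<zeta> ^ j - 1))"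
      unfolding c s_def by (simp add: right_diff_distrib sum_subtractf)
    also have "\<dots> = (\<Sum>j<l - 1. - (\<pi> * (of_int (c j) * (\<Sum>i<j. \<zeta> ^ i))))"
      by (intro sum.cong refl) (simp add: \<pi>_def power_diff_1_eq algebra_simps)
    also have "\<dots> = \<pi> * w" unfolding w_def by (simp add: sum_negf sum_distrib_left)
    finally have xs: "x - of_int s = \<pi> * w" .
    have w: "algebraic_int w" unfolding w_def
      by (auto intro!: algebraic_int_sum algebraic_int_mult alg_zeta_pow)
    \<comment> \<open>\<pi> does not lie in \<open>L\<close>; the power \<open>l - 1\<close>
      replaces it by the rational integer \<open>l\<close>, and primality of \<open>P\<close> undoes
      the power.\<close>
    have "(x - of_int s) ^ (l - 1) / of_nat l = \<pi> ^ (l - 1) / of_nat l * w ^ (l - 1)"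
      by (simp add: xs power_mult_distrib)
    also have "algebraic_int \<dots>" by (intro algebraic_int_mult pi_pow_div_l algebraic_int_power w)
    finally have ai: "algebraic_int ((x - of_int s) ^ (l - 1) / of_nat l)" .
    have xO: "x - of_int s \<in> L.\<O>" by (intro L.diff_O x L.of_int_O)
    have "(x - of_int s) ^ (l - 1) \<in> P"
      by (rule of_nat_mult_P[OF l0 _ L.power_F[OF L.O_F[OF xO]] ai]) (use p eq in simp)
    thus ?thesis using L.prime_power[OF P xO] by blast
  qed
  thus False using L.residue_degree_2(1)[OF P p deg] by blast
qed

lemma not_l_dvd_p: "\<not> l dvd p"
  using primes_dvd_imp_eq[OF prime_l p(1)] p_ne_l by auto

lemma p_pos: "p > 0" using p(1) prime_gt_0_nat by blast

lemma l_notin_P: "of_nat l \<notin> P"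
proof
  assume "of_nat l \<in> P"
  hence "of_int (int l) \<in> P" by simp
  hence "int p dvd int l" by (simp only: L.prime_int_iff[OF P p])
  hence "p dvd l" by simp
  thus False using primes_dvd_imp_eq[OF p(1) prime_l] p_ne_l by auto
qed

lemma frobenius_P:
  assumes x: "x \<in> L.\<O>" shows "sig p x - x ^ p \<in> P"
proof -
  have "sig p x - x ^ p \<in> L" by (intro L.diff_F L.power_F L.O_F sig_OL x not_l_dvd_p)
  from of_nat_mult_P[OF p_pos p(2) this] show ?thesis
    using frobenius[OF p(1) p_ne_l x] by (simp add: cong_int_def)
qed

text \<open>Frobenius lies in the decomposition group of \<open>P\<close>.\<close>

lemma sig_p_P: assumes "x \<in> P" shows "sig p x \<in> P"
proof -
  have "x ^ p = x ^ (p - 1) * x" using p_pos by (simp add: power_eq_if mult.commute)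
  hence "x ^ p \<in> P" using L.prime_mult[OF P _ assms] L.power_O L.prime_subset[OF P assms] by simp
  from L.prime_add[OF P frobenius_P[OF L.prime_subset[OF P assms]] this] show ?thesis by simp
qed

lemma sig_p_P_cancel: assumes "x \<in> L.\<O>" "sig p x \<in> P" shows "x \<in> P"
proof -
  have "sig p x - (sig p x - x ^ p) \<in> P" by (intro L.prime_diff[OF P] assms(2) frobenius_P assms(1))
  thus ?thesis using L.prime_power[OF P assms(1), of p] by simp
qed

text \<open>Otherwise \<open>sig_theta_factor\<close> writes the difference as a unit times two
  factors that divide \<open>l\<close>; it then divides \<open>l * l\<close>, and \<open>P\<close>
  would contain \<open>l\<close>.\<close>

lemma theta_conj_cong:
  assumes "\<not> l dvd a" "\<not> l dvd b" "sig a \<theta> - sig b \<theta> \<in> P"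
  shows "[a = b] (mod l) \<or> [a = (l - 1) * b] (mod l)"
proof (rule ccontr)
  assume contra: "\<not> ?thesis"
  have 1: "\<not> l dvd a + (l - 1) * b"
  proof
    assume d: "l dvd a + (l - 1) * b"
    have "a + l * b = (a + (l - 1) * b) + b" using l0 by (cases l) auto
    hence "(a + l * b) mod l = ((a + (l - 1) * b) mod l + b) mod l" by (metis mod_add_left_eq)
    hence "[a = b] (mod l)" using d by (simp add: cong_def dvd_eq_mod_eq_0)
    thus False using contra by simp
  qed
  have 2: "\<not> l dvd (l - 1) * (a + b)"
  proof
    assume "l dvd (l - 1) * (a + b)"
    hence d: "l dvd a + b" using l_minus_1 prime_l prime_dvd_mult_nat by blast
    have "a + l * b = (a + b) + (l - 1) * b" using l0 by (cases l) auto
    hence "(a + l * b) mod l = ((a + b) mod l + (l - 1) * b) mod l" by (metis mod_add_left_eq)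
    hence "[a = (l - 1) * b] (mod l)" using d by (simp add: cong_def dvd_eq_mod_eq_0)
    thus False using contra by simp
  qed
  define u v where "u = 1 - \<zeta> ^ (a + (l - 1) * b)" "v = 1 - \<zeta> ^ ((l - 1) * (a + b))"
  define e where "e = sig a \<theta> - sig b \<theta>"
  have e: "e = - (\<zeta> ^ b * u * v)"
    unfolding e_def u_v_def sig_theta[OF assms(1)] sig_theta[OF assms(2)] by (rule sig_theta_factor)
  have uv: "u \<noteq> 0" "v \<noteq> 0" using 1 2 by (auto simp: u_v_def zeta_pow_eq_1_iff[symmetric])
  define y where "y = of_nat l * of_nat l / e"
  have e0: "e \<noteq> 0" using uv zeta_ne_0 by (simp add: e)
  have y: "y = - (\<zeta> ^ ((l - 1) * b) * (of_nat l / u) * (of_nat l / v))"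
    unfolding y_def e using uv zeta_ne_0 zeta_pow_minus[of b] by (simp add: field_simps)
  have "algebraic_int (of_nat l / u)" "algebraic_int (of_nat l / v)"
    unfolding u_v_def using 1 2 by (auto intro: l_div_one_minus_zeta_pow)
  hence "algebraic_int y" unfolding y by (intro algebraic_int_minus algebraic_int_mult alg_zeta_pow)
  moreover have "e \<in> L.\<O>" unfolding e_def by (intro L.diff_O sig_OL theta_OL assms)
  hence "y \<in> L" unfolding y_def by (intro L.divide_F L.mult_F L.of_nat_F L.O_F)
  ultimately have "y \<in> L.\<O>" by (intro L.OI)
  hence "y * e \<in> P" using assms(3) by (intro L.prime_mult[OF P]) (auto simp: e_def)
  hence "of_nat l * of_nat l \<in> P" using e0 by (simp add: y_def)
  thus False using L.prime_prime[OF P] L.of_nat_O l_notin_P by blast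
qed

text \<open>Automorphisms stabilising \<open>P\<close> send \<theta> to roots modulo
  \<open>P\<close> of one quadratic congruence with rational coefficients, which cannot have three
  incongruent roots. This bounds the decomposition group by the residue degree.\<close>

lemma stabilizer_theta:
  assumes d: "\<not> l dvd d" "\<And>x. x \<in> P \<Longrightarrow> sig d x \<in> P"
    and e: "\<not> l dvd e" "\<And>x. x \<in> P \<Longrightarrow> sig e x \<in> P"
  shows "\<theta> - sig d \<theta> \<in> P \<or> \<theta> - sig e \<theta> \<in> P \<or> sig d \<theta> - sig e \<theta> \<in> P"
proof (rule ccontr)
  assume contra: "\<not> ?thesis"
  obtain a b c where abc: "\<not> (of_int a \<in> P \<and> of_int b \<in> P \<and> of_int c \<in> P)"
    "of_int a * \<theta> ^ 2 + of_int b * \<theta> + of_int c \<in> P"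
    using L.residue_degree_2(2)[OF P p deg theta_OL] by blast
  define f where "f = [:of_int c, of_int b, of_int a :: complex:]"
  have f: "poly f x = of_int a * x ^ 2 + of_int b * x + of_int c" for x
    by (simp add: f_def power2_eq_square algebra_simps)
  have conj: "poly f (sig g \<theta>) \<in> P" if g: "\<not> l dvd g" "\<And>x. x \<in> P \<Longrightarrow> sig g x \<in> P" for g
  proof -
    have "sig g (poly f \<theta>) = poly f (sig g \<theta>)"
      unfolding f power2_eq_square using g(1) theta_E
      by (simp add: sig_add sig_mult sig_rat E_add E_mult E_rat)
    thus ?thesis using g(2)[of "poly f \<theta>"] abc(2) by (simp add: f)
  qed
  define T where "T = {\<theta>, sig d \<theta>, sig e \<theta>}"
  have neg: "y - x \<in> P \<Longrightarrow> x - y \<in> P" for x y using L.prime_uminus[OF P, of "y - x"] by simp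
  have inc: "\<theta> - sig d \<theta> \<notin> P" "\<theta> - sig e \<theta> \<notin> P" "sig d \<theta> - sig e \<theta> \<notin> P"
     "sig d \<theta> - \<theta> \<notin> P" "sig e \<theta> - \<theta> \<notin> P" "sig e \<theta> - sig d \<theta> \<notin> P"
    using contra neg by auto
  have z: "(0::complex) \<in> P" by (rule L.prime_zero[OF P])
  have ne: "\<theta> \<noteq> sig d \<theta>" "\<theta> \<noteq> sig e \<theta>" "sig d \<theta> \<noteq> sig e \<theta>" using inc(1-3) z by auto
  have TO: "T \<subseteq> L.\<O>" using theta_OL sig_OL d e by (auto simp: T_def)
  have fO: "coeff f i \<in> L.\<O>" for i
    by (auto simp: f_def coeff_pCons L.of_int_O L.zero_O split: nat.splits)
  have cT: "card T = 3" using ne by (simp add: T_def)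
  have "degree f \<le> 2" by (simp add: f_def)
  hence coef: "coeff f i \<in> P" for i
  proof (intro L.prime_few_roots[OF P fO _ _ TO])
    show "poly f x \<in> P" if "x \<in> T" for x
      using that abc(2) conj[OF d] conj[OF e] by (auto simp: T_def f)
    show "x - y \<notin> P" if "x \<in> T" "y \<in> T" "x \<noteq> y" for x y
      using that inc by (auto simp: T_def)
    show "degree f < card T" using \<open>degree f \<le> 2\<close> cT by simp
    show "finite T" by (simp add: T_def)
  qed
  have "of_int c \<in> P" "of_int b \<in> P" "of_int a \<in> P"
    using coef[of 0] coef[of 1] coef[of 2] by (simp_all add: f_def numeral_2_eq_2)
  thus False using abc(1) by blast
qed

text \<open>A Frobenius that fixes \<theta> modulo \<open>P\<close> is trivial on \<open>L\<close>.
  Then \<open>x ^ p\<close> is congruent to \<open>x\<close> for all integers \<open>x\<close>, and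
  as \<open>X ^ p - X\<close> has no roots modulo \<open>P\<close> besides 0, ..., p - 1, the
  residue degree would be one.\<close>

lemma frobenius_nontrivial: "\<theta> - sig p \<theta> \<notin> P"
proof
  assume "\<theta> - sig p \<theta> \<in> P"
  hence "sig 1 \<theta> - sig p \<theta> \<in> P" using sig_id[OF theta_E] by simp
  hence "[1 = p] (mod l) \<or> [1 = (l - 1) * p] (mod l)"
    using l_gt_2 not_l_dvd_p by (intro theta_conj_cong) auto
  hence id: "sig p x = x" if x: "x \<in> L" for x
  proof
    assume "[1 = p] (mod l)"
    thus ?thesis using x L_E sig_one cong_sym by blast
  next
    assume "[1 = (l - 1) * p] (mod l)"
    hence "sig ((l - 1) * p) x = x" using x L_E sig_one cong_sym by blast
    thus ?thesis using sig_neg[OF x not_l_dvd_p] by simp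
  qed
  have "\<exists>c. x - of_int c \<in> P" if x: "x \<in> L.\<O>" for x
  proof (rule ccontr)
    assume contra: "\<not> ?thesis"
    define f :: "complex poly" where "f = monom 1 p - monom 1 1"
    define T where "T = Set.insert x (of_nat ` {..<p})"
    have p1: "p > 1" using p(1) prime_gt_1_nat by blast
    have xn: "x - of_nat i \<notin> P" for i using contra by (metis of_int_of_nat_eq)
    hence xn': "of_nat i - x \<notin> P" for i using L.prime_uminus[OF P, of "of_nat i - x"] by auto
    have "x \<noteq> of_nat i" for i using xn[of i] L.prime_zero[OF P] by auto
    hence "x \<notin> of_nat ` {..<p}" by auto
    moreover have "card (of_nat ` {..<p} :: complex set) = p" by (simp add: card_image inj_on_def)
    ultimately have cT: "card T = p + 1" by (simp add: T_def)
    have "degree f \<le> p" unfolding f_def using p1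
      by (intro degree_diff_le) (auto simp: degree_monom_eq)
    hence "coeff f p \<in> P"
    proof (intro L.prime_few_roots[OF P])
      show "coeff f i \<in> L.\<O>" for i by (auto simp: f_def L.one_O L.zero_O L.diff_O L.uminus_O)
      show "T \<subseteq> L.\<O>" using x L.of_nat_O by (auto simp: T_def)
      show "poly f y \<in> P" if "y \<in> T" for y
      proof -
        have yO: "y \<in> L.\<O>" using that x L.of_nat_O by (auto simp: T_def)
        have "- (sig p y - y ^ p) \<in> P" by (intro L.prime_uminus[OF P] frobenius_P yO)
        thus ?thesis using id[OF L.O_F[OF yO]] by (simp add: f_def poly_monom)
      qed
      show "u - v \<notin> P" if "u \<in> T" "v \<in> T" "u \<noteq> v" for u v
      proof -
        have *: "of_nat i - of_nat j \<notin> P" if "i < p" "j < p" "i \<noteq> j" for i j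
        proof
          assume "of_nat i - of_nat j \<in> P"
          hence "of_int (int i - int j) \<in> P" by simp
          hence "int p dvd int i - int j" by (simp only: L.prime_int_iff[OF P p])
          hence "[i = j] (mod p)" by (simp add: cong_iff_dvd_diff flip: cong_int_iff)
          thus False using that by (simp add: cong_def)
        qed
        thus ?thesis using that xn xn' by (auto simp: T_def)
      qed
    qed (auto simp: T_def cT[unfolded T_def])
    moreover have "coeff f p = 1" using p1 by (simp add: f_def)
    ultimately show False using L.prime_not_one[OF P] by simp
  qed
  thus False using L.residue_degree_2(1)[OF P p deg] by blast
qed

text \<open>\<open>stabilizer_theta\<close> for \<open>p\<close> and \<open>p * p\<close> leaves
  only the case that the square of Frobenius is trivial on \<open>L\<close>, so \<open>p * p\<close>
  is 1 or -1 modulo \<open>l\<close>. The value 1 would make \<open>p\<close> congruent to 1 or -1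
  and Frobenius trivial.\<close>

lemma p_square: "[p * p = l - 1] (mod l)"
proof -
  have pp: "\<not> l dvd p * p" by (rule not_dvd_mult[OF not_l_dvd_p not_l_dvd_p])
  have spp: "sig (p * p) x = sig p (sig p x)" if "x \<in> L" for x
    using that L_E not_l_dvd_p by (simp add: sig_sig)
  have "\<theta> - sig p \<theta> \<in> P \<or> \<theta> - sig (p * p) \<theta> \<in> P \<or> sig p \<theta> - sig (p * p) \<theta> \<in> P"
    using not_l_dvd_p pp sig_p_P spp L.prime_subset[OF P] L.O_F by (intro stabilizer_theta) auto
  \<comment> \<open>Cancelling \<open>sig p\<close> reduces this case to the nontriviality of
    Frobenius.\<close>
  moreover have "sig p \<theta> - sig (p * p) \<theta> \<notin> P"
  proof
    assume "sig p \<theta> - sig (p * p) \<theta> \<in> P"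
    hence "sig p (\<theta> - sig p \<theta>) \<in> P"
      using spp[OF L.O_F[OF theta_OL]] not_l_dvd_p theta_E by (simp add: sig_diff sig_E)
    moreover have "\<theta> - sig p \<theta> \<in> L.\<O>" by (intro L.diff_O theta_OL sig_OL not_l_dvd_p)
    ultimately show False using sig_p_P_cancel frobenius_nontrivial by blast
  qed
  ultimately have "sig 1 \<theta> - sig (p * p) \<theta> \<in> P"
    using frobenius_nontrivial sig_id[OF theta_E] by simp
  hence "[1 = p * p] (mod l) \<or> [1 = (l - 1) * (p * p)] (mod l)"
    using l_gt_2 pp by (intro theta_conj_cong) auto
  moreover have "\<not> [1 = p * p] (mod l)"
  proof
    assume "[1 = p * p] (mod l)"
    hence "[int (p * p) = 1] (mod int l)" by (metis cong_nat_1 cong_sym)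
    hence "int l dvd int p * int p - 1" by (simp add: cong_iff_dvd_diff)
    also have "int p * int p - 1 = (int p - 1) * (int p + 1)" by (simp add: algebra_simps)
    finally have "int l dvd int p - 1 \<or> int l dvd int p + 1" using prime_l by (simp add: prime_dvd_mult_iff)
    hence "\<theta> - sig p \<theta> \<in> P"
    proof
      assume "int l dvd int p - 1"
      hence "[int p = 1] (mod int l)" by (simp add: cong_iff_dvd_diff)
      hence "[p = 1] (mod l)" by (simp only: cong_nat_1)
      thus ?thesis using sig_one[OF _ theta_E] L.prime_zero[OF P] by simp
    next
      assume "int l dvd int p + 1"
      hence "l dvd p + 1" by (metis int_dvd_int_iff of_nat_1 of_nat_add)
      hence "(p + 1) mod l = 0" by simp
      have "(l - 1) * p + (p + 1) = l * p + 1" using l0 by (cases l) auto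
      hence "((l - 1) * p + (p + 1) mod l) mod l = (l * p + 1) mod l" by (simp add: mod_add_right_eq)
      also have "(l * p + 1) mod l = 1 mod l" using mod_mult_self2[of 1 l p] by (simp only: add.commute)
      finally have "[(l - 1) * p = 1] (mod l)" using \<open>(p + 1) mod l = 0\<close> by (simp add: cong_def)
      hence "sig ((l - 1) * p) \<theta> = \<theta>" using sig_one theta_E by blast
      thus ?thesis using sig_neg[OF L.O_F[OF theta_OL] not_l_dvd_p] L.prime_zero[OF P] by simp
    qed
    thus False using frobenius_nontrivial by simp
  qed
  ultimately have "[1 = (l - 1) * (p * p)] (mod l)" by simp
  hence "[(l - 1) * 1 = (l - 1) * ((l - 1) * (p * p))] (mod l)" by (intro cong_mult cong_refl)
  thus ?thesis using minus_1_square[of "p * p"] by (metis cong_sym cong_trans mult.right_neutral)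
qed

lemma chi_p: "chi p = -1" by (rule chi_sqrt_minus_1[OF p_square])

text \<open>The identity and Frobenius already give the two possible conjugates of \<theta> modulo
  \<open>P\<close> under the stabiliser. A square \<open>d\<close> cannot act as Frobenius because
  \<open>chi p = -1\<close>, so it acts as the identity.\<close>

lemma stabilizer_trivial:
  assumes d: "\<not> l dvd d" "\<And>x. x \<in> P \<Longrightarrow> sig d x \<in> P" "chi d = 1"
  shows "[d = 1] (mod l) \<or> [d = l - 1] (mod l)"
proof -
  have "\<theta> - sig p \<theta> \<in> P \<or> \<theta> - sig d \<theta> \<in> P \<or> sig p \<theta> - sig d \<theta> \<in> P"
    using not_l_dvd_p sig_p_P d by (intro stabilizer_theta) auto
  moreover have "sig p \<theta> - sig d \<theta> \<notin> P"
  proof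
    assume "sig p \<theta> - sig d \<theta> \<in> P"
    hence "[p = d] (mod l) \<or> [p = (l - 1) * d] (mod l)" using not_l_dvd_p d by (intro theta_conj_cong) auto
    hence "chi p = chi d \<or> chi p = chi ((l - 1) * d)" using chi_congr by blast
    thus False using chi_p d chi_mult[OF l_minus_1 d(1)] chi_minus_1 by auto
  qed
  ultimately have "\<theta> - sig d \<theta> \<in> P" using frobenius_nontrivial by blast
  hence "- (\<theta> - sig d \<theta>) \<in> P" by (rule L.prime_uminus[OF P])
  hence "sig d \<theta> - sig 1 \<theta> \<in> P" using sig_id[OF theta_E] by simp
  hence "[d = 1] (mod l) \<or> [d = (l - 1) * 1] (mod l)"
    using l_gt_2 d by (intro theta_conj_cong) auto
  thus ?thesis by simp
qed

text \<open>Frobenius has order four on \<open>E\<close>, so modulo \<open>p\<close> the element \<open>e = x ^ (p ^ 4 - 1)\<close> satisfies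
  \<open>x * e = x\<close>, while the norm of \<open>1 - e\<close> is congruent to \<open>1\<close>.\<close>

lemma conjugates_in_prime:
  assumes x: "x \<in> L.\<O>" and conj: "\<And>c. \<not> l dvd c \<Longrightarrow> sig c x \<in> P"
  shows "algebraic_int (x / of_nat p)"
proof -
  have lp: "\<not> l dvd p ^ k" for k using not_l_dvd_p prime_l prime_dvd_power_nat by blast
  have iter: "cong_int p (sig (p ^ k) x) (x ^ (p ^ k))" for k
  proof (induction k)
    case 0
    show ?case using sig_id L_E L.O_F[OF x] by (simp add: cong_int_refl)
  next
    case (Suc k)
    have s: "sig (p ^ k) x \<in> L.\<O>" by (rule sig_OL[OF x lp])
    have "sig (p ^ Suc k) x = sig p (sig (p ^ k) x)"
      using lp not_l_dvd_p L_E L.O_F[OF x] by (simp add: sig_sig)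
    hence "cong_int p (sig (p ^ Suc k) x) (sig (p ^ k) x ^ p)" using frobenius[OF p(1) p_ne_l s] by simp
    moreover have "cong_int p (sig (p ^ k) x ^ p) ((x ^ (p ^ k)) ^ p)"
      using Suc s x L.O_int by (intro cong_int_power algebraic_int_power) auto
    ultimately show ?case by (metis cong_int_trans power_Suc2 power_mult)
  qed
  have "[p ^ 4 = 1] (mod l)"
  proof -
    have "p ^ 4 = (p * p) * (p * p)" by (simp add: power4_eq_xxxx)
    moreover have "[(p * p) * (p * p) = (l - 1) * (l - 1)] (mod l)" by (intro cong_mult p_square)
    moreover have "[(l - 1) * ((l - 1) * 1) = 1] (mod l)" by (rule minus_1_square)
    ultimately show ?thesis by (metis cong_trans mult.right_neutral)
  qed
  hence "sig (p ^ 4) x = x" using sig_one L_E L.O_F[OF x] by blast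
  hence xe: "cong_int p x (x ^ (p ^ 4))" using iter[of 4] by simp
  define e where "e = x ^ (p ^ 4 - 1)"
  have p1: "p > 1" using p(1) prime_gt_1_nat by blast
  hence "p ^ 4 > 1" by (intro one_less_power) auto
  \<comment> \<open>\<open>m\<close> exhibits a factor \<open>x\<close> in \<open>e\<close>, which
    puts all conjugates of \<open>e\<close> into \<open>P\<close>.\<close>
  define m where "m = p ^ 4 - 2"
  have "p ^ 4 = Suc (Suc m)" using \<open>p ^ 4 > 1\<close> by (simp add: m_def)
  hence xpe: "x ^ (p ^ 4) = x * e" "e = x ^ m * x" unfolding e_def by simp_all
  have eO: "e \<in> L.\<O>" unfolding e_def by (rule L.power_O[OF x])
  have conj_e: "sig c e \<in> P" if "\<not> l dvd c" for c
  proof -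
    have "sig c e = sig c (x ^ m) * sig c x"
      unfolding xpe(2) using that L_E L.O_F x L.power_F by (simp add: sig_mult)
    thus ?thesis using conj[OF that] L.prime_mult[OF P] sig_OL[OF L.power_O[OF x] that] by simp
  qed
  have e1: "1 - e \<in> L.\<O>" by (intro L.diff_O L.one_O eO)
  obtain w N where w: "w \<in> L.\<O>" "nrm (1 - e) = (1 - e) * w" "nrm (1 - e) = of_int N"
    using conj_prod_factor[OF e1] by blast
  have "(\<Prod>c\<in>T. 1 - sig c e) - 1 \<in> P" if "T \<subseteq> {1..<l}" "finite T" for T
    using that(2,1)
  proof (induction T rule: finite_induct)
    case empty
    show ?case using L.prime_zero[OF P] by simp
  next
    case (insert c T)
    have c: "\<not> l dvd c" using insert.prems not_dvd_unit by auto
    have IH: "(\<Prod>c\<in>T. 1 - sig c e) - 1 \<in> P" using insert by auto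
    have "(\<Prod>c\<in>Set.insert c T. 1 - sig c e) - 1
        = (1 - sig c e) * ((\<Prod>c\<in>T. 1 - sig c e) - 1) + - sig c e"
      using insert.hyps by (simp add: algebra_simps)
    also have "\<dots> \<in> P"
      by (intro L.prime_add[OF P] L.prime_mult[OF P] L.prime_uminus[OF P] IH conj_e c L.diff_O L.one_O sig_OL eO)
    finally show ?case .
  qed
  hence "(\<Prod>c\<in>{1..<l}. 1 - sig c e) - 1 \<in> P" by blast
  moreover have "nrm (1 - e) = (\<Prod>c\<in>{1..<l}. 1 - sig c e)"
    unfolding nrm_def using not_dvd_unit L_E[OF L.O_F[OF eO]]
    by (intro prod.cong refl) (auto simp: sig_diff E_rat)
  ultimately have "of_int (N - 1) \<in> P" using w(3) by simp
  hence "int p dvd N - 1" by (simp only: L.prime_int_iff[OF P p])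
  then obtain k where "N - 1 = int p * k" by (auto simp: dvd_def)
  hence N: "N = 1 + int p * k" by simp
  \<comment> \<open>Multiplying \<open>x - x * e\<close>, a multiple of \<open>p\<close>, by the
    cofactor \<open>w\<close> gives \<open>x * N\<close>, and \<open>N\<close> is 1 modulo
    \<open>p\<close>.\<close>
  have "x / of_nat p = (x - x ^ (p ^ 4)) / of_nat p * w - of_int k * x"
  proof -
    have "(x - x ^ (p ^ 4)) * w = x * ((1 - e) * w)" by (simp add: xpe(1) algebra_simps)
    also have "\<dots> = x * of_int N" using w by simp
    also have "\<dots> = x + of_nat p * (of_int k * x)" by (simp add: N algebra_simps)
    finally have "(x - x ^ (p ^ 4)) / of_nat p * w = x / of_nat p + of_int k * x"
      using p_pos by (simp add: field_simps)
    thus ?thesis by simp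
  qed
  also have "algebraic_int \<dots>"
    using xe w(1) x L.O_int unfolding cong_int_def
    by (intro algebraic_int_diff algebraic_int_mult) auto
  finally show ?thesis .
qed

end

end

subsection \<open>The ideal norm\<close>

context cyclotomic_5_mod_8
begin

lemma sig_image_OL: "\<not> l dvd a \<Longrightarrow> sig a ` L.\<O> = L.\<O>"
proof -
  assume a: "\<not> l dvd a"
  obtain b where b: "\<not> l dvd b" "[a * b = 1] (mod l)" using inverse_mod[OF a] by blast
  have "x \<in> sig a ` L.\<O>" if "x \<in> L.\<O>" for x
    using sig_inverse[OF L.O_F[OF that] a b] sig_OL[OF that b(1)] by (metis imageI)
  thus ?thesis using sig_OL a by blast
qed

lemma frac_sig:
  assumes I: "fractional_ideal L I" and a: "\<not> l dvd a"
  shows "fractional_ideal L (sig a ` I)"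
proof -
  obtain x where x: "x \<in> I" "x \<noteq> 0" using L.frac_nonzero[OF I] by blast
  obtain d where d: "d \<in> L.\<O>" "d \<noteq> 0" "\<And>x. x \<in> I \<Longrightarrow> d * x \<in> L.\<O>"
    using I unfolding fractional_ideal_def by blast
  have IE: "x \<in> E" "x \<in> L" if "x \<in> I" for x using L.frac_subset[OF I that] L_E by auto
  show ?thesis
  proof (rule L.fractional_idealI[of _ "sig a x" "sig a d"])
    show "sig a ` I \<subseteq> L" using IE sig_L a by auto
    show "sig a x \<in> sig a ` I" "sig a x \<noteq> 0" using x sig_nonzero IE a by auto
    show "sig a d \<in> L.\<O>" "sig a d \<noteq> 0"
      using d sig_OL sig_nonzero L_E L.O_F a by auto
  next
    fix y assume "y \<in> sig a ` I"
    then obtain z where z: "y = sig a z" "z \<in> I" by blast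
    have "sig a d * y = sig a (d * z)" using z IE d L_E[OF L.O_F[OF d(1)]] a by (simp add: sig_mult)
    thus "sig a d * y \<in> L.\<O>" using sig_OL[OF d(3)[OF z(2)] a] by simp
  next
    fix y z assume "y \<in> sig a ` I" "z \<in> sig a ` I"
    then obtain u v where uv: "y = sig a u" "u \<in> I" "z = sig a v" "v \<in> I" by blast
    have "y + z = sig a (u + v)" using uv IE a by (simp add: sig_add)
    thus "y + z \<in> sig a ` I" using L.frac_add[OF I uv(2,4)] by blast
  next
    fix c y assume c: "c \<in> L.\<O>" "y \<in> sig a ` I"
    then obtain u where u: "y = sig a u" "u \<in> I" by blast
    obtain c' where c': "c = sig a c'" "c' \<in> L.\<O>" using c(1) sig_image_OL[OF a] by blast
    have "c * y = sig a (c' * u)" using u c' IE L_E[OF L.O_F[OF c'(2)]] a by (simp add: sig_mult)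
    thus "c * y \<in> sig a ` I" using L.frac_mult[OF I c'(2) u(2)] by blast
  qed
qed

text \<open>The relative norm from \<open>L\<close> to \<open>K\<close>, kept as an ideal of
  \<open>L\<close>: the product of the conjugates over representatives of the Galois group.\<close>

definition ideal_norm :: "complex set \<Rightarrow> complex set" where
  "ideal_norm I = finprod L.FI (\<lambda>a. sig a ` I) H"

lemma sig_funcset: "fractional_ideal L I \<Longrightarrow> (\<lambda>a. sig a ` I) \<in> H \<rightarrow> carrier L.FI"
  using frac_sig H_units by simp

lemma frac_ideal_norm: "fractional_ideal L I \<Longrightarrow> fractional_ideal L (ideal_norm I)"
  using L.FI.finprod_closed[OF sig_funcset] by (simp add: ideal_norm_def)

lemma ideal_norm_mult:
  assumes "fractional_ideal L I" "fractional_ideal L J"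
  shows "ideal_norm (I \<star> J) = ideal_norm I \<star> ideal_norm J"
proof -
  have "ideal_norm (I \<star> J) = finprod L.FI (\<lambda>a. sig a ` I \<otimes>\<^bsub>L.FI\<^esub> sig a ` J) H"
    unfolding ideal_norm_def
  proof (rule L.FI.finprod_cong')
    show "(\<lambda>a. sig a ` I \<otimes>\<^bsub>L.FI\<^esub> sig a ` J) \<in> H \<rightarrow> carrier L.FI"
      using assms frac_sig H_units L.frac_prod by simp
    fix a assume "a \<in> H"
    hence a: "\<not> l dvd a" by (rule H_units)
    have "sig a ` (I \<star> J) = sig a ` I \<star> sig a ` J"
    proof (rule set_prod_image_hom[of _ L])
      show "I \<subseteq> L" "J \<subseteq> L" using assms L.frac_subset by auto
    qed (auto intro: L.add_F L.mult_F simp: sig_add sig_mult a L_E)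
    thus "sig a ` (I \<star> J) = sig a ` I \<otimes>\<^bsub>L.FI\<^esub> sig a ` J" by simp
  qed simp
  also have "\<dots> = ideal_norm I \<star> ideal_norm J"
    unfolding ideal_norm_def using L.FI.finprod_multf[OF sig_funcset sig_funcset] assms by simp
  finally show ?thesis .
qed

lemma principal_mult: "(*) c ` L.\<O> \<star> (*) d ` L.\<O> = (*) (c * d) ` L.\<O>"
  by (simp only: set_prod_scale set_prod_scale_right L.O_set_prod[OF L.frac_O] scale_scale mult.commute)

lemma finprod_principal:
  assumes "finite T" "\<And>a. a \<in> T \<Longrightarrow> f a \<in> L" "\<And>a. a \<in> T \<Longrightarrow> f a \<noteq> 0"
  shows "finprod L.FI (\<lambda>a. (*) (f a) ` L.\<O>) T = (*) (\<Prod>a\<in>T. f a) ` L.\<O>"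
  using assms
proof (induction T rule: finite_induct)
  case (insert b T)
  have fr: "fractional_ideal L ((*) (f a) ` L.\<O>)" if "a \<in> Set.insert b T" for a
    using insert.prems that by (intro L.frac_scale L.frac_O) auto
  have "finprod L.FI (\<lambda>a. (*) (f a) ` L.\<O>) (Set.insert b T)
      = (*) (f b) ` L.\<O> \<star> finprod L.FI (\<lambda>a. (*) (f a) ` L.\<O>) T"
    using L.FI.finprod_insert[OF insert.hyps, of "\<lambda>a. (*) (f a) ` L.\<O>"] fr by simp
  also have "finprod L.FI (\<lambda>a. (*) (f a) ` L.\<O>) T = (*) (\<Prod>a\<in>T. f a) ` L.\<O>"
    using insert by simp
  also have "(*) (f b) ` L.\<O> \<star> \<dots> = (*) (\<Prod>a\<in>Set.insert b T. f a) ` L.\<O>"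
    unfolding principal_mult using insert.hyps by simp
  finally show ?case .
qed simp

text \<open>Together with \<open>H_separated\<close>: \<open>H\<close> meets each pair
  \<open>c\<close>, \<open>-c\<close> of squares exactly once.\<close>

lemma H_fold:
  assumes "\<not> l dvd c" "chi c = 1"
  shows "\<exists>a\<in>H. [a = c] (mod l) \<or> [a = (l - 1) * c] (mod l)"
proof -
  define r where "r = c mod l"
  have r: "r \<in> {1..<l}" using assms(1) l0 by (auto simp: r_def dvd_eq_mod_eq_0 Suc_le_eq)
  have rc: "[r = c] (mod l)" by (simp add: r_def cong_def)
  have chi_r: "chi r = 1" using assms(2) by (simp add: r_def)
  show ?thesis
  proof (cases "r \<le> h")
    case True
    thus ?thesis using r chi_r rc by (auto simp: H_def)
  next
    case False
    have "l - r \<in> H" using False r chi_r chi_neg[OF r] l_eq by (auto simp: H_def)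
    moreover have "(l - 1) * r = l * (r - 1) + (l - r)" using r by (auto simp: algebra_simps diff_mult_distrib2)
    hence "[l - r = (l - 1) * r] (mod l)" by (simp add: cong_def)
    hence "[l - r = (l - 1) * c] (mod l)" using rc by (meson cong_mult cong_refl cong_trans)
    ultimately show ?thesis by blast
  qed
qed

lemma H_separated:
  assumes "a \<in> H" "b \<in> H" "[a = b] (mod l) \<or> [a = (l - 1) * b] (mod l)" shows "a = b"
proof -
  have ab: "1 \<le> a" "a \<le> h" "1 \<le> b" "b \<le> h" using assms(1,2) by (auto simp: H_def)
  have "\<not> [a = (l - 1) * b] (mod l)"
  proof
    assume "[a = (l - 1) * b] (mod l)"
    hence "[a + b = (l - 1) * b + b] (mod l)" by (intro cong_add cong_refl)
    moreover have "(l - 1) * b + b = l * b" using l0 by (cases l) auto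
    ultimately have "(a + b) mod l = 0" by (simp add: cong_def)
    hence "l dvd a + b" by (simp add: dvd_eq_mod_eq_0)
    thus False using ab l_eq by (auto dest: dvd_imp_le)
  qed
  hence "[a = b] (mod l)" using assms(3) by simp
  thus ?thesis using ab l_eq by (simp add: cong_def)
qed

lemma sig_fold:
  assumes "x \<in> L" "\<not> l dvd c" "[a = c] (mod l) \<or> [a = (l - 1) * c] (mod l)"
  shows "sig a x = sig c x"
  using assms(3) sig_cong[of a c] sig_cong[of a "(l - 1) * c"] sig_neg[OF assms(1,2)] by auto

text \<open>Multiplication by a square \<open>b\<close> permutes \<open>H\<close> up to sign, and
  signs are invisible on \<open>L\<close>; so \<open>sig b\<close> only permutes the
  factors.\<close>

lemma norm_in_K:
  assumes c: "c \<in> L" shows "(\<Prod>a\<in>H. sig a c) \<in> K"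
proof -
  have E: "(\<Prod>a\<in>H. sig a c) \<in> E" using H_units sig_E L_E[OF c] by (intro E_prod) auto
  have "sig b (\<Prod>a\<in>H. sig a c) = (\<Prod>a\<in>H. sig a c)" if b: "chi b = 1" "\<not> l dvd b" for b
  proof -
    have ab: "\<not> l dvd a * b" "chi (a * b) = 1" if "a \<in> H" for a
      using b H_units[OF _] that not_dvd_mult chi_mult by auto
    have "\<forall>a. \<exists>r. a \<in> H \<longrightarrow> r \<in> H \<and> ([r = a * b] (mod l) \<or> [r = (l - 1) * (a * b)] (mod l))"
      using H_fold ab by blast
    then obtain \<rho> where \<rho>: "\<And>a. a \<in> H \<Longrightarrow> \<rho> a \<in> H"
      "\<And>a. a \<in> H \<Longrightarrow> [\<rho> a = a * b] (mod l) \<or> [\<rho> a = (l - 1) * (a * b)] (mod l)" by metis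
    obtain b' where b': "\<not> l dvd b'" "[b * b' = 1] (mod l)" using inverse_mod[OF b(2)] by blast
    \<comment> \<open>Multiplying by the inverse of \<open>b\<close> recovers \<open>a\<close> from
      \<open>\<rho> a\<close> up to sign, and \<open>H_separated\<close> settles the sign.\<close>
    have inj: "inj_on \<rho> H"
    proof (rule inj_onI)
      fix x y assume xy: "x \<in> H" "y \<in> H" "\<rho> x = \<rho> y"
      have c1: "[\<rho> a * b' = a] (mod l) \<or> [\<rho> a * b' = (l - 1) * a] (mod l)" if "a \<in> H" for a
      proof -
        have bb: "[u * (b * b') = u] (mod l)" for u
          using cong_mult[OF cong_refl[of u l] b'(2)] by simp
        have "[\<rho> a * b' = a * b * b'] (mod l) \<or> [\<rho> a * b' = (l - 1) * (a * b) * b'] (mod l)"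
          using \<rho>(2)[OF that] cong_mult[OF _ cong_refl[of b' l]] by blast
        moreover have "a * b * b' = a * (b * b')" "(l - 1) * (a * b) * b' = ((l - 1) * a) * (b * b')"
          by (simp_all only: mult.assoc)
        ultimately show ?thesis using bb[of a] bb[of "(l - 1) * a"] by (metis cong_trans)
      qed
      have m: "[u = (l - 1) * v] (mod l)" if "[(l - 1) * u = v] (mod l)" for u v
        using cong_mult[OF cong_refl[of "l - 1" l] that] minus_1_square[of u] by (meson cong_sym cong_trans)
      have "[x = y] (mod l) \<or> [x = (l - 1) * y] (mod l)"
        using c1[OF xy(1)] c1[OF xy(2)] unfolding xy(3)
      proof (elim disjE)
        assume "[\<rho> y * b' = x] (mod l)" "[\<rho> y * b' = y] (mod l)"
        thus ?thesis by (meson cong_sym cong_trans)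
      next
        assume "[\<rho> y * b' = x] (mod l)" "[\<rho> y * b' = (l - 1) * y] (mod l)"
        thus ?thesis by (meson cong_sym cong_trans)
      next
        assume "[\<rho> y * b' = (l - 1) * x] (mod l)" "[\<rho> y * b' = y] (mod l)"
        hence "[(l - 1) * x = y] (mod l)" by (meson cong_sym cong_trans)
        thus ?thesis using m by blast
      next
        assume "[\<rho> y * b' = (l - 1) * x] (mod l)" "[\<rho> y * b' = (l - 1) * y] (mod l)"
        hence "[(l - 1) * x = (l - 1) * y] (mod l)" by (meson cong_sym cong_trans)
        hence "[x = (l - 1) * ((l - 1) * y)] (mod l)" by (rule m)
        thus ?thesis using minus_1_square[of y] cong_trans by blast
      qed
      thus "x = y" by (rule H_separated[OF xy(1,2)])
    qed
    have "\<rho> ` H = H" using \<rho>(1) inj finite_H by (intro endo_inj_surj) auto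
    hence bij: "bij_betw \<rho> H H" using inj by (simp add: bij_betw_def)
    have "sig b (\<Prod>a\<in>H. sig a c) = (\<Prod>a\<in>H. sig b (sig a c))"
      using b(2) H_units sig_E L_E[OF c] by (intro sig_prod) auto
    also have "\<dots> = (\<Prod>a\<in>H. sig (\<rho> a) c)"
    proof (intro prod.cong refl)
      fix a assume a: "a \<in> H"
      have "sig b (sig a c) = sig (a * b) c" using a b(2) H_units(2) L_E[OF c] by (simp add: sig_sig mult.commute)
      also have "\<dots> = sig (\<rho> a) c" using sig_fold[OF c ab(1)[OF a] \<rho>(2)[OF a]] by simp
      finally show "sig b (sig a c) = sig (\<rho> a) c" .
    qed
    also have "\<dots> = (\<Prod>a\<in>H. sig a c)" by (rule prod.reindex_bij_betw[OF bij])
    finally show ?thesis .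
  qed
  thus ?thesis using E by (simp add: K_def Fix_def)
qed

lemma ideal_norm_principal:
  assumes c: "c \<in> L" "c \<noteq> 0"
  shows "ideal_norm ((*) c ` L.\<O>) = (*) (\<Prod>a\<in>H. sig a c) ` L.\<O>" "(\<Prod>a\<in>H. sig a c) \<noteq> 0"
proof -
  have nz: "sig a c \<noteq> 0" "sig a c \<in> L" if "a \<in> H" for a
    using sig_nonzero sig_L c L_E[OF c(1)] H_units(2)[OF that] by auto
  have "ideal_norm ((*) c ` L.\<O>) = finprod L.FI (\<lambda>a. (*) (sig a c) ` L.\<O>) H"
    unfolding ideal_norm_def
  proof (rule L.FI.finprod_cong')
    show "(\<lambda>a. (*) (sig a c) ` L.\<O>) \<in> H \<rightarrow> carrier L.FI"
      using nz by (auto intro!: L.frac_scale L.frac_O)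
    fix a assume "a \<in> H"
    hence a: "\<not> l dvd a" by (rule H_units)
    have "sig a ` (*) c ` L.\<O> = (\<lambda>x. sig a c * sig a x) ` L.\<O>"
      unfolding image_image using a L_E L.O_F L_E[OF c(1)] by (intro image_cong refl) (simp add: sig_mult)
    also have "\<dots> = (*) (sig a c) ` sig a ` L.\<O>" by (simp add: image_image)
    finally show "sig a ` (*) c ` L.\<O> = (*) (sig a c) ` L.\<O>" by (simp only: sig_image_OL[OF a])
  qed simp
  also have "\<dots> = (*) (\<Prod>a\<in>H. sig a c) ` L.\<O>" using nz by (intro finprod_principal finite_H) auto
  finally show "ideal_norm ((*) c ` L.\<O>) = (*) (\<Prod>a\<in>H. sig a c) ` L.\<O>" .
  show "(\<Prod>a\<in>H. sig a c) \<noteq> 0" using nz finite_H by simp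
qed

text \<open>The norm of a nonzero element provides a positive integer in \<open>P\<close>; primality
  descends to one of its prime factors.\<close>

lemma prime_contains_rational_prime:
  assumes P: "P \<in> primes_of L"
  obtains p :: nat where "Factorial_Ring.prime p" "of_nat p \<in> P"
proof -
  obtain x where x: "x \<in> P" "x \<noteq> 0" using L.frac_nonzero[OF L.prime_frac[OF P]] by blast
  have xO: "x \<in> L.\<O>" by (rule L.prime_subset[OF P x(1)])
  obtain w N where w: "w \<in> L.\<O>" "nrm x = x * w" "nrm x = of_int N" using conj_prod_factor[OF xO] by blast
  have NP: "of_int N \<in> P" using L.prime_mult[OF P w(1) x(1)] w by (simp add: mult.commute)
  have "N \<noteq> 0" using nrm_nonzero[OF L_E[OF L.O_F[OF xO]] x(2)] w(3) by auto
  moreover have "of_nat (nat \<bar>N\<bar>) \<in> P"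
    using NP L.prime_uminus[OF P NP] by (cases "N \<ge> 0") (simp_all add: of_nat_nat)
  ultimately have "\<exists>m::nat. m > 0 \<and> of_nat m \<in> P" by (intro exI[of _ "nat \<bar>N\<bar>"]) simp
  then obtain m :: nat where m: "m > 0" "of_nat m \<in> P" by blast
  hence "\<exists>p::nat. Factorial_Ring.prime p \<and> of_nat p \<in> P"
  proof (induction m rule: less_induct)
    case (less m)
    have "m \<noteq> 1" using less.prems L.prime_not_one[OF P] by auto
    then obtain q where q: "Factorial_Ring.prime q" "q dvd m" using prime_factor_nat by blast
    then obtain k where k: "m = q * k" by (auto simp: dvd_def)
    have "of_nat q * of_nat k \<in> P" using less.prems k by simp
    hence "of_nat q \<in> P \<or> of_nat k \<in> P" using L.prime_prime[OF P L.of_nat_O L.of_nat_O] by blast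
    moreover have "k < m" "k > 0" using k less.prems(1) q(1) prime_gt_1_nat[of q] by auto
    ultimately show ?case using q(1) less.IH[of k] by blast
  qed
  thus ?thesis using that by blast
qed

text \<open>By \<open>stabilizer_trivial\<close> the conjugates of \<open>P\<close> over
  \<open>K\<close> are distinct, so their product is their intersection. Frobenius stabilises
  \<open>P\<close> and accounts for the automorphisms that move \<open>K\<close>; so an element of
  the intersection has all its conjugates in \<open>P\<close> and is divisible by
  \<open>p\<close>.\<close>

lemma ideal_norm_prime:
  assumes P: "P \<in> primes_of L" and p: "Factorial_Ring.prime p" "of_nat p \<in> P"
    and deg: "residue_degree L \<rat> P = 2"
  shows "ideal_norm P = (*) (of_nat p) ` L.\<O>"
proof -
  have PO: "x \<in> L.\<O>" "x \<in> L" "x \<in> E" if "x \<in> P" for x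
    using L.prime_subset[OF P that] L.O_F L_E by auto
  have "\<forall>a. \<exists>b. a \<in> H \<longrightarrow> \<not> l dvd b \<and> [a * b = 1] (mod l)"
    using inverse_mod H_units(2) by metis
  then obtain \<beta> where \<beta>: "\<And>a. a \<in> H \<Longrightarrow> \<not> l dvd \<beta> a" "\<And>a. a \<in> H \<Longrightarrow> [a * \<beta> a = 1] (mod l)" by metis
  have \<beta>': "[\<beta> a * a = 1] (mod l)" if "a \<in> H" for a using \<beta>(2)[OF that] by (simp add: mult.commute)
  \<comment> \<open>Membership in a conjugate ideal is tested by the inverse automorphism
    \<open>sig (\<beta> a)\<close>.\<close>
  have mem: "x \<in> sig a ` P \<longleftrightarrow> x \<in> L.\<O> \<and> sig (\<beta> a) x \<in> P" if a: "a \<in> H" for a x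
  proof
    assume "x \<in> sig a ` P"
    then obtain y where y: "x = sig a y" "y \<in> P" by blast
    have "sig (\<beta> a) x = y" unfolding y(1)
      by (rule sig_inverse[OF PO(2)[OF y(2)] \<beta>(1)[OF a] H_units(2)[OF a] \<beta>'[OF a]])
    thus "x \<in> L.\<O> \<and> sig (\<beta> a) x \<in> P" using y sig_OL[OF PO(1)[OF y(2)] H_units(2)[OF a]] by simp
  next
    assume x: "x \<in> L.\<O> \<and> sig (\<beta> a) x \<in> P"
    hence "x = sig a (sig (\<beta> a) x)"
      using sig_inverse[OF L.O_F H_units(2)[OF a] \<beta>(1)[OF a] \<beta>(2)[OF a], of x] by simp
    thus "x \<in> sig a ` P" using x by blast
  qed
  have p0: "p > 0" using p(1) prime_gt_0_nat by blast
  have "ideal_norm P = {x \<in> L.\<O>. \<forall>a\<in>H. x \<in> sig a ` P}"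
    unfolding ideal_norm_def
  proof (rule L.finprod_primes[OF finite_H])
    fix i assume i: "i \<in> H"
    note ui = H_units(2)[OF i]
    note bi = \<beta>(1)[OF i]
    show "fractional_ideal L (sig i ` P)" by (rule frac_sig[OF L.prime_frac[OF P] ui])
    show "sig i ` P \<subseteq> L.\<O>" using mem[OF i] by blast
    show "1 \<notin> sig i ` P" using mem[OF i] bi L.prime_not_one[OF P] by simp
    show "x \<in> sig i ` P \<or> y \<in> sig i ` P" if xy: "x \<in> L.\<O>" "y \<in> L.\<O>" "x * y \<in> sig i ` P" for x y
    proof -
      have "sig (\<beta> i) (x * y) \<in> P" using xy(3) mem[OF i] by blast
      hence "sig (\<beta> i) x * sig (\<beta> i) y \<in> P" using xy(1,2) L.O_F L_E bi by (simp add: sig_mult)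
      hence "sig (\<beta> i) x \<in> P \<or> sig (\<beta> i) y \<in> P" using xy(1,2) sig_OL bi by (intro L.prime_prime[OF P]) auto
      thus ?thesis using mem[OF i] xy(1,2) by blast
    qed
    show "\<exists>y\<in>L.\<O>. 1 - x * y \<in> sig i ` P" if x: "x \<in> L.\<O>" "x \<notin> sig i ` P" for x
    proof -
      have "sig (\<beta> i) x \<notin> P" using x mem[OF i] by blast
      then obtain y where y: "y \<in> L.\<O>" "1 - sig (\<beta> i) x * y \<in> P"
        using L.prime_inverse[OF P p0 p(2) sig_OL[OF x(1) bi]] by blast
      have sy: "sig i y \<in> L.\<O>" by (rule sig_OL[OF y(1) ui])
      have "sig (\<beta> i) (1 - x * sig i y) = 1 - sig (\<beta> i) x * y"
        using sig_inverse[OF L.O_F[OF y(1)] bi ui \<beta>'[OF i]] L_E[OF L.O_F[OF sy]] L_E[OF L.O_F[OF x(1)]] bi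
        by (simp add: sig_diff sig_mult E_rat E_mult)
      hence "1 - x * sig i y \<in> sig i ` P"
        using mem[OF i, of "1 - x * sig i y"] y(2) L.diff_O[OF L.one_O L.mult_O[OF x(1) sy]] by simp
      thus ?thesis using sy by blast
    qed
    show "\<not> sig j ` P \<subseteq> sig i ` P" if j: "j \<in> H" "i \<noteq> j" for j
    proof
      \<comment> \<open>The inclusion says that \<open>sig (\<beta> i * j)\<close> stabilises
        \<open>P\<close>, so \<open>j\<close> equals \<open>i\<close> up to sign, and
        \<open>H\<close> separates them.\<close>
      assume sub: "sig j ` P \<subseteq> sig i ` P"
      note uj = H_units(2)[OF j(1)]
      have d: "\<not> l dvd \<beta> i * j" by (rule not_dvd_mult[OF bi uj])
      have chi_b: "chi (\<beta> i) = 1"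
        using chi_mult[OF ui bi] chi_congr[OF \<beta>(2)[OF i]] H_units(3)[OF i] by simp
      have "[\<beta> i * j = 1] (mod l) \<or> [\<beta> i * j = l - 1] (mod l)"
      proof (rule stabilizer_trivial[OF P p deg d])
        fix y assume y: "y \<in> P"
        hence "sig (\<beta> i) (sig j y) \<in> P" using sub mem[OF i] by blast
        thus "sig (\<beta> i * j) y \<in> P" using PO(3)[OF y] bi uj by (simp add: sig_sig)
      next
        show "chi (\<beta> i * j) = 1" using chi_mult[OF bi uj] chi_b H_units(3)[OF j(1)] by simp
      qed
      hence "[i * (\<beta> i * j) = i * 1] (mod l) \<or> [i * (\<beta> i * j) = i * (l - 1)] (mod l)"
        using cong_mult[OF cong_refl[of i l]] by blast
      moreover have "[i * (\<beta> i * j) = j] (mod l)"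
        using cong_mult[OF \<beta>(2)[OF i] cong_refl[of j l]] by (simp add: mult.assoc)
      ultimately have "[j = i] (mod l) \<or> [j = (l - 1) * i] (mod l)"
        by (metis cong_sym cong_trans mult.commute mult.right_neutral)
      thus False using H_separated[OF j(1) i] j(2) by simp
    qed
  qed
  also have "\<dots> = (*) (of_nat p) ` L.\<O>"
  proof
    show "(*) (of_nat p) ` L.\<O> \<subseteq> {x \<in> L.\<O>. \<forall>a\<in>H. x \<in> sig a ` P}"
    proof clarify
      fix x assume x: "x \<in> L.\<O>"
      have "of_nat p * x \<in> sig a ` P" if a: "a \<in> H" for a
      proof -
        have "sig (\<beta> a) (of_nat p * x) = sig (\<beta> a) x * of_nat p"
          using \<beta>(1)[OF a] L_E[OF L.O_F[OF x]] by (simp add: sig_mult sig_rat E_rat)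
        also have "\<dots> \<in> P" by (intro L.prime_mult[OF P] sig_OL x \<beta>(1)[OF a] p(2))
        finally show ?thesis using mem[OF a] x L.mult_O L.of_nat_O by blast
      qed
      thus "of_nat p * x \<in> L.\<O> \<and> (\<forall>a\<in>H. of_nat p * x \<in> sig a ` P)"
        using x L.mult_O L.of_nat_O by blast
    qed
    show "{x \<in> L.\<O>. \<forall>a\<in>H. x \<in> sig a ` P} \<subseteq> (*) (of_nat p) ` L.\<O>"
    proof
      fix x assume x: "x \<in> {x \<in> L.\<O>. \<forall>a\<in>H. x \<in> sig a ` P}"
      have res: "sig c x \<in> P" if c: "\<not> l dvd c" "chi c = 1" for c
      proof -
        obtain c' where c': "\<not> l dvd c'" "[c * c' = 1] (mod l)" using inverse_mod[OF c(1)] by blast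
        have "chi c' = 1" using chi_mult[OF c(1) c'(1)] chi_congr[OF c'(2)] c(2) by simp
        then obtain a where a: "a \<in> H" "[a = c'] (mod l) \<or> [a = (l - 1) * c'] (mod l)"
          using H_fold[OF c'(1)] by blast
        obtain y where y: "x = sig a y" "y \<in> P" using x a(1) by blast
        have "x = sig c' y" using y sig_fold[OF PO(2)[OF y(2)] c'(1) a(2)] by simp
        hence "sig c x = y" using sig_inverse[OF PO(2)[OF y(2)] c(1) c'(1) c'(2)] by simp
        thus ?thesis using y by simp
      qed
      note lp = not_l_dvd_p[OF P p deg]
      have "sig c x \<in> P" if c: "\<not> l dvd c" for c
      proof (cases "chi c = 1")
        case False
        hence chi_c: "chi c = -1" using chi_pm1 by blast
        \<comment> \<open>\<open>p ^ 3 * c\<close> is a product of four non-residues, hence a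
          residue, and one more Frobenius returns to \<open>c\<close> because \<open>p ^ 4\<close>
          is 1 modulo \<open>l\<close>.\<close>
        have u: "\<not> l dvd p * (p * (p * c))" by (intro not_dvd_mult lp c)
        have "chi (p * (p * (p * c))) = 1"
          using chi_p[OF P p deg] chi_c by (simp add: chi_mult not_dvd_mult lp c)
        hence "sig (p * (p * (p * c))) x \<in> P" by (rule res[OF u])
        hence "sig p (sig (p * (p * (p * c))) x) \<in> P" by (rule sig_p_P[OF P p deg])
        moreover have "sig p (sig (p * (p * (p * c))) x) = sig (p * (p * (p * (p * c)))) x"
          using x L.O_F L_E by (intro sig_sig lp u) auto
        moreover have "[p * (p * (p * (p * c))) = c] (mod l)"
        proof -
          have "p * (p * (p * (p * c))) = (p * p) * ((p * p) * c)" by (simp add: mult_ac)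
          moreover have "[(p * p) * ((p * p) * c) = (l - 1) * ((l - 1) * c)] (mod l)"
            by (intro cong_mult cong_refl p_square[OF P p deg])
          ultimately show ?thesis using minus_1_square[of c] by (metis cong_trans)
        qed
        ultimately show ?thesis using sig_cong by metis
      qed (rule res[OF c])
      hence "algebraic_int (x / of_nat p)" using x by (intro conjugates_in_prime[OF P p deg]) auto
      hence "x / of_nat p \<in> L.\<O>" using x by (intro L.OI L.divide_F L.of_nat_F) (auto intro: L.O_F)
      moreover have "x = of_nat p * (x / of_nat p)" using p0 by simp
      ultimately show "x \<in> (*) (of_nat p) ` L.\<O>" by blast
    qed
  qed
  finally show ?thesis .
qed

text \<open>The generator is required in \<open>K\<close>, since the conclusion has to descend from
  \<open>L\<close> to \<open>K\<close>.\<close>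

definition norm_principal :: "complex set \<Rightarrow> bool" where
  "norm_principal I \<longleftrightarrow> (\<exists>c\<in>K. c \<noteq> 0 \<and> ideal_norm I = (*) c ` L.\<O>)"

lemma all_norm_principal:
  assumes gen: "2 \<in> generating_residue_degrees L \<rat>" and I: "fractional_ideal L I"
  shows "norm_principal I"
proof -
  define S where "S = {P \<in> primes_of L. unramified L \<rat> P \<and> residue_degree L \<rat> P = 2}"
  have "{ideal_class L P |P. P \<in> primes_of L \<and> unramified L \<rat> P \<and> residue_degree L \<rat> P = 2} = ideal_class L ` S"
    by (auto simp: S_def)
  hence gen': "generate (class_group L) (ideal_class L ` S) = carrier (class_group L)"
    using gen by (simp add: generating_residue_degrees_def)
  show ?thesis
  proof (rule L.class_group_generated_induct[OF gen', where Q = norm_principal])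
    fix P assume "P \<in> S"
    hence P: "P \<in> primes_of L" "residue_degree L \<rat> P = 2" by (auto simp: S_def)
    show "fractional_ideal L P" by (rule L.prime_frac[OF P(1)])
    obtain p :: nat where p: "Factorial_Ring.prime p" "of_nat p \<in> P"
      using prime_contains_rational_prime[OF P(1)] by blast
    have "ideal_norm P = (*) (of_nat p) ` L.\<O>" by (rule ideal_norm_prime[OF P(1) p P(2)])
    moreover have "p > 0" using p(1) prime_gt_0_nat by blast
    ultimately show "norm_principal P" unfolding norm_principal_def
      by (intro bexI[of _ "of_nat p"] K.of_nat_F) auto
  next
    fix c assume "c \<in> L" "c \<noteq> 0"
    thus "norm_principal ((*) c ` L.\<O>)"
      unfolding norm_principal_def using ideal_norm_principal norm_in_K by blast
  next
    fix I J assume IJ: "fractional_ideal L I" "fractional_ideal L J" "norm_principal I" "norm_principal J"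
    obtain c d where c: "c \<in> K" "c \<noteq> 0" "ideal_norm I = (*) c ` L.\<O>"
      and d: "d \<in> K" "d \<noteq> 0" "ideal_norm J = (*) d ` L.\<O>" using IJ by (auto simp: norm_principal_def)
    have "ideal_norm (I \<star> J) = (*) (c * d) ` L.\<O>"
      unfolding ideal_norm_mult[OF IJ(1,2)] c(3) d(3) by (rule principal_mult)
    thus "norm_principal (I \<star> J)" unfolding norm_principal_def using c d K.mult_F
      by (intro bexI[of _ "c * d"]) auto
  next
    fix I J assume IJ: "fractional_ideal L I" "fractional_ideal L J" "I \<star> J = L.\<O>" "norm_principal I"
    obtain c where c: "c \<in> K" "c \<noteq> 0" "ideal_norm I = (*) c ` L.\<O>" using IJ by (auto simp: norm_principal_def)
    have "ideal_norm L.\<O> = L.\<O>"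
      using ideal_norm_principal(1)[OF L.one_F] H_units(2) by simp
    hence "L.\<O> = (*) c ` ideal_norm J"
      using ideal_norm_mult[OF IJ(1,2)] IJ(3) c(3) L.principal_prod[OF frac_ideal_norm[OF IJ(2)]] by simp
    hence "(*) (inverse c) ` L.\<O> = ideal_norm J" using inverse_scale[OF c(2)] by metis
    thus "norm_principal J" unfolding norm_principal_def using c K.inverse_F
      by (intro bexI[of _ "inverse c"]) auto
  qed (rule I)
qed

section \<open>Extension of ideals from \<open>K\<close> to \<open>L\<close>\<close>

lemma OK_subset_OL: "K.\<O> \<subseteq> L.\<O>" using K_subset_L by (auto simp: integers_of_def)

lemma frac_extension:
  assumes I: "fractional_ideal K I" shows "fractional_ideal L (I \<star> L.\<O>)"
proof -
  obtain x where x: "x \<in> I" "x \<noteq> 0" using K.frac_nonzero[OF I] by blast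
  obtain d where d: "d \<in> K.\<O>" "d \<noteq> 0" "\<And>x. x \<in> I \<Longrightarrow> d * x \<in> K.\<O>"
    using I unfolding fractional_ideal_def by blast
  have IL: "x \<in> L" if "x \<in> I" for x using K.frac_subset[OF I that] K_subset_L by blast
  show ?thesis
  proof (rule L.fractional_idealI[of _ x d])
    show "I \<star> L.\<O> \<subseteq> L" by (intro set_prod_subset) (auto intro: L.mult_F L.add_F IL L.O_F)
    show "x \<in> I \<star> L.\<O>" using set_prodI[OF x(1) L.one_O] by simp
    show "d \<in> L.\<O>" using d OK_subset_OL by blast
  next
    fix y assume "y \<in> I \<star> L.\<O>"
    thus "d * y \<in> L.\<O>"
    proof (induction rule: set_prod_induct)
      case (prod a b)
      have "(d * a) * b \<in> L.\<O>"
        by (rule L.mult_O[OF subsetD[OF OK_subset_OL d(3)[OF prod(1)]] prod(2)])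
      thus ?case by (simp add: mult.assoc)
    qed (auto simp: distrib_left intro: L.add_O)
  next
    fix a y assume a: "a \<in> L.\<O>" and "y \<in> I \<star> L.\<O>"
    from this(2) show "a * y \<in> I \<star> L.\<O>"
    proof (induction rule: set_prod_induct)
      case (prod u v)
      have "u * (a * v) \<in> I \<star> L.\<O>" by (intro set_prodI prod L.mult_O a)
      thus ?case by (simp add: mult.left_commute)
    qed (auto simp: distrib_left intro: set_prod_add)
  qed (use x d in \<open>auto intro: set_prod_add\<close>)
qed

lemma extension_O: "K.\<O> \<star> L.\<O> = L.\<O>"
proof
  show "K.\<O> \<star> L.\<O> \<subseteq> L.\<O>" using OK_subset_OL by (intro set_prod_subset L.mult_O L.add_O) auto
  show "L.\<O> \<subseteq> K.\<O> \<star> L.\<O>" using set_prodI[OF K.one_O] by force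
qed

lemma extension_mult: "(I \<star> J) \<star> L.\<O> = (I \<star> L.\<O>) \<star> (J \<star> L.\<O>)"
proof -
  have "(I \<star> L.\<O>) \<star> (J \<star> L.\<O>) = I \<star> J \<star> (L.\<O> \<star> L.\<O>)"
    by (metis set_prod_assoc set_prod_commute)
  thus ?thesis using L.O_set_prod[OF L.frac_O] by simp
qed

text \<open>For \<open>a\<close> in \<open>H\<close>, \<open>sig a\<close> fixes \<open>K\<close>
  pointwise and maps the integers of \<open>L\<close> onto themselves, so all \<open>n\<close>
  factors of the norm equal the extended ideal.\<close>

lemma ideal_norm_extension:
  assumes I: "fractional_ideal K I"
  shows "ideal_norm (I \<star> L.\<O>) = K.ideal_power I n \<star> L.\<O>"
proof -
  have fr: "fractional_ideal L (I \<star> L.\<O>)" by (rule frac_extension[OF I])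
  have fix_ideal: "sig a ` (I \<star> L.\<O>) = I \<star> L.\<O>" if a: "a \<in> H" for a
  proof -
    have "sig a ` (I \<star> L.\<O>) = sig a ` I \<star> sig a ` L.\<O>"
    proof (rule set_prod_image_hom[of _ L])
      show "I \<subseteq> L" using K.frac_subset[OF I] K_subset_L by blast
      show "L.\<O> \<subseteq> L" using L.O_F by blast
    qed (auto intro: L.add_F L.mult_F simp: sig_add sig_mult H_units(2)[OF a] L_E)
    moreover have "sig a ` I = id ` I"
      using K.frac_subset[OF I] H_units[OF a] by (intro image_cong) (auto simp: K_def Fix_def)
    ultimately show ?thesis using sig_image_OL[OF H_units(2)[OF a]] by simp
  qed
  have "ideal_norm (I \<star> L.\<O>) = finprod L.FI (\<lambda>a. I \<star> L.\<O>) H"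
    unfolding ideal_norm_def using fix_ideal fr by (intro L.FI.finprod_cong') auto
  also have "finprod L.FI (\<lambda>a. I \<star> L.\<O>) T = K.ideal_power I (card T) \<star> L.\<O>" if "finite T" for T :: "nat set"
    using that
  proof (induction T rule: finite_induct)
    case empty
    show ?case by (simp add: extension_O)
  next
    case (insert a T)
    have "finprod L.FI (\<lambda>a. I \<star> L.\<O>) (Set.insert a T) = (I \<star> L.\<O>) \<star> finprod L.FI (\<lambda>a. I \<star> L.\<O>) T"
      using L.FI.finprod_insert[OF insert.hyps, of "\<lambda>a. I \<star> L.\<O>"] fr by simp
    thus ?case using insert by (simp add: extension_mult)
  qed
  finally show ?thesis using finite_H card_H by simp
qed

text \<open>An ideal with trivial extension consists of integers of \<open>L\<close> lying in
  \<open>K\<close>. The inverse of \<open>J\<close> also has trivial extension, so both lie in the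
  integers of \<open>K\<close>, which forces equality.\<close>

lemma extension_trivial:
  assumes J: "fractional_ideal K J" "J \<star> L.\<O> = L.\<O>" shows "J = K.\<O>"
proof -
  have sub: "I \<subseteq> K.\<O>" if I: "fractional_ideal K I" "I \<star> L.\<O> = L.\<O>" for I
  proof
    fix x assume x: "x \<in> I"
    hence "x \<in> L.\<O>" using set_prodI[OF x L.one_O] I(2) by simp
    thus "x \<in> K.\<O>" using K.frac_subset[OF I(1) x] by (auto simp: integers_of_def)
  qed
  obtain J' where J': "fractional_ideal K J'" "J \<star> J' = K.\<O>" using K.inverse_ideal_exists[OF J(1)] by blast
  have "J' \<star> L.\<O> = J' \<star> (J \<star> L.\<O>)" using J(2) by simp
  also have "\<dots> = (J \<star> J') \<star> L.\<O>" by (metis set_prod_assoc set_prod_commute)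
  also have "\<dots> = L.\<O>" by (simp add: J'(2) extension_O)
  finally have "J' \<subseteq> K.\<O>" by (rule sub[OF J'(1)])
  hence "J \<star> J' \<subseteq> J \<star> K.\<O>" by (intro set_prod_mono) auto
  also have "\<dots> = J" using K.O_set_prod[OF J(1)] by (simp add: set_prod_commute)
  finally show ?thesis using sub[OF J] J'(2) by blast
qed

text \<open>The norm of the extended ideal is the extension of the \<open>n\<close>-th power and is
  generated by some \<open>c\<close> in \<open>K\<close>; dividing by \<open>c\<close> leaves an
  ideal of \<open>K\<close> with trivial extension.\<close>

lemma power_principal:
  assumes gen: "2 \<in> generating_residue_degrees L \<rat>" and I: "fractional_ideal K I"
  shows "K.ideal_power I n \<in> K.PI"
proof -
  define J where "J = K.ideal_power I n"
  have J: "fractional_ideal K J" unfolding J_def by (rule K.frac_power[OF I])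
  obtain c where c: "c \<in> K" "c \<noteq> 0" "J \<star> L.\<O> = (*) c ` L.\<O>"
    using all_norm_principal[OF gen frac_extension[OF I]] ideal_norm_extension[OF I]
    by (auto simp: norm_principal_def J_def)
  have "((*) (inverse c) ` J) \<star> L.\<O> = L.\<O>"
    using c inverse_scale[OF c(2)] by (simp only: set_prod_scale)
  moreover have "fractional_ideal K ((*) (inverse c) ` J)" using c by (intro K.frac_scale J K.inverse_F) auto
  ultimately have "(*) (inverse c) ` J = K.\<O>" by (intro extension_trivial)
  hence "J = (*) c ` K.\<O>" using inverse_scale[of "inverse c" J] c(2) by simp
  thus ?thesis using c by (auto simp: K.PI_def J_def)
qed

end

theorem corollary1p9:
  fixes l :: nat and \<zeta> :: complex
  assumes "Factorial_Ring.prime l"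
    and "[l = 5] (mod 8)"
    and "primitive_root_of_unity l \<zeta>"
    and "2 \<in> generating_residue_degrees (maximal_real_subfield (rat_adjoin {\<zeta>})) \<rat>"
  shows "(\<forall>p. Factorial_Ring.prime p \<and> p dvd class_number (rat_adjoin {complex_of_real (sqrt (real l))})
            \<longrightarrow> p dvd (l - 1) div 4)
       \<and> odd (class_number (rat_adjoin {complex_of_real (sqrt (real l))}))"
proof -
  have "l \<noteq> 2" using assms(2) by (auto simp: cong_def)
  hence "l > 2" using prime_ge_2_nat[OF assms(1)] by simp
  then interpret cyclotomic_5_mod_8 l \<zeta>
    using assms(1-3) by unfold_locales
  have gen: "2 \<in> generating_residue_degrees L \<rat>" using assms(4) maximal_real_subfield_zeta by simp
  have main: "p dvd n" if "Factorial_Ring.prime p" "p dvd class_number K" for p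
    using K.prime_dvd_class_number[OF that power_principal[OF gen]] .
  \<comment> \<open>Oddness is the case \<open>p = 2\<close>, since \<open>n\<close> is odd.\<close>
  moreover have "odd (class_number K)" using main[of 2] odd_n by auto
  ultimately show ?thesis unfolding rat_adjoin_sqrt_l n_def by blast
qed

end
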